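(* Let $F_\omega$ be a one-variable random self-similar set generated by homogeneous iterated function systems satisfying the uniform open set condition and not almost deterministic (all as defined in the context). Then the following dichotomy holds. (1) Let $\phi$ be a dimension function such that $\sum_{k=1}^\infty e^{-\phi(e^{-k})k}<\infty$. Then for dimension functions $\varphi$ with $\varphi(x)=\omega(\phi(x))$ (i.e. $\phi(x)/\varphi(x)\to0$ as $x\to0$), almost surely $\dim_{\mathrm A}^{\varphi}F_\omega=\dim_{\mathrm B}F_\omega$. (2) Conversely, let $\phi$ be a dimension function such that $\sum_{k=1}^\infty e^{-\phi(e^{-k})k}=\infty$. Then for dimension functions $\varphi$ with $\varphi(x)=o(\phi(x))$ (i.e. $\varphi(x)/\phi(x)\to0$ as $x\to0$), almost surely $\dim_{\mathrm A}^{\varphi}F_\omega=\dim_{\mathrm A}F_\omega$. (3) In the situation of (2), assume additionally that there exists $\Lambda'\subset\Lambda$ with $\mu(\Lambda')>0$ such that $\mathfrak S_\lambda^{s_A}=1$ for all $\lambda\in\Lambda'$, where $s_A$ is the almost sure value of $\dim_{\mathrm A}F_\omega$. Then there is a constant $C>0$ such that the conclusion of (2), namely that almost surely $\dim_{\mathrm A}^{\varphi}F_\omega=\dim_{\mathrm A}F_\omega$, holds for all dimension functions $\varphi$ with $\varphi(x)\le C\phi(x)$.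
   Context: Dimension function: a function $\phi$ with values in $(0,\infty)$ such that $x\mapsto\phi(x)$ and $x\mapsto\phi(x)|\log x|$ are both monotone on $(0,1)$. Generalised Assouad spectrum: for a metric space $F$ let $N_r(E)$ be the minimal number of balls of radius at most $r$ needed to cover $E$, and let $B(x,R)$ be the ball of radius $R$ centred at $x$. For a dimension function $\phi$, $\dim_{\mathrm A}^{\phi}F$ is the infimum of all $s$ for which there is $C'>0$ such that for all $0<R<1$, with $r=R^{1+\phi(R)}$, one has $\sup_{x\in F}N_r(F\cap B(x,R))\le C'(R/r)^s=C' R^{-\phi(R)s}$. The Assouad dimension $\dim_{\mathrm A}F$ is the infimum of all $s$ for which there is $C'>0$ such that $\sup_{x\in F}N_r(F\cap B(x,R))\le C'(R/r)^s$ for all $0<r\le R<1$. $\dim_{\mathrm B}$ is the box-counting dimension. One-variable random self-similar sets: $\Lambda\subset\mathbb{R}^n$ is a compact set supporting a Borel probability measure $\mu$. To each $\lambda\in\Lambda$ is associated an iterated function system $\mathbb I_\lambda=\{f_1^\lambda,\dots,f_{N_\lambda}^\lambda\}$ of strictly contracting similarities on a common non-empty open subset $V$ of a Euclidean space, $|f_i^\lambda(x)-f_i^\lambda(y)|=c_i^\lambda|x-y|$ for $x,y\in V$. Standing assumptions: $\sup_\lambda N_\lambda<\infty$; $0<\inf_{\lambda,i}c_i^\lambda\le\sup_{\lambda,i}c_i^\lambda<1$; and there is a non-empty compact set $\Delta\subset V$ with $f_i^\lambda(\Delta)\subseteq\Delta$ for all $\lambda$ and $i$. Let $\Omega=\Lambda^{\mathbb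 N}$ with product measure $\mathbb P=\mu^{\mathbb N}$. For $\omega=(\omega_1,\omega_2,\dots)\in\Omega$, $$F_\omega=\bigcap_{k=1}^\infty\ \bigcup_{\substack{1\le i_j\le N_{\omega_j}\\ 1\le j\le k}} f_{i_1}^{\omega_1}\circ\cdots\circ f_{i_k}^{\omega_k}(\Delta).$$ "Almost surely" refers to $\omega$ chosen according to $\mathbb P$. Homogeneous: for each $\lambda$, $c_i^\lambda=c_j^\lambda=:c(\lambda)$ for all $i,j$. Write $\mathfrak S_\lambda^t=\sum_{i=1}^{N_\lambda}(c_i^\lambda)^t=N_\lambda c(\lambda)^t$. Uniform open set condition: there is a non-empty open set $U$ such that for every $\lambda$, $f_i^\lambda(U)\subseteq U$ for all $i$ and the union $\bigcup_{i=1}^{N_\lambda}f_i^\lambda(U)$ is disjoint. Not almost deterministic: $\mathbb P(\mathfrak S_{\omega_1}^s=1)\ne1$, where $s$ is the unique number satisfying $\exp\int_\Omega\log\mathfrak S^s_{\omega_1}\,d\mathbb P(\omega)=1$. It is known that under these assumptions, almost surely $\dim_{\mathrm B}F_\omega=s$ and $\dim_{\mathrm A}F_\omega=s_A:=\sup\{t:\mu(\{\lambda\in\Lambda:\mathfrak S_\lambda^t\ge1\})>0\}$.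
   Formalization: In (2) and (3) the dimension function φ-variant ϕ is additionally required to satisfy ϕ(x)|log x| → ∞ as x → 0; otherwise the claim fails, e.g. φ(x)=1/|log x|, ϕ(x)=1/|log x|² in (2), where the spectrum is at most s < s_A. *)

theory Defs
  imports "HOL-Probability.Probability"
begin

definition dimension_function :: "(real \<Rightarrow> real) \<Rightarrow> bool" where
  "dimension_function \<phi> \<longleftrightarrow>
     (\<forall>x\<in>{0<..<1}. 0 < \<phi> x) \<and>
     (mono_on {0<..<1} \<phi> \<or> antimono_on {0<..<1} \<phi>) \<and>
     (mono_on {0<..<1} (\<lambda>x. \<phi> x * \<bar>ln x\<bar>) \<or> antimono_on {0<..<1} (\<lambda>x. \<phi> x * \<bar>ln x\<bar>))"

text \<open>The value is \<open>\<infinity>\<close> if no finite cover exists.  The centres of the covering balls may be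
  arbitrary points of the ambient metric space; restricting them to the covered set would change
  the dimensions below by nothing.\<close>

definition covering_number :: "real \<Rightarrow> 'b::metric_space set \<Rightarrow> enat" where
  "covering_number r E =
     Inf {enat (card \<B>) |\<B>. finite \<B> \<and> (\<forall>B\<in>\<B>. \<exists>x \<rho>. \<rho> \<le> r \<and> B = cball x \<rho>) \<and> E \<subseteq> \<Union>\<B>}"

definition generalised_assouad_spectrum ::
    "(real \<Rightarrow> real) \<Rightarrow> 'b::metric_space set \<Rightarrow> ereal" where
  "generalised_assouad_spectrum \<phi> F =
     Inf {ereal s |s. \<exists>C>0. \<forall>R\<in>{0<..<1}. let r = R powr (1 + \<phi> R) in
            ereal_of_enat (SUP x\<in>F. covering_number r (F \<inter> cball x R))
              \<le> ereal (C * (R / r) powr s)}"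

definition assouad_dimension :: "'b::metric_space set \<Rightarrow> ereal" where
  "assouad_dimension F =
     Inf {ereal s |s. \<exists>C>0. \<forall>r R. 0 < r \<and> r \<le> R \<and> R < 1 \<longrightarrow>
            ereal_of_enat (SUP x\<in>F. covering_number r (F \<inter> cball x R))
              \<le> ereal (C * (R / r) powr s)}"

text \<open>A relation rather than a function: it says that the box-counting dimension of \<open>F\<close> exists
  (upper and lower values agree) and equals \<open>d\<close>.\<close>

definition has_box_dimension :: "'b::metric_space set \<Rightarrow> ereal \<Rightarrow> bool" where
  "has_box_dimension F d \<longleftrightarrow>
     (\<forall>r>0. covering_number r F \<noteq> \<infinity>) \<and>
     ((\<lambda>r. ereal (ln (real (the_enat (covering_number r F))) / - ln r)) \<longlongrightarrow> d) (at_right 0)"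

text \<open>The sum of the \<open>t\<close>-th powers of the contraction ratios of the system with label \<open>l\<close>.\<close>

definition ratio_sum :: "('a \<Rightarrow> nat) \<Rightarrow> ('a \<Rightarrow> nat \<Rightarrow> real) \<Rightarrow> 'a \<Rightarrow> real \<Rightarrow> real" where
  "ratio_sum N c l t = (\<Sum>i=1..N l. c l i powr t)"

text \<open>The maps \<open>f l i\<close> (\<open>1 \<le> i \<le> N l\<close>, \<open>l \<in> \<Lambda>\<close>) are total functions of which only the values
  on \<open>V\<close> matter.  The measure \<open>\<mu>\<close> lives on the Borel sets of \<open>\<Lambda>\<close>.  The last assumption is the
  measurability implicit in speaking of the probability of events about the ratio sums and of the
  integrals of their logarithms; nothing is assumed about measurability of the maps.\<close>

locale one_variable_RIFS =
  fixes \<Lambda> :: "'a::euclidean_space set"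
    and \<mu> :: "'a measure"
    and V :: "'b::euclidean_space set"
    and N :: "'a \<Rightarrow> nat"
    and f :: "'a \<Rightarrow> nat \<Rightarrow> 'b \<Rightarrow> 'b"
    and c :: "'a \<Rightarrow> nat \<Rightarrow> real"
    and \<Delta> :: "'b set"
  assumes compact_labels: "compact \<Lambda>"
    and prob_labels: "prob_space \<mu>"
    and sets_labels: "sets \<mu> = sets (restrict_space borel \<Lambda>)"
    and open_V: "open V" "V \<noteq> {}"
    and maps_nonempty: "l \<in> \<Lambda> \<Longrightarrow> 1 \<le> N l"
    and similarity:
      "l \<in> \<Lambda> \<Longrightarrow> i \<in> {1..N l} \<Longrightarrow> x \<in> V \<Longrightarrow> y \<in> V
        \<Longrightarrow> dist (f l i x) (f l i y) = c l i * dist x y"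
    and number_bounded: "bdd_above (N ` \<Lambda>)"
    and ratios_bounded:
      "\<exists>a b. 0 < a \<and> b < 1 \<and> (\<forall>l\<in>\<Lambda>. \<forall>i\<in>{1..N l}. a \<le> c l i \<and> c l i \<le> b)"
    and Delta: "compact \<Delta>" "\<Delta> \<noteq> {}" "\<Delta> \<subseteq> V"
    and Delta_invariant: "l \<in> \<Lambda> \<Longrightarrow> i \<in> {1..N l} \<Longrightarrow> f l i ` \<Delta> \<subseteq> \<Delta>"
    and measurable_ratio_sum: "(\<lambda>l. ratio_sum N c l t) \<in> borel_measurable \<mu>"

text \<open>Sequences are indexed from \<open>0\<close>: \<open>\<omega> j\<close> and \<open>i j\<close> are the mathematician's
  \<open>\<omega>\<close> and \<open>i\<close> with index \<open>j + 1\<close>.\<close>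

abbreviation label_sequences :: "'a measure \<Rightarrow> (nat \<Rightarrow> 'a) measure" where
  "label_sequences \<mu> \<equiv> Pi\<^sub>M UNIV (\<lambda>_. \<mu>)"

text \<open>\<open>f (\<omega> 0) (i 0) \<circ> \<dots> \<circ> f (\<omega> (k - 1)) (i (k - 1))\<close>\<close>

primrec word_map :: "('a \<Rightarrow> nat \<Rightarrow> 'b \<Rightarrow> 'b) \<Rightarrow> (nat \<Rightarrow> 'a) \<Rightarrow> (nat \<Rightarrow> nat) \<Rightarrow> nat \<Rightarrow> 'b \<Rightarrow> 'b" where
  "word_map f \<omega> i 0 = id"
| "word_map f \<omega> i (Suc k) = word_map f \<omega> i k \<circ> f (\<omega> k) (i k)"

definition random_set ::
    "('a \<Rightarrow> nat) \<Rightarrow> ('a \<Rightarrow> nat \<Rightarrow> 'b \<Rightarrow> 'b) \<Rightarrow> 'b set \<Rightarrow> (nat \<Rightarrow> 'a) \<Rightarrow> 'b set" where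
  "random_set N f \<Delta> \<omega> =
     (\<Inter>k\<in>{1..}. \<Union>i\<in>{i. \<forall>j<k. i j \<in> {1..N (\<omega> j)}}. word_map f \<omega> i k ` \<Delta>)"

definition homogeneous :: "'a set \<Rightarrow> ('a \<Rightarrow> nat) \<Rightarrow> ('a \<Rightarrow> nat \<Rightarrow> real) \<Rightarrow> bool" where
  "homogeneous \<Lambda> N c \<longleftrightarrow> (\<forall>l\<in>\<Lambda>. \<forall>i\<in>{1..N l}. \<forall>j\<in>{1..N l}. c l i = c l j)"

text \<open>\<open>U \<subseteq> V\<close> because the maps are only given on \<open>V\<close>.\<close>

definition uniform_open_set_condition ::
    "'a set \<Rightarrow> 'b::topological_space set \<Rightarrow> ('a \<Rightarrow> nat) \<Rightarrow> ('a \<Rightarrow> nat \<Rightarrow> 'b \<Rightarrow> 'b) \<Rightarrow> bool" where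
  "uniform_open_set_condition \<Lambda> V N f \<longleftrightarrow>
     (\<exists>U. open U \<and> U \<noteq> {} \<and> U \<subseteq> V \<and>
        (\<forall>l\<in>\<Lambda>. (\<forall>i\<in>{1..N l}. f l i ` U \<subseteq> U) \<and> disjoint_family_on (\<lambda>i. f l i ` U) {1..N l}))"

definition similarity_exponent :: "'a measure \<Rightarrow> ('a \<Rightarrow> nat) \<Rightarrow> ('a \<Rightarrow> nat \<Rightarrow> real) \<Rightarrow> real" where
  "similarity_exponent \<mu> N c =
     (THE s. exp (\<integral>\<omega>. ln (ratio_sum N c (\<omega> 0) s) \<partial>label_sequences \<mu>) = 1)"

definition almost_deterministic :: "'a measure \<Rightarrow> ('a \<Rightarrow> nat) \<Rightarrow> ('a \<Rightarrow> nat \<Rightarrow> real) \<Rightarrow> bool" where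
  "almost_deterministic \<mu> N c \<longleftrightarrow>
     measure (label_sequences \<mu>)
       {\<omega> \<in> space (label_sequences \<mu>). ratio_sum N c (\<omega> 0) (similarity_exponent \<mu> N c) = 1} = 1"

definition assouad_exponent :: "'a measure \<Rightarrow> ('a \<Rightarrow> nat) \<Rightarrow> ('a \<Rightarrow> nat \<Rightarrow> real) \<Rightarrow> real" where
  "assouad_exponent \<mu> N c = Sup {t. measure \<mu> {l \<in> space \<mu>. ratio_sum N c l t \<ge> 1} > 0}"

text \<open>If \<open>\<phi>(x)\<bar>log x\<bar>\<close> is bounded, then so is \<open>R / r\<close> for \<open>r = R\<close> to the power \<open>1 + \<phi>(R)\<close>, and the
  spectrum carries no information: it is \<open>-\<infinity>\<close> for every set (and would be \<open>0\<close> if the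
  infimum were restricted to nonnegative \<open>s\<close>).  Such dimension functions are the reason for the
  hypothesis that \<open>\<phi>(x)\<bar>log x\<bar>\<close> tends to infinity at \<open>0\<close> wherever the spectrum is claimed to equal
  the Assouad dimension.\<close>

lemma generalised_assouad_spectrum_degenerate:
  fixes F :: "'b::euclidean_space set"
  assumes bound: "\<And>x. 0 < x \<Longrightarrow> x < 1 \<Longrightarrow> 0 < \<phi> x \<and> \<phi> x * \<bar>ln x\<bar> \<le> M"
  shows "generalised_assouad_spectrum \<phi> F = -\<infinity>"
proof -
  obtain Y :: "'b set" where Y: "finite Y" "cball 0 (exp M) \<subseteq> (\<Union>y\<in>Y. ball y 1)"
  proof -
    have "compact (cball (0::'b) (exp M))" by simp
    then show ?thesis
      using that compactE_image[of "cball (0::'b) (exp M)" UNIV "\<lambda>y. ball y 1"]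
      by (metis (no_types, lifting) UNIV_I centre_in_ball open_ball subsetI UN_I zero_less_one)
  qed
  have ratio: "R / R powr (1 + \<phi> R) = exp (\<phi> R * \<bar>ln R\<bar>)" if "0 < R" "R < 1" for R
    using that by (simp add: powr_def exp_diff[symmetric] algebra_simps exp_minus
        exp_add field_simps)
  have cover: "covering_number r (F \<inter> cball x R) \<le> enat (card Y)"
    if r: "0 < r" and R: "R \<le> exp M * r" for r R and x :: 'b
  proof -
    let ?B = "(\<lambda>y. cball (x + r *\<^sub>R y) r) ` Y"
    have "F \<inter> cball x R \<subseteq> \<Union>?B"
    proof
      fix z assume "z \<in> F \<inter> cball x R"
      then have "norm (z - x) \<le> exp M * r" using R by (simp add: dist_norm norm_minus_commute)
      moreover have "norm ((1 / r) *\<^sub>R (z - x)) = norm (z - x) / r" using r by simp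
      ultimately have "(1 / r) *\<^sub>R (z - x) \<in> cball 0 (exp M)"
        unfolding mem_cball_0 using r by (simp only: pos_divide_le_eq)
      then obtain y where y: "y \<in> Y" "dist y ((1 / r) *\<^sub>R (z - x)) < 1"
        using subsetD[OF Y(2)] unfolding UN_iff mem_ball by blast
      have "x + r *\<^sub>R y - z = r *\<^sub>R (y - (1 / r) *\<^sub>R (z - x))"
        using r by (simp add: algebra_simps)
      then have "dist (x + r *\<^sub>R y) z = r * dist y ((1 / r) *\<^sub>R (z - x))"
        using r by (simp add: dist_norm)
      also have "\<dots> \<le> r" using y(2) r by simp
      finally show "z \<in> \<Union>?B" using y(1) by auto
    qed
    then have "covering_number r (F \<inter> cball x R) \<le> enat (card ?B)"
      unfolding covering_number_def using Y(1) by (intro Inf_lower) blast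
    also have "\<dots> \<le> enat (card Y)" using card_image_le[OF Y(1)] by simp
    finally show ?thesis .
  qed
  have "ereal s \<in> {ereal s |s. \<exists>C>0. \<forall>R\<in>{0<..<1}. let r = R powr (1 + \<phi> R) in
            ereal_of_enat (SUP x\<in>F. covering_number r (F \<inter> cball x R))
              \<le> ereal (C * (R / r) powr s)}" for s
  proof -
    let ?C = "(real (card Y) + 1) * exp (M * \<bar>s\<bar>)"
    have "ereal_of_enat (SUP x\<in>F. covering_number (R powr (1 + \<phi> R)) (F \<inter> cball x R))
        \<le> ereal (?C * (R / R powr (1 + \<phi> R)) powr s)" if R: "0 < R" "R < 1" for R
    proof -
      define b where "b = \<phi> R * \<bar>ln R\<bar>"
      have b: "0 \<le> b" "b \<le> M" using bound[OF R] by (auto simp: b_def)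
      have "R / R powr (1 + \<phi> R) \<le> exp M" using ratio[OF R] b by (simp add: b_def)
      then have le: "R \<le> exp M * R powr (1 + \<phi> R)" using R by (simp add: field_simps)
      have "- (M * \<bar>s\<bar>) \<le> b * s"
      proof -
        have "- (b * s) \<le> b * \<bar>s\<bar>" using b by (metis abs_ge_minus_self abs_mult abs_of_nonneg)
        also have "\<dots> \<le> M * \<bar>s\<bar>" using b by (intro mult_right_mono) auto
        finally show ?thesis by simp
      qed
      then have one: "1 \<le> exp (M * \<bar>s\<bar>) * exp (b * s)" by (simp add: exp_add[symmetric])
      have "ereal_of_enat (SUP x\<in>F. covering_number (R powr (1 + \<phi> R)) (F \<inter> cball x R))
          \<le> ereal_of_enat (enat (card Y))"
        unfolding ereal_of_enat_le_iff using R le by (intro SUP_least cover) auto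
      also have "\<dots> = ereal (real (card Y))" by simp
      also have "\<dots> \<le> ereal ((real (card Y) + 1) * (exp (M * \<bar>s\<bar>) * exp (b * s)))"
      proof -
        have "real (card Y) * 1 \<le> (real (card Y) + 1) * (exp (M * \<bar>s\<bar>) * exp (b * s))"
          using one by (intro mult_mono) auto
        then show ?thesis by simp
      qed
      also have "(R / R powr (1 + \<phi> R)) powr s = exp (b * s)"
        unfolding ratio[OF R] b_def by (simp add: powr_def mult.commute)
      then have "(real (card Y) + 1) * (exp (M * \<bar>s\<bar>) * exp (b * s))
          = ?C * (R / R powr (1 + \<phi> R)) powr s" by simp
      finally show ?thesis .
    qed
    moreover have "?C > 0" by (simp add: add_pos_nonneg)
    ultimately have "\<exists>C>0. \<forall>R\<in>{0<..<1}. let r = R powr (1 + \<phi> R) in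
            ereal_of_enat (SUP x\<in>F. covering_number r (F \<inter> cball x R))
              \<le> ereal (C * (R / r) powr s)"
      unfolding Let_def by (intro exI[of _ ?C]) auto
    then show ?thesis by blast
  qed
  then have "generalised_assouad_spectrum \<phi> F \<le> ereal s" for s
    unfolding generalised_assouad_spectrum_def by (rule Inf_lower)
  then show ?thesis by (rule ereal_bot)
qed

end

theory Submission
  imports Defs
begin

text \<open>Write \<open>\<rho>\<^sub>k\<close> for the product of the first \<open>k\<close> contraction ratios.  By homogeneity and the open set
  condition, \<open>N\<^sub>r(F \<inter> B(x, R))\<close> is, for suitable \<open>x\<close> and up to constants, the product of the numbers of
  maps at the levels \<open>k \<le> j < l\<close>, where \<open>\<rho>\<^sub>k\<close> and \<open>\<rho>\<^sub>l\<close> are comparable with \<open>R\<close> and \<open>r\<close>.  Hence \<open>s\<close> is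
  admissible for a spectrum iff the sums of \<open>log \<SS>\<^sup>s\<close> over the corresponding blocks \<open>[k, l)\<close> are bounded
  above.  With \<open>r = R\<close> to the power \<open>1 + \<psi>(R)\<close> the block starting at \<open>k\<close> has length comparable with
  \<open>\<psi>(R)|log R|\<close>, \<open>R = \<rho>\<^sub>k\<close>.  If the exponentials of minus these lengths are summable, Hoeffding's inequality and
  Borel-Cantelli show that all late block averages are close to the mean, which gives the box dimension.
  If they are not summable, the second Borel-Cantelli lemma for disjoint blocks produces infinitely
  many blocks consisting only of labels with \<open>\<SS>\<^sup>t \<ge> 1\<close>, for any \<open>t\<close> below the almost sure
  Assouad dimension.\<close>

section \<open>Covering numbers of cylinders\<close>

text \<open>The block lengths of a spectrum depend on the random scales \<open>rho k\<close>,
  whereas Borel-Cantelli needs lengths fixed in advance. On the scale y = - ln R the quantity ln (R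
  / r) is h(y) = \<psi>(exp (- y)) * y, which is monotone for a dimension function, and
  \<open>rho k\<close> lies between exp (- \<alpha> k) and exp (- \<beta> k) with \<alpha> = - ln a,
  \<beta> = - ln b. So h at affine functions of k bounds the random lengths from both sides.
  Rescaling the argument of a monotone h does not affect the summability of exp (- h); multiplying h
  by a constant can. Such constants arise from the Hoeffding rate, from converting logarithmic scale
  into levels and from the probability of a label set, and the gap between \<phi> and \<psi> absorbs
  them. In the divergent case the label sets for exponents approaching the critical one may have
  measures tending to 0, so no single constant need suffice. If the critical exponent itself has
  ratio sum 1 on a set of positive measure, one constant is enough, and it is the C of the last
  claim.\<close>

lemma separated_set_card_le:
  fixes A d :: real
  assumes "0 < d"
  shows "\<exists>K::nat. \<forall>\<rho>>0. \<forall>(x::'b::euclidean_space) S. S \<subseteq> cball x (A * \<rho>) \<longrightarrow>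
    (\<forall>y\<in>S. \<forall>z\<in>S. y \<noteq> z \<longrightarrow> d * \<rho> \<le> dist y z) \<longrightarrow> card S \<le> K"
proof -
  \<comment> \<open>After translation by x and scaling by 1 / \<rho>, this one cover serves every
    ball. Two points of S in the same piece would be closer than d, so S injects into T.\<close>
  obtain T :: "'b set" where T: "finite T" "cball 0 A \<subseteq> (\<Union>t\<in>T. ball t (d / 2))"
  proof -
    have "cball (0::'b) A \<subseteq> (\<Union>t\<in>UNIV. ball t (d / 2))"
    proof
      fix y :: 'b
      show "y \<in> (\<Union>t\<in>UNIV. ball t (d / 2))" using assms by (intro UN_I[of y]) auto
    qed
    then obtain T where "finite T" "cball (0::'b) A \<subseteq> (\<Union>t\<in>T. ball t (d / 2))"
      using compactE_image[of "cball (0::'b) A" UNIV "\<lambda>t. ball t (d / 2)"]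
      by (metis compact_cball open_ball)
    then show ?thesis by (rule that)
  qed
  show ?thesis
  proof (intro exI allI impI)
    fix \<rho> and x :: 'b and S assume \<rho>: "0 < \<rho>" and S: "S \<subseteq> cball x (A * \<rho>)"
      and sep: "\<forall>y\<in>S. \<forall>z\<in>S. y \<noteq> z \<longrightarrow> d * \<rho> \<le> dist y z"
    have "\<exists>t\<in>T. dist t ((y - x) /\<^sub>R \<rho>) < d / 2" if "y \<in> S" for y
    proof -
      have "norm (y - x) \<le> A * \<rho>"
        using S that by (auto simp: dist_norm norm_minus_commute)
      then have "(y - x) /\<^sub>R \<rho> \<in> cball 0 A"
        using \<rho> by (simp add: divide_inverse[symmetric] pos_divide_le_eq mult.commute[of "inverse \<rho>"])
      then have "(y - x) /\<^sub>R \<rho> \<in> (\<Union>t\<in>T. ball t (d / 2))" by (rule subsetD[OF T(2)])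
      then show ?thesis unfolding UN_iff mem_ball .
    qed
    then have "\<exists>t. \<forall>y\<in>S. t y \<in> T \<and> dist (t y) ((y - x) /\<^sub>R \<rho>) < d / 2"
      by (intro bchoice) auto
    then obtain t where t: "\<forall>y\<in>S. t y \<in> T \<and> dist (t y) ((y - x) /\<^sub>R \<rho>) < d / 2" ..
    have "inj_on t S"
    proof (rule inj_onI, rule ccontr)
      fix y z assume yz: "y \<in> S" "z \<in> S" "t y = t z" "y \<noteq> z"
      have "dist ((y - x) /\<^sub>R \<rho>) ((z - x) /\<^sub>R \<rho>) < d"
        using bspec[OF t yz(1)] bspec[OF t yz(2)] yz(3) by (metis dist_commute dist_triangle_half_l)
      moreover have "dist ((y - x) /\<^sub>R \<rho>) ((z - x) /\<^sub>R \<rho>) = dist y z / \<rho>"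
      proof -
        have "(y - x) /\<^sub>R \<rho> - (z - x) /\<^sub>R \<rho> = (y - z) /\<^sub>R \<rho>" by (simp add: algebra_simps)
        then show ?thesis using \<rho> by (simp add: dist_norm divide_inverse)
      qed
      ultimately have "dist y z / \<rho> < d" by simp
      then show False using sep yz \<rho> by (force simp: pos_divide_less_eq)
    qed
    moreover have "t ` S \<subseteq> T" using t by auto
    ultimately show "card S \<le> card T"
      using T(1) by (rule card_inj_on_le)
  qed
qed

text \<open>The map is a similarity only on the ball, so that its image is full has to be proved. On
  the sphere of radius t about u, the rescaled map \<open>g\<close> is an isometry of the unit
  sphere; it extends to an orthogonal transformation, which is onto. This provides each cylinder of
  U with an inner ball.\<close>

lemma ball_subset_similarity_image:
  fixes f :: "'b::euclidean_space \<Rightarrow> 'b"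
  assumes q: "0 < q" and r: "0 < r"
    and f: "\<And>x y. x \<in> ball u r \<Longrightarrow> y \<in> ball u r \<Longrightarrow> dist (f x) (f y) = q * dist x y"
  shows "ball (f u) (q * r) \<subseteq> f ` ball u r"
proof
  fix z assume z: "z \<in> ball (f u) (q * r)"
  show "z \<in> f ` ball u r"
  proof (cases "z = f u")
    case True
    then show ?thesis using r by auto
  next
    case False
    define t where "t = dist (f u) z / q"
    have t: "0 < t" "t < r" and qt: "q * t = dist (f u) z"
      using False q z by (auto simp: t_def field_simps)
    define g where "g x = (f (u + t *\<^sub>R x) - f u) /\<^sub>R (q * t)" for x
    have in_ball: "u + t *\<^sub>R x \<in> ball u r" if "norm x = 1" for x
      using t that by (simp add: dist_norm)
    have "norm (g x) = 1" if "norm x = 1" for x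
    proof -
      have "norm (f (u + t *\<^sub>R x) - f u) = q * t"
        using f[OF in_ball[OF that], of u] r t that by (simp add: dist_norm)
      moreover have "\<bar>inverse (q * t)\<bar> * (q * t) = 1" using q t by (simp add: field_simps)
      ultimately show ?thesis unfolding g_def norm_scaleR by metis
    qed
    moreover have "dist (g x) (g y) = dist x y" if "norm x = 1" "norm y = 1" for x y
    proof -
      have "g x - g y = (f (u + t *\<^sub>R x) - f (u + t *\<^sub>R y)) /\<^sub>R (q * t)"
        by (simp add: g_def algebra_simps)
      moreover have "dist (f (u + t *\<^sub>R x)) (f (u + t *\<^sub>R y)) = q * (t * dist x y)"
        using f[OF in_ball[OF that(1)] in_ball[OF that(2)]] t by (simp add: dist_norm scaleR_diff_right[symmetric])
      moreover have "\<bar>inverse (q * t)\<bar> * (q * (t * dist x y)) = dist x y" using q t by (simp add: field_simps)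
      ultimately show ?thesis unfolding dist_norm[of "g x"] by (simp only: norm_scaleR dist_norm)
    qed
    ultimately obtain G where G: "orthogonal_transformation G" "\<And>x. norm x = 1 \<Longrightarrow> G x = g x"
      using isometry_sphere_extend[of g] by blast
    obtain x where x: "G x = (z - f u) /\<^sub>R (q * t)"
      using orthogonal_transformation_surj[OF G(1)] by (metis surjD)
    have "norm ((z - f u) /\<^sub>R (q * t)) = 1"
      unfolding qt using False by (simp add: dist_norm norm_minus_commute)
    then have nx: "norm x = 1"
      using orthogonal_transformation_norm[OF G(1), of x] x by simp
    then have "(f (u + t *\<^sub>R x) - f u) /\<^sub>R (q * t) = (z - f u) /\<^sub>R (q * t)"
      using G(2) x by (simp add: g_def)
    then have "f (u + t *\<^sub>R x) = z" using q t by simp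
    then show ?thesis using in_ball[OF nx] by blast
  qed
qed

lemma covering_number_le:
  assumes "finite \<B>" "\<And>B. B \<in> \<B> \<Longrightarrow> \<exists>x \<rho>. \<rho> \<le> r \<and> B = cball x \<rho>" "E \<subseteq> \<Union>\<B>"
  shows "covering_number r E \<le> enat (card \<B>)"
  unfolding covering_number_def
  by (rule Inf_lower, rule CollectI, rule exI[of _ \<B>]) (intro conjI refl ballI assms)

text \<open>A finite infimum of extended naturals is attained, which yields an actual cover to
  count. When no finite cover exists, \<open>0 < K\<close> keeps the right side infinite.\<close>

lemma le_covering_numberI:
  assumes "\<And>\<B>. finite \<B> \<Longrightarrow> \<forall>B\<in>\<B>. \<exists>x \<rho>. \<rho> \<le> r \<and> B = cball x \<rho> \<Longrightarrow> E \<subseteq> \<Union>\<B> \<Longrightarrow> m \<le> K * card \<B>"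
    and "0 < K"
  shows "enat m \<le> enat K * covering_number r E"
proof (cases "covering_number r E")
  case (enat n)
  let ?S = "{enat (card \<B>) |\<B>. finite \<B> \<and> (\<forall>B\<in>\<B>. \<exists>x \<rho>. \<rho> \<le> r \<and> B = cball x \<rho>) \<and> E \<subseteq> \<Union>\<B>}"
  have ne: "?S \<noteq> {}"
  proof
    assume "?S = {}"
    then show False using enat unfolding covering_number_def Inf_enat_def by simp
  qed
  then obtain e where "e \<in> ?S" by blast
  then have "(LEAST e. e \<in> ?S) \<in> ?S" by (rule LeastI)
  also have "(LEAST e. e \<in> ?S) = covering_number r E"
    using ne unfolding covering_number_def Inf_enat_def by (simp only: if_False)
  finally obtain \<B> where "covering_number r E = enat (card \<B>)" "finite \<B>"
      "\<forall>B\<in>\<B>. \<exists>x \<rho>. \<rho> \<le> r \<and> B = cball x \<rho>" "E \<subseteq> \<Union>\<B>" by blast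
  then show ?thesis using assms(1)[of \<B>] by simp
next
  case infinity
  then show ?thesis using assms(2) by (simp add: enat_0_iff)
qed

text \<open>One realisation \<omega>, treated deterministically; \<open>q j\<close> is the common
  ratio of the system used at level j. The ball of radius \<delta> about u is the inner size of U,
  and D bounds the extent of \<Delta> as seen from u. Normalising D to be at least 1 keeps ln (2 *
  D) nonnegative and r / D below r.\<close>

locale homogeneous_iteration =
  fixes V U \<Delta> :: "'b::euclidean_space set"
    and N :: "'a \<Rightarrow> nat"
    and f :: "'a \<Rightarrow> nat \<Rightarrow> 'b \<Rightarrow> 'b"
    and \<omega> :: "nat \<Rightarrow> 'a"
    and q :: "nat \<Rightarrow> real"
    and a b D \<delta> :: real
    and u :: 'b
  assumes a_pos: "0 < a" and b_less_1: "b < 1"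
    and q_bounds: "a \<le> q j" "q j \<le> b"
    and N_ge_1: "1 \<le> N (\<omega> j)"
    and similarity: "i \<in> {1..N (\<omega> j)} \<Longrightarrow> x \<in> V \<Longrightarrow> y \<in> V \<Longrightarrow>
      dist (f (\<omega> j) i x) (f (\<omega> j) i y) = q j * dist x y"
    and U_V: "U \<subseteq> V" and Delta_V: "\<Delta> \<subseteq> V"
    and compact_Delta: "compact \<Delta>" and Delta_nonempty: "\<Delta> \<noteq> {}"
    and Delta_image: "i \<in> {1..N (\<omega> j)} \<Longrightarrow> f (\<omega> j) i ` \<Delta> \<subseteq> \<Delta>"
    and U_image: "i \<in> {1..N (\<omega> j)} \<Longrightarrow> f (\<omega> j) i ` U \<subseteq> U"
    and U_disjoint: "disjoint_family_on (\<lambda>i. f (\<omega> j) i ` U) {1..N (\<omega> j)}"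
    and \<delta>_pos: "0 < \<delta>" and ball_U: "ball u \<delta> \<subseteq> U"
    and D_ge_1: "1 \<le> D" and dist_Delta: "x \<in> \<Delta> \<Longrightarrow> dist u x \<le> D"
begin

section \<open>Cylinders of a single realisation\<close>

abbreviation F :: "'b set" where "F \<equiv> random_set N f \<Delta> \<omega>"

abbreviation wm :: "(nat \<Rightarrow> nat) \<Rightarrow> nat \<Rightarrow> 'b \<Rightarrow> 'b" where "wm \<equiv> word_map f \<omega>"

text \<open>Extensional functions make a word of length k a unique object: the set is finite,
  prefixes are restrictions, and cardinalities are products.\<close>

definition words :: "nat \<Rightarrow> (nat \<Rightarrow> nat) set" where
  "words k = PiE {..<k} (\<lambda>j. {1..N (\<omega> j)})"

definition rho :: "nat \<Rightarrow> real" where "rho k = (\<Prod>j<k. q j)"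

lemma q_pos: "0 < q j"
  using a_pos q_bounds[of j] by linarith

lemma rho_pos: "0 < rho k"
  unfolding rho_def by (intro prod_pos) (simp add: q_pos)

lemma rho_Suc: "rho (Suc k) = rho k * q k"
  by (simp add: rho_def)

lemma u_in_U: "u \<in> U"
  using \<delta>_pos by (intro subsetD[OF ball_U]) simp

lemma wm_cong: "(\<And>j. j < k \<Longrightarrow> i j = i' j) \<Longrightarrow> wm i k = wm i' k"
  by (induction k) auto

lemma wm_image_subset:
  assumes "\<And>j. j < k \<Longrightarrow> i j \<in> {1..N (\<omega> j)}"
  shows "wm i k ` \<Delta> \<subseteq> \<Delta>" "wm i k ` U \<subseteq> U"
  using assms
proof (induction k)
  case (Suc k)
  { case 1 then show ?case using Suc Delta_image[of "i k" k] by (fastforce simp: image_comp[symmetric]) }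
  { case 2 then show ?case using Suc U_image[of "i k" k] by (fastforce simp: image_comp[symmetric]) }
qed auto

lemma wm_image_mono:
  assumes "k \<le> l" "\<And>j. j < l \<Longrightarrow> i j \<in> {1..N (\<omega> j)}"
  shows "wm i l ` \<Delta> \<subseteq> wm i k ` \<Delta>" "wm i l ` U \<subseteq> wm i k ` U"
  using assms
proof (induction l rule: dec_induct)
  case (step l)
  { case 1 then show ?case using step Delta_image[of "i l" l] by (fastforce simp: image_comp[symmetric]) }
  { case 2 then show ?case using step U_image[of "i l" l] by (fastforce simp: image_comp[symmetric]) }
qed auto

text \<open>Base points come from U and points of F from \<Delta>, and these sets need not meet. The
  scaling law is therefore stated across their union, which every map sends into itself inside
  V.\<close>

lemma dist_wm:
  assumes "\<And>j. j < k \<Longrightarrow> i j \<in> {1..N (\<omega> j)}" "x \<in> U \<union> \<Delta>" "y \<in> U \<union> \<Delta>"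
  shows "dist (wm i k x) (wm i k y) = rho k * dist x y"
  using assms
proof (induction k arbitrary: x y)
  case 0
  then show ?case by (simp add: rho_def)
next
  case (Suc k)
  have ik: "i k \<in> {1..N (\<omega> k)}" using Suc.prems(1) by blast
  have "f (\<omega> k) (i k) x \<in> U \<union> \<Delta>" "f (\<omega> k) (i k) y \<in> U \<union> \<Delta>"
    using Suc.prems(2,3) Delta_image[OF ik] U_image[OF ik] by blast+
  then have "dist (wm i k (f (\<omega> k) (i k) x)) (wm i k (f (\<omega> k) (i k) y))
      = rho k * dist (f (\<omega> k) (i k) x) (f (\<omega> k) (i k) y)"
    using Suc.IH Suc.prems(1) by auto
  also have "dist (f (\<omega> k) (i k) x) (f (\<omega> k) (i k) y) = q k * dist x y"
    using similarity[OF ik] U_V Delta_V Suc.prems(2,3) by blast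
  finally show ?case by (simp add: rho_Suc)
qed

text \<open>A difference at an earlier level is inherited by nested images. A difference in the last
  symbol alone is the open set condition, carried over by the injective common prefix.\<close>

lemma wm_disjoint:
  assumes "\<And>j. j < k \<Longrightarrow> i j \<in> {1..N (\<omega> j)}" "\<And>j. j < k \<Longrightarrow> i' j \<in> {1..N (\<omega> j)}"
    and "\<exists>j<k. i j \<noteq> i' j"
  shows "wm i k ` U \<inter> wm i' k ` U = {}"
  using assms
proof (induction k)
  case (Suc k)
  show ?case
  proof (cases "\<exists>j<k. i j \<noteq> i' j")
    case True
    then have "wm i k ` U \<inter> wm i' k ` U = {}" using Suc by auto
    moreover have "wm i (Suc k) ` U \<subseteq> wm i k ` U" "wm i' (Suc k) ` U \<subseteq> wm i' k ` U"
      using wm_image_mono(2)[of k "Suc k"] Suc.prems by auto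
    ultimately show ?thesis by blast
  next
    case False
    then have ne: "i k \<noteq> i' k" and eq: "wm i' k = wm i k"
      using Suc.prems(3) less_Suc_eq wm_cong[of k i' i] by auto
    have ik: "i k \<in> {1..N (\<omega> k)}" "i' k \<in> {1..N (\<omega> k)}" using Suc.prems by auto
    have "inj_on (wm i k) U"
    proof (rule inj_onI)
      fix x y assume "x \<in> U" "y \<in> U" "wm i k x = wm i k y"
      then have "rho k * dist x y = 0" using dist_wm[of k i x y] Suc.prems(1) by auto
      then show "x = y" using rho_pos[of k] by simp
    qed
    then have "wm i k ` (f (\<omega> k) (i k) ` U) \<inter> wm i k ` (f (\<omega> k) (i' k) ` U)
        = wm i k ` (f (\<omega> k) (i k) ` U \<inter> f (\<omega> k) (i' k) ` U)"
      using U_image[OF ik(1)] U_image[OF ik(2)] by (intro inj_on_image_Int[symmetric]) auto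
    also have "f (\<omega> k) (i k) ` U \<inter> f (\<omega> k) (i' k) ` U = {}"
      using U_disjoint[of k] ik ne by (auto simp: disjoint_family_on_def)
    finally show ?thesis by (simp add: eq image_image)
  qed
qed auto

text \<open>The ball of radius \<delta> * \<open>rho k\<close> about one base point lies in its own
  cylinder of U, so the other base point, which lies in a disjoint cylinder, stays outside.\<close>

lemma dist_wm_u_ge:
  assumes "\<And>j. j < k \<Longrightarrow> i j \<in> {1..N (\<omega> j)}" "\<And>j. j < k \<Longrightarrow> i' j \<in> {1..N (\<omega> j)}"
    and "\<exists>j<k. i j \<noteq> i' j"
  shows "\<delta> * rho k \<le> dist (wm i k u) (wm i' k u)"
proof (rule ccontr)
  assume "\<not> ?thesis"
  then have "wm i' k u \<in> ball (wm i k u) (rho k * \<delta>)" by (simp add: mult.commute)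
  also have "\<dots> \<subseteq> wm i k ` ball u \<delta>"
    using ball_U by (intro ball_subset_similarity_image rho_pos \<delta>_pos dist_wm assms(1)) auto
  finally have "wm i' k u \<in> wm i k ` U" using ball_U by auto
  then show False using wm_disjoint[OF assms] u_in_U by auto
qed

lemma dist_wm_u_le:
  assumes "\<And>j. j < k \<Longrightarrow> i j \<in> {1..N (\<omega> j)}" "z \<in> wm i k ` \<Delta>"
  shows "dist (wm i k u) z \<le> D * rho k"
proof -
  obtain x where x: "x \<in> \<Delta>" "z = wm i k x" using assms(2) by auto
  then have "dist (wm i k u) z = rho k * dist u x"
    using dist_wm[OF assms(1)] u_in_U by auto
  then show ?thesis
    using mult_left_mono[OF dist_Delta[OF x(1)], of "rho k"] rho_pos[of k] by (simp add: mult.commute)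
qed

section \<open>Words and the packing of their base points\<close>

lemma words_D: "w \<in> words k \<Longrightarrow> j < k \<Longrightarrow> w j \<in> {1..N (\<omega> j)}"
  using PiE_mem[of w "{..<k}" "\<lambda>j. {1..N (\<omega> j)}" j] by (simp add: words_def)

lemma finite_words: "finite (words k)"
  unfolding words_def by (intro finite_PiE) auto

lemma wm_u_inj_on: "inj_on (\<lambda>w. wm w k u) (words k)"
  and words_separated: "w \<in> words k \<Longrightarrow> w' \<in> words k \<Longrightarrow> wm w k u \<noteq> wm w' k u \<Longrightarrow>
    \<delta> * rho k \<le> dist (wm w k u) (wm w' k u)"
proof -
  have *: "\<delta> * rho k \<le> dist (wm w k u) (wm w' k u)" if "w \<in> words k" "w' \<in> words k" "w \<noteq> w'" for w w'
  proof (rule dist_wm_u_ge)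
    show "w j \<in> {1..N (\<omega> j)}" "w' j \<in> {1..N (\<omega> j)}" if "j < k" for j
      by (rule words_D[OF _ that], fact)+
    show "\<exists>j<k. w j \<noteq> w' j"
    proof (rule ccontr)
      assume "\<not> ?thesis"
      then have "w = w'" using that unfolding words_def by (intro PiE_ext) auto
      then show False using that by simp
    qed
  qed
  show "inj_on (\<lambda>w. wm w k u) (words k)"
  proof (rule inj_onI, rule ccontr)
    fix w w' assume "w \<in> words k" "w' \<in> words k" "wm w k u = wm w' k u" "w \<noteq> w'"
    then have "\<delta> * rho k \<le> 0" using * by force
    then show False using mult_pos_pos[OF \<delta>_pos rho_pos[of k]] by linarith
  qed
  show "w \<in> words k \<Longrightarrow> w' \<in> words k \<Longrightarrow> wm w k u \<noteq> wm w' k u \<Longrightarrow>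
    \<delta> * rho k \<le> dist (wm w k u) (wm w' k u)" using * by blast
qed

text \<open>Separation and radius both scale with \<open>rho k\<close>, so one K serves all levels.
  Both covering estimates rest on this count.\<close>

lemma word_packing:
  "\<exists>K::nat. \<forall>k x W. W \<subseteq> words k \<longrightarrow> (\<forall>w\<in>W. dist x (wm w k u) \<le> A * rho k) \<longrightarrow> card W \<le> K"
proof -
  obtain K :: nat where K: "\<forall>\<rho>>0. \<forall>(x::'b) S. S \<subseteq> cball x (A * \<rho>) \<longrightarrow>
       (\<forall>y\<in>S. \<forall>z\<in>S. y \<noteq> z \<longrightarrow> \<delta> * \<rho> \<le> dist y z) \<longrightarrow> card S \<le> K"
    using separated_set_card_le[OF \<delta>_pos] by blast
  have "card W \<le> K" if W: "W \<subseteq> words k" and A: "\<forall>w\<in>W. dist x (wm w k u) \<le> A * rho k" for k x W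
  proof -
    have "card W = card ((\<lambda>w. wm w k u) ` W)"
      using inj_on_subset[OF wm_u_inj_on W] by (simp add: card_image)
    moreover have "card ((\<lambda>w. wm w k u) ` W) \<le> K"
    proof (rule K[rule_format, OF rho_pos])
      show "(\<lambda>w. wm w k u) ` W \<subseteq> cball x (A * rho k)" using A by auto
      show "\<delta> * rho k \<le> dist y z"
        if yz: "y \<in> (\<lambda>w. wm w k u) ` W" "z \<in> (\<lambda>w. wm w k u) ` W" "y \<noteq> z" for y z
      proof -
        obtain w w' where "w \<in> W" "w' \<in> W" "y = wm w k u" "z = wm w' k u" using yz by blast
        then show ?thesis using words_separated[of w k w'] W yz(3) by blast
      qed
    qed
    ultimately show ?thesis by simp
  qed
  then show ?thesis by blast
qed

lemma card_extensions:
  assumes "k \<le> l" "w \<in> words k"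
  shows "card {v \<in> words l. restrict v {..<k} = w} = (\<Prod>j=k..<l. N (\<omega> j))"
proof -
  have "bij_betw (\<lambda>v. restrict v {k..<l}) {v \<in> words l. restrict v {..<k} = w}
      (PiE {k..<l} (\<lambda>j. {1..N (\<omega> j)}))"
  proof (rule bij_betw_byWitness[where f' = "\<lambda>v. \<lambda>j\<in>{..<l}. if j < k then w j else v j"])
    show "\<forall>v\<in>{v \<in> words l. restrict v {..<k} = w}.
       (\<lambda>j\<in>{..<l}. if j < k then w j else restrict v {k..<l} j) = v"
    proof (intro ballI ext)
      fix v j assume v: "v \<in> {v \<in> words l. restrict v {..<k} = w}"
      then have "v \<in> extensional {..<l}" "w = restrict v {..<k}" by (auto simp: words_def PiE_iff)
      then show "(\<lambda>j\<in>{..<l}. if j < k then w j else restrict v {k..<l} j) j = v j"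
        using assms(1) by (simp add: extensional_def)
    qed
    show "\<forall>v\<in>PiE {k..<l} (\<lambda>j. {1..N (\<omega> j)}).
       restrict (\<lambda>j\<in>{..<l}. if j < k then w j else v j) {k..<l} = v"
    proof (intro ballI ext)
      fix v j assume "v \<in> PiE {k..<l} (\<lambda>j. {1..N (\<omega> j)})"
      then have "v \<in> extensional {k..<l}" by (simp add: PiE_iff)
      then show "restrict (\<lambda>j\<in>{..<l}. if j < k then w j else v j) {k..<l} j = v j"
        by (simp add: extensional_def)
    qed
    show "(\<lambda>v. restrict v {k..<l}) ` {v \<in> words l. restrict v {..<k} = w}
       \<subseteq> PiE {k..<l} (\<lambda>j. {1..N (\<omega> j)})"
    proof
      fix v' assume "v' \<in> (\<lambda>v. restrict v {k..<l}) ` {v \<in> words l. restrict v {..<k} = w}"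
      then obtain v where "v \<in> words l" "v' = restrict v {k..<l}" by blast
      then show "v' \<in> PiE {k..<l} (\<lambda>j. {1..N (\<omega> j)})"
        using words_D[of v l] by (simp add: restrict_PiE_iff)
    qed
    show "(\<lambda>v. \<lambda>j\<in>{..<l}. if j < k then w j else v j) ` (PiE {k..<l} (\<lambda>j. {1..N (\<omega> j)}))
       \<subseteq> {v \<in> words l. restrict v {..<k} = w}"
    proof
      fix v' assume "v' \<in> (\<lambda>v. \<lambda>j\<in>{..<l}. if j < k then w j else v j) ` (PiE {k..<l} (\<lambda>j. {1..N (\<omega> j)}))"
      then obtain v where v: "v \<in> PiE {k..<l} (\<lambda>j. {1..N (\<omega> j)})"
          and v': "v' = (\<lambda>j\<in>{..<l}. if j < k then w j else v j)" by blast
      have "v' j \<in> {1..N (\<omega> j)}" if "j < l" for j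
        using that words_D[OF assms(2), of j] PiE_mem[OF v, of j] by (simp add: v')
      then have "v' \<in> words l" by (simp add: words_def v' PiE_iff)
      moreover have "restrict v' {..<k} = w"
      proof
        fix j
        have "w \<in> extensional {..<k}" using assms(2) by (simp add: words_def PiE_iff)
        then show "restrict v' {..<k} j = w j" using assms(1) by (cases "j < k") (auto simp: v' extensional_def)
      qed
      ultimately show "v' \<in> {v \<in> words l. restrict v {..<k} = w}" by simp
    qed
  qed
  then have "card {v \<in> words l. restrict v {..<k} = w} = card (PiE {k..<l} (\<lambda>j. {1..N (\<omega> j)}))"
    by (rule bij_betw_same_card)
  then show ?thesis by (simp add: card_PiE)
qed

text \<open>The word is continued by the symbol 1, which every system possesses. The cylinders along
  this infinite word are nested nonempty compact sets, and a common point lies in F.\<close>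

lemma F_meets_cylinder:
  assumes "w \<in> words k"
  obtains x where "x \<in> F" "x \<in> wm w k ` \<Delta>"
proof -
  define i where "i j = (if j < k then w j else 1)" for j
  have i: "i j \<in> {1..N (\<omega> j)}" for j
    using words_D[OF assms] N_ge_1[of j] by (auto simp: i_def)
  have "compact (wm i n ` \<Delta>)" for n
  proof (rule compact_continuous_image[OF _ compact_Delta])
    have "(rho n)-lipschitz_on \<Delta> (wm i n)"
      by (rule lipschitz_onI) (use dist_wm[of n i] i rho_pos[of n] in auto)
    then show "continuous_on \<Delta> (wm i n)" by (rule lipschitz_on_continuous_on)
  qed
  then have "\<Inter>(range (\<lambda>n. wm i n ` \<Delta>)) \<noteq> {}"
    using Delta_nonempty wm_image_mono(1) i by (intro compact_nest) auto
  then obtain x where x: "x \<in> wm i n ` \<Delta>" for n by blast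
  have "i \<in> {i. \<forall>j<n. i j \<in> {1..N (\<omega> j)}}" for n using i by blast
  then have "x \<in> F" unfolding random_set_def by (intro INT_I UN_I[of i] x)
  moreover have "wm i k = wm w k" by (rule wm_cong) (simp add: i_def)
  ultimately show thesis using x[of k] by (intro that[of x]) auto
qed

text \<open>The intersection defining F may use unrelated words at different levels. One
  sufficiently deep word is enough here, because its prefixes give cylinders containing z at all
  smaller levels.\<close>

lemma F_in_cylinder:
  assumes "z \<in> F"
  shows "\<exists>v\<in>words l. z \<in> wm v l ` \<Delta> \<and>
    (\<forall>k\<le>l. restrict v {..<k} \<in> words k \<and> z \<in> wm (restrict v {..<k}) k ` \<Delta>)"
proof -
  \<comment> \<open>Level \<open>Suc l\<close> rather than l, because the intersection starts at
    level 1 and l = 0 must be covered too.\<close>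
  have "z \<in> (\<Union>i\<in>{i. \<forall>j<Suc l. i j \<in> {1..N (\<omega> j)}}. wm i (Suc l) ` \<Delta>)"
    using assms unfolding random_set_def by (rule INT_D) simp
  then obtain i where i: "\<And>j. j < Suc l \<Longrightarrow> i j \<in> {1..N (\<omega> j)}" "z \<in> wm i (Suc l) ` \<Delta>"
    unfolding UN_iff by blast
  define v where "v = restrict i {..<l}"
  have r: "restrict v {..<k} \<in> words k" "wm (restrict v {..<k}) k = wm i k" if "k \<le> l" for k
  proof -
    show "restrict v {..<k} \<in> words k"
      unfolding words_def by (rule PiE_I) (use i(1) that in \<open>auto simp: v_def\<close>)
    show "wm (restrict v {..<k}) k = wm i k"
      using that by (intro wm_cong) (auto simp: v_def)
  qed
  have z: "z \<in> wm i k ` \<Delta>" if "k \<le> l" for k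
    using wm_image_mono(1)[of k "Suc l" i] i that by auto
  have "v = restrict v {..<l}" by (simp add: v_def)
  then have "v \<in> words l" "z \<in> wm v l ` \<Delta>" using r(1,2)[of l] z[of l] by simp_all
  then show ?thesis using r z by (intro bexI[of _ v]) auto
qed

text \<open>Boundedly many cylinders of level k meet the ball. Each splits into the product of the
  numbers of maps many cylinders of level l, and each of these fits into a ball of radius D *
  \<open>rho l\<close>.\<close>

lemma covering_number_upper:
  "\<exists>K::nat. \<forall>k l r R x. k \<le> l \<longrightarrow> R \<le> A * rho k \<longrightarrow> D * rho l \<le> r \<longrightarrow>
     covering_number r (F \<inter> cball x R) \<le> enat (K * (\<Prod>j=k..<l. N (\<omega> j)))"
proof -
  obtain K :: nat where K: "\<forall>k x W. W \<subseteq> words k \<longrightarrow>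
      (\<forall>w\<in>W. dist x (wm w k u) \<le> (A + D) * rho k) \<longrightarrow> card W \<le> K"
    using word_packing[of "A + D"] by blast
  have "covering_number r (F \<inter> cball x R) \<le> enat (K * (\<Prod>j=k..<l. N (\<omega> j)))"
    if kl: "k \<le> l" and R: "R \<le> A * rho k" and r: "D * rho l \<le> r" for k l r R x
  proof -
    define W where "W = {w \<in> words k. wm w k ` \<Delta> \<inter> cball x R \<noteq> {}}"
    define E where "E w = {v \<in> words l. restrict v {..<k} = w}" for w
    define \<B> where "\<B> = (\<lambda>v. cball (wm v l u) (D * rho l)) ` (\<Union>w\<in>W. E w)"
    have fin: "finite W" "finite (E w)" for w
      using finite_words by (auto simp: W_def E_def)
    have "card W \<le> K"
    proof (rule K[rule_format])
      fix w assume w: "w \<in> W"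
      then obtain z where z: "z \<in> wm w k ` \<Delta>" "dist x z \<le> R"
        unfolding W_def mem_Collect_eq disjoint_iff mem_cball by blast
      have "dist x (wm w k u) \<le> dist x z + dist (wm w k u) z"
        by (metis dist_commute dist_triangle)
      also have "dist (wm w k u) z \<le> D * rho k"
        using w z words_D by (intro dist_wm_u_le) (auto simp: W_def)
      finally show "dist x (wm w k u) \<le> (A + D) * rho k"
        using z(2) R by (simp add: algebra_simps)
    qed (auto simp: W_def)
    have "F \<inter> cball x R \<subseteq> \<Union>\<B>"
    proof
      fix z assume z: "z \<in> F \<inter> cball x R"
      then obtain v where v: "v \<in> words l" "z \<in> wm v l ` \<Delta>" "restrict v {..<k} \<in> words k"
          "z \<in> wm (restrict v {..<k}) k ` \<Delta>"
        using F_in_cylinder[of z l] kl by blast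
      have "v \<in> (\<Union>w\<in>W. E w)" using v z by (auto simp: W_def E_def)
      moreover have "z \<in> cball (wm v l u) (D * rho l)"
        using dist_wm_u_le[OF words_D[OF v(1)] v(2)] by auto
      ultimately show "z \<in> \<Union>\<B>" unfolding \<B>_def by blast
    qed
    then have "covering_number r (F \<inter> cball x R) \<le> enat (card \<B>)"
      using fin r by (intro covering_number_le) (auto simp: \<B>_def)
    also have "card \<B> \<le> card (\<Union>w\<in>W. E w)"
      unfolding \<B>_def using fin by (intro card_image_le) auto
    also have "\<dots> \<le> (\<Sum>w\<in>W. card (E w))" by (rule card_UN_le[OF fin(1)])
    also have "\<dots> = card W * (\<Prod>j=k..<l. N (\<omega> j))"
      unfolding E_def using card_extensions[OF kl] by (simp add: W_def)
    also have "\<dots> \<le> K * (\<Prod>j=k..<l. N (\<omega> j))" using \<open>card W \<le> K\<close> by simp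
    finally show ?thesis by simp
  qed
  then show ?thesis by blast
qed

text \<open>All of a cylinder of level k lies within 2 * D * \<open>rho k\<close> of any of its
  points. A point of F is picked in each of its subcylinders of level l, and by packing a covering
  ball contains boundedly many of them.\<close>

lemma covering_number_lower:
  "\<exists>K::nat. \<forall>k l r R. k \<le> l \<longrightarrow> 2 * D * rho k \<le> R \<longrightarrow> r \<le> A * rho l \<longrightarrow>
     (\<exists>x\<in>F. enat (\<Prod>j=k..<l. N (\<omega> j)) \<le> enat K * covering_number r (F \<inter> cball x R))"
proof -
  obtain K :: nat where K: "\<forall>k x W. W \<subseteq> words k \<longrightarrow>
      (\<forall>w\<in>W. dist x (wm w k u) \<le> (A + D) * rho k) \<longrightarrow> card W \<le> K"
    using word_packing[of "A + D"] by blast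
  \<comment> \<open>\<open>Suc K\<close> guarantees the positive factor that the passage to the
    infimum requires.\<close>
  have "\<exists>x\<in>F. enat (\<Prod>j=k..<l. N (\<omega> j)) \<le> enat (Suc K) * covering_number r (F \<inter> cball x R)"
    if kl: "k \<le> l" and R: "2 * D * rho k \<le> R" and r: "r \<le> A * rho l" for k l r R
  proof -
    \<comment> \<open>Any word would do: at a given level the number of extensions does not depend
      on the prefix.\<close>
    define w where "w = (\<lambda>j\<in>{..<k}. 1::nat)"
    have w: "w \<in> words k" using N_ge_1 by (auto simp: w_def words_def)
    obtain x where x: "x \<in> F" "x \<in> wm w k ` \<Delta>" using F_meets_cylinder[OF w] .
    define E where "E = {v \<in> words l. restrict v {..<k} = w}"
    have "\<exists>p. p \<in> F \<and> p \<in> wm v l ` \<Delta>" if "v \<in> words l" for v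
      using F_meets_cylinder[OF that] by blast
    then obtain p where p: "\<And>v. v \<in> words l \<Longrightarrow> p v \<in> F \<and> p v \<in> wm v l ` \<Delta>" by metis
    have px: "p v \<in> F \<inter> cball x R" if "v \<in> E" for v
    proof -
      have v: "v \<in> words l" "restrict v {..<k} = w" using that by (auto simp: E_def)
      have "wm v k = wm w k" using v(2)[symmetric] by (intro wm_cong) simp
      then have "p v \<in> wm w k ` \<Delta>"
        using wm_image_mono(1)[OF kl words_D[OF v(1)]] p[OF v(1)] by auto
      then have "dist (wm w k u) (p v) \<le> D * rho k" "dist (wm w k u) x \<le> D * rho k"
        using dist_wm_u_le[OF words_D[OF w]] x by auto
      then have "dist x (p v) \<le> 2 * D * rho k"
        using dist_triangle[of x "p v" "wm w k u"] by (simp add: dist_commute)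
      then show ?thesis using p[OF v(1)] R by auto
    qed
    have "card E \<le> Suc K * card \<B>"
      if \<B>: "finite \<B>" "\<forall>B\<in>\<B>. \<exists>y \<rho>. \<rho> \<le> r \<and> B = cball y \<rho>" "F \<inter> cball x R \<subseteq> \<Union>\<B>" for \<B>
    proof -
      have "\<exists>B\<in>\<B>. p v \<in> B" if "v \<in> E" for v using px[OF that] \<B>(3) by blast
      then have "E \<subseteq> (\<Union>B\<in>\<B>. {v \<in> E. p v \<in> B})" by blast
      then have "card E \<le> card (\<Union>B\<in>\<B>. {v \<in> E. p v \<in> B})"
        using \<B>(1) finite_words by (intro card_mono) (auto simp: E_def)
      also have "\<dots> \<le> (\<Sum>B\<in>\<B>. card {v \<in> E. p v \<in> B})" by (rule card_UN_le[OF \<B>(1)])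
      also have "\<dots> \<le> (\<Sum>B\<in>\<B>. K)"
      proof (rule sum_mono)
        fix B assume "B \<in> \<B>"
        then obtain y \<rho> where B: "\<rho> \<le> r" "B = cball y \<rho>" using \<B>(2) by blast
        show "card {v \<in> E. p v \<in> B} \<le> K"
        proof (rule K[rule_format])
          fix v assume "v \<in> {v \<in> E. p v \<in> B}"
          then have v: "v \<in> words l" "dist y (p v) \<le> r" using B by (auto simp: E_def)
          have "dist y (wm v l u) \<le> dist y (p v) + dist (wm v l u) (p v)"
            by (metis dist_commute dist_triangle)
          also have "dist (wm v l u) (p v) \<le> D * rho l"
            using p[OF v(1)] by (intro dist_wm_u_le words_D[OF v(1)]) auto
          finally show "dist y (wm v l u) \<le> (A + D) * rho l"
            using v(2) r by (simp add: algebra_simps)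
        qed (auto simp: E_def)
      qed
      finally show ?thesis by (simp add: mult.commute)
    qed
    moreover have "card E = (\<Prod>j=k..<l. N (\<omega> j))"
      unfolding E_def by (rule card_extensions[OF kl w])
    ultimately have "enat (\<Prod>j=k..<l. N (\<omega> j)) \<le> enat (Suc K) * covering_number r (F \<inter> cball x R)"
      by (intro le_covering_numberI) simp_all
    then show ?thesis using x(1) by blast
  qed
  then show ?thesis by blast
qed

end

section \<open>Dimensions and block sums\<close>

text \<open>Replacing R / r by a comparable quotient of ratio products must cost only a constant
  factor, for exponents s of either sign.\<close>

lemma powr_abs_bounds:
  fixes \<theta> M s :: real
  assumes "1 / M \<le> \<theta>" "\<theta> \<le> M" "0 < \<theta>" "0 < M"
  shows "\<theta> powr s \<le> M powr \<bar>s\<bar>" "M powr (- \<bar>s\<bar>) \<le> \<theta> powr s"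
proof -
  have "- ln M \<le> ln \<theta>" "ln \<theta> \<le> ln M"
    using assms ln_le_cancel_iff[of "1 / M" \<theta>] by (auto simp: ln_div)
  then have "\<bar>ln \<theta>\<bar> \<le> ln M" by linarith
  then have "\<bar>s * ln \<theta>\<bar> \<le> \<bar>s\<bar> * ln M"
    by (simp add: abs_mult mult_left_mono)
  then show "\<theta> powr s \<le> M powr \<bar>s\<bar>" "M powr (- \<bar>s\<bar>) \<le> \<theta> powr s"
    using assms by (auto simp: powr_def abs_le_iff)
qed

lemma spectrum_le_assouad_dimension:
  assumes "\<And>x. 0 < x \<Longrightarrow> x < 1 \<Longrightarrow> 0 < \<psi> x"
  shows "generalised_assouad_spectrum \<psi> F \<le> assouad_dimension F"
  unfolding generalised_assouad_spectrum_def assouad_dimension_def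
proof (rule Inf_superset_mono, rule subsetI)
  fix x assume "x \<in> {ereal s |s. \<exists>C>0. \<forall>r R. 0 < r \<and> r \<le> R \<and> R < 1 \<longrightarrow>
      ereal_of_enat (SUP x\<in>F. covering_number r (F \<inter> cball x R)) \<le> ereal (C * (R / r) powr s)}"
  then obtain s C where x: "x = ereal s" "C > 0" and C: "\<And>r R. 0 < r \<Longrightarrow> r \<le> R \<Longrightarrow> R < 1 \<Longrightarrow>
      ereal_of_enat (SUP x\<in>F. covering_number r (F \<inter> cball x R)) \<le> ereal (C * (R / r) powr s)"
    by blast
  have "ereal_of_enat (SUP x\<in>F. covering_number (R powr (1 + \<psi> R)) (F \<inter> cball x R))
      \<le> ereal (C * (R / R powr (1 + \<psi> R)) powr s)" if R: "R \<in> {0<..<1}" for R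
  proof (rule C)
    have "0 < \<psi> R" using R assms by simp
    then show "R powr (1 + \<psi> R) \<le> R"
      using R powr_mono'[of 1 "1 + \<psi> R" R] by simp
  qed (use R in auto)
  then show "x \<in> {ereal s |s. \<exists>C>0. \<forall>R\<in>{0<..<1}. let r = R powr (1 + \<psi> R) in
      ereal_of_enat (SUP x\<in>F. covering_number r (F \<inter> cball x R)) \<le> ereal (C * (R / r) powr s)}"
    unfolding Let_def using x by blast
qed

context homogeneous_iteration
begin

text \<open>Under homogeneity this is the logarithm of the ratio sum with exponent s of the label
  used at level j.\<close>

definition log_sum :: "real \<Rightarrow> nat \<Rightarrow> real" where
  "log_sum s j = ln (real (N (\<omega> j))) + s * ln (q j)"

text \<open>The stopping level of the scale t: for 0 < t < 1 the product \<open>rho\<close> at this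
  level lies between a * t and t.\<close>

definition idx :: "real \<Rightarrow> nat" where
  "idx t = (LEAST k. rho k \<le> t)"

abbreviation \<alpha> :: real where "\<alpha> \<equiv> - ln a"
abbreviation \<beta> :: real where "\<beta> \<equiv> - ln b"

section \<open>Exponential decay of the ratio products and stopping levels\<close>

lemma b_pos: "0 < b"
  using a_pos q_bounds[of 0] by linarith

lemma beta_pos: "0 < \<beta>"
  using b_pos b_less_1 by simp

lemma alpha_pos: "0 < \<alpha>"
  using a_pos q_bounds[of 0] b_less_1 by simp

lemma ln_q: "- \<alpha> \<le> ln (q j)" "ln (q j) \<le> - \<beta>"
  using q_bounds[of j] a_pos b_pos q_pos[of j] by simp_all

lemma ln_rho: "ln (rho k) = (\<Sum>j<k. ln (q j))"
  unfolding rho_def by (rule ln_prod) (simp, metis q_pos less_irrefl)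

lemma ln_rho_diff:
  assumes "k \<le> l"
  shows "ln (rho k) - ln (rho l) = (\<Sum>j=k..<l. - ln (q j))"
proof -
  have "(\<Sum>j<l. ln (q j)) = (\<Sum>j<k. ln (q j)) + (\<Sum>j=k..<l. ln (q j))"
    using sum.atLeastLessThan_concat[of 0 k l "\<lambda>j. ln (q j)"] assms
    by (simp add: lessThan_atLeast0)
  then show ?thesis by (simp add: ln_rho sum_negf)
qed

lemma ln_rho_diff_bounds:
  assumes "k \<le> l"
  shows "\<beta> * (real l - real k) \<le> ln (rho k) - ln (rho l)"
    and "ln (rho k) - ln (rho l) \<le> \<alpha> * (real l - real k)"
proof -
  have "(\<Sum>j=k..<l. \<beta>) \<le> (\<Sum>j=k..<l. - ln (q j))" "(\<Sum>j=k..<l. - ln (q j)) \<le> (\<Sum>j=k..<l. \<alpha>)"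
    using ln_q by (intro sum_mono; force)+
  then show "\<beta> * (real l - real k) \<le> ln (rho k) - ln (rho l)"
    "ln (rho k) - ln (rho l) \<le> \<alpha> * (real l - real k)"
    unfolding ln_rho_diff[OF assms] using assms by (simp_all add: of_nat_diff mult.commute)
qed

lemma rho_0 [simp]: "rho 0 = 1"
  by (simp add: rho_def)

lemma neg_ln_rho: "\<beta> * real k \<le> - ln (rho k)" "- ln (rho k) \<le> \<alpha> * real k"
  using ln_rho_diff_bounds[of 0 k] by simp_all

lemma rho_antimono: "k \<le> l \<Longrightarrow> rho l \<le> rho k"
proof -
  assume kl: "k \<le> l"
  then have "0 \<le> \<beta> * (real l - real k)" using beta_pos by (intro mult_nonneg_nonneg) auto
  also have "\<dots> \<le> ln (rho k) - ln (rho l)" by (rule ln_rho_diff_bounds(1)[OF kl])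
  finally show "rho l \<le> rho k" using rho_pos by simp
qed

lemma ex_rho_le:
  assumes "0 < t"
  shows "\<exists>k. rho k \<le> t"
proof -
  obtain k where "- ln t / \<beta> < real k" using reals_Archimedean2 by blast
  then have "- ln t < \<beta> * real k" using beta_pos by (simp add: divide_less_eq mult.commute)
  then have "ln (rho k) \<le> ln t" using neg_ln_rho(1)[of k] by linarith
  then show ?thesis using assms rho_pos by auto
qed

lemma rho_idx_le: "0 < t \<Longrightarrow> rho (idx t) \<le> t"
  unfolding idx_def using ex_rho_le by (rule LeastI_ex)

lemma idx_le: "rho k \<le> t \<Longrightarrow> idx t \<le> k"
  unfolding idx_def by (rule Least_le)

lemma idx_antimono: "0 < t \<Longrightarrow> t \<le> t' \<Longrightarrow> idx t' \<le> idx t"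
  using rho_idx_le[of t] by (intro idx_le) linarith

lemma rho_less_idx: "j < idx t \<Longrightarrow> t < rho j"
  using idx_le[of j t] by linarith

lemma less_idx: "0 < t \<Longrightarrow> t < rho k \<Longrightarrow> k < idx t"
  using rho_idx_le[of t] rho_antimono[of "idx t" k] by (metis linorder_not_less order.trans)

lemma idx_pos: "0 < t \<Longrightarrow> t < 1 \<Longrightarrow> 0 < idx t"
  using less_idx[of t 0] by simp

lemma rho_idx_ge:
  assumes "0 < t" "t < 1"
  shows "a * t < rho (idx t)"
proof -
  obtain m where m: "idx t = Suc m" using idx_pos[OF assms] gr0_conv_Suc by blast
  have "a * t < rho m * a" using rho_less_idx[of m t] m a_pos by (simp add: mult.commute)
  also have "\<dots> \<le> rho m * q m" using q_bounds(1)[of m] rho_pos[of m] by simp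
  finally show ?thesis by (simp add: m rho_Suc)
qed

text \<open>The exponent s is free. The identity expresses how far the number of words exceeds the
  s-th power of the scale ratio, and thereby turns covering bounds into bounds on block
  sums.\<close>

lemma prod_N_eq:
  assumes "k \<le> l"
  shows "real (\<Prod>j=k..<l. N (\<omega> j)) = exp (\<Sum>j=k..<l. log_sum s j) * (rho k / rho l) powr s"
proof -
  have Npos: "0 < real (N (\<omega> j))" for j using N_ge_1[of j] by simp
  have "real (\<Prod>j=k..<l. N (\<omega> j)) = exp (\<Sum>j=k..<l. ln (real (N (\<omega> j))))"
    using Npos by (simp add: exp_sum)
  moreover have "(rho k / rho l) powr s = exp (s * (ln (rho k) - ln (rho l)))"
    using rho_pos[of k] rho_pos[of l] by (simp add: powr_def ln_div)
  moreover have "(\<Sum>j=k..<l. log_sum s j) = (\<Sum>j=k..<l. ln (real (N (\<omega> j)))) - s * (ln (rho k) - ln (rho l))"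
    unfolding ln_rho_diff[OF assms] by (simp add: log_sum_def sum.distrib sum_negf sum_distrib_left)
  ultimately show ?thesis by (simp add: exp_diff)
qed

text \<open>The block ends at the stopping level of r / D so that cylinders of that level fit into
  balls of radius r.\<close>

lemma covering_sup_le:
  "\<exists>C>0. \<forall>r R. 0 < r \<and> r \<le> R \<and> R < 1 \<longrightarrow>
     ereal_of_enat (SUP x\<in>F. covering_number r (F \<inter> cball x R))
       \<le> ereal (C * exp (\<Sum>j=idx R..<idx (r / D). log_sum s j) * (R / r) powr s)"
proof -
  obtain K :: nat where K: "\<forall>k l r R x. k \<le> l \<longrightarrow> R \<le> 1 / a * rho k \<longrightarrow> D * rho l \<le> r \<longrightarrow>
     covering_number r (F \<inter> cball x R) \<le> enat (K * (\<Prod>j=k..<l. N (\<omega> j)))"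
    using covering_number_upper[of "1 / a"] by blast
  \<comment> \<open>The factor D comes from using r / D in place of r, and 1 / a from the overshoot
    at the stopping levels.\<close>
  define M where "M = D / a"
  have M: "0 < M" using a_pos D_ge_1 by (simp add: M_def)
  have "ereal_of_enat (SUP x\<in>F. covering_number r (F \<inter> cball x R))
       \<le> ereal ((real K + 1) * M powr \<bar>s\<bar> * exp (\<Sum>j=idx R..<idx (r / D). log_sum s j) * (R / r) powr s)"
    if r: "0 < r" "r \<le> R" "R < 1" for r R
  proof -
    define k l where "k = idx R" and "l = idx (r / D)"
    have rD: "0 < r / D" "r / D \<le> r" "r / D < 1"
    proof -
      show "0 < r / D" using r D_ge_1 by simp
      show "r / D \<le> r" using r D_ge_1 by (simp add: divide_le_eq)
      then show "r / D < 1" using r by linarith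
    qed
    have kl: "k \<le> l" unfolding k_def l_def using rD r by (intro idx_antimono) auto
    have k: "a * R < rho k" "rho k \<le> R"
      unfolding k_def using rho_idx_ge[of R] rho_idx_le[of R] r by auto
    have l: "a * (r / D) < rho l" "rho l \<le> r / D"
      unfolding l_def using rho_idx_ge[of "r / D"] rho_idx_le[of "r / D"] rD by auto
    have "R \<le> 1 / a * rho k" using k a_pos by (simp add: field_simps)
    moreover have "D * rho l \<le> r" using l D_ge_1 by (simp add: field_simps)
    ultimately have "covering_number r (F \<inter> cball x R) \<le> enat (K * (\<Prod>j=k..<l. N (\<omega> j)))" for x
      using K kl by blast
    then have "(SUP x\<in>F. covering_number r (F \<inter> cball x R)) \<le> enat (K * (\<Prod>j=k..<l. N (\<omega> j)))"
      by (intro SUP_least)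
    then have "ereal_of_enat (SUP x\<in>F. covering_number r (F \<inter> cball x R))
        \<le> ereal_of_enat (enat (K * (\<Prod>j=k..<l. N (\<omega> j))))"
      by (simp only: ereal_of_enat_le_iff)
    also have "\<dots> = ereal (real K * real (\<Prod>j=k..<l. N (\<omega> j)))" by simp
    also have "\<dots> \<le> ereal ((real K + 1) * M powr \<bar>s\<bar> * exp (\<Sum>j=k..<l. log_sum s j) * (R / r) powr s)"
    proof -
      define \<theta> where "\<theta> = rho k / rho l / (R / r)"
      have pos: "0 < \<theta>" using rho_pos[of k] rho_pos[of l] r by (simp add: \<theta>_def)
      have "\<theta> \<le> M"
      proof -
        have "rho k * r * a \<le> R * (r * a)" using k r a_pos by simp
        also have "\<dots> \<le> R * (rho l * D)" using l r a_pos D_ge_1 by (intro mult_left_mono) (auto simp: field_simps)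
        finally show ?thesis using rho_pos[of l] r a_pos by (simp add: \<theta>_def M_def field_simps)
      qed
      moreover have "1 / M \<le> \<theta>"
      proof -
        have "a * R * rho l \<le> rho k * (r / D)"
          using k l r rho_pos[of k] rho_pos[of l] by (intro mult_mono) auto
        also have "\<dots> \<le> rho k * (r * D)" using rD r D_ge_1 rho_pos[of k]
          by (intro mult_left_mono) (auto intro: order_trans[of _ r])
        finally show ?thesis using rho_pos[of l] r a_pos D_ge_1 by (simp add: \<theta>_def M_def field_simps)
      qed
      ultimately have \<theta>: "\<theta> powr s \<le> M powr \<bar>s\<bar>" using pos M by (intro powr_abs_bounds)
      have "rho k / rho l = \<theta> * (R / r)" using r by (simp add: \<theta>_def)
      then have "(rho k / rho l) powr s = \<theta> powr s * (R / r) powr s"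
        using pos r by (simp only: powr_mult)
      also have "\<dots> \<le> M powr \<bar>s\<bar> * (R / r) powr s" using \<theta> by (intro mult_right_mono) auto
      finally have *: "(rho k / rho l) powr s \<le> M powr \<bar>s\<bar> * (R / r) powr s" .
      have "real K * real (\<Prod>j=k..<l. N (\<omega> j)) \<le> (real K + 1) * real (\<Prod>j=k..<l. N (\<omega> j))"
        by (intro mult_right_mono of_nat_0_le_iff) simp
      also have "\<dots> = (real K + 1) * (exp (\<Sum>j=k..<l. log_sum s j) * (rho k / rho l) powr s)"
        by (simp only: prod_N_eq[OF kl, of s])
      also have "\<dots> \<le> (real K + 1) * (exp (\<Sum>j=k..<l. log_sum s j) * (M powr \<bar>s\<bar> * (R / r) powr s))"
        using * by (intro mult_left_mono) auto
      finally show ?thesis by (simp add: mult_ac)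
    qed
    finally show ?thesis unfolding k_def l_def .
  qed
  moreover have "0 < (real K + 1) * M powr \<bar>s\<bar>" using M by (simp add: add_pos_nonneg)
  ultimately show ?thesis by blast
qed

text \<open>The radius is taken from the level k, as 2 * D * \<open>rho k\<close>, so that a ball
  about a point of F contains a whole cylinder. To refute an exponent it is enough to test these
  radii.\<close>

lemma covering_sup_ge:
  "\<exists>C>0. \<forall>k r. 0 < r \<and> r < 1 \<and> k \<le> idx r \<longrightarrow>
     ereal (C * exp (\<Sum>j=k..<idx r. log_sum s j) * (2 * D * rho k / r) powr s)
       \<le> ereal_of_enat (SUP x\<in>F. covering_number r (F \<inter> cball x (2 * D * rho k)))"
proof -
  obtain K :: nat where K: "\<forall>k l r R. k \<le> l \<longrightarrow> 2 * D * rho k \<le> R \<longrightarrow> r \<le> 1 / a * rho l \<longrightarrow>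
     (\<exists>x\<in>F. enat (\<Prod>j=k..<l. N (\<omega> j)) \<le> enat K * covering_number r (F \<inter> cball x R))"
    using covering_number_lower[of "1 / a"] by blast
  \<comment> \<open>A crude symmetric constant: the quotient \<theta> below lies between 1 / M and
    M.\<close>
  define M where "M = 2 * D / a"
  have M: "0 < M" using a_pos D_ge_1 by (simp add: M_def)
  have a1: "a < 1" using q_bounds[of 0] b_less_1 by linarith
  have "ereal (M powr (- \<bar>s\<bar>) / (real K + 1) * exp (\<Sum>j=k..<idx r. log_sum s j) * (2 * D * rho k / r) powr s)
       \<le> ereal_of_enat (SUP x\<in>F. covering_number r (F \<inter> cball x (2 * D * rho k)))" (is "_ \<le> ereal_of_enat ?S")
    if r: "0 < r" "r < 1" "k \<le> idx r" for k r
  proof (cases "?S")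
    case (enat n)
    define l where "l = idx r"
    have l: "a * r < rho l" "rho l \<le> r" "k \<le> l"
      unfolding l_def using rho_idx_ge[of r] rho_idx_le[of r] r by auto
    then have "r \<le> 1 / a * rho l" using a_pos by (simp add: field_simps)
    then obtain x where x: "x \<in> F" "enat (\<Prod>j=k..<l. N (\<omega> j)) \<le> enat K * covering_number r (F \<inter> cball x (2 * D * rho k))"
      using K l(3) order_refl by blast
    note x(2)
    also have "enat K * covering_number r (F \<inter> cball x (2 * D * rho k)) \<le> enat K * enat n"
      unfolding enat[symmetric] by (intro mult_left_mono SUP_upper x(1)) simp
    finally have "(\<Prod>j=k..<l. N (\<omega> j)) \<le> K * n" by simp
    then have "real (\<Prod>j=k..<l. N (\<omega> j)) \<le> real K * real n"
      by (metis of_nat_le_iff of_nat_mult)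
    also have "\<dots> \<le> (real K + 1) * real n" by (intro mult_right_mono) auto
    finally have le: "exp (\<Sum>j=k..<l. log_sum s j) * (rho k / rho l) powr s \<le> (real K + 1) * real n"
      by (simp only: prod_N_eq[OF l(3), of s])
    define \<theta> where "\<theta> = r / (2 * D * rho l)"
    have pos: "0 < \<theta>" using rho_pos[of l] r D_ge_1 by (simp add: \<theta>_def)
    have "\<theta> \<le> M"
    proof -
      have "r * a \<le> rho l * 1" using l by (simp add: mult.commute)
      also have "\<dots> \<le> rho l * ((2 * D) * (2 * D))"
        using D_ge_1 rho_pos[of l] mult_mono[of 1 "2 * D" 1 "2 * D"] by (intro mult_left_mono) auto
      finally show ?thesis using rho_pos[of l] a_pos D_ge_1 by (simp add: \<theta>_def M_def field_simps)
    qed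
    moreover have "1 / M \<le> \<theta>"
    proof -
      have "a * rho l \<le> 1 * r" using l a1 a_pos r rho_pos[of l] by (intro mult_mono) auto
      then show ?thesis using rho_pos[of l] r a_pos D_ge_1 by (simp add: \<theta>_def M_def field_simps)
    qed
    ultimately have \<theta>: "M powr (- \<bar>s\<bar>) \<le> \<theta> powr s" using pos M by (intro powr_abs_bounds)
    have "rho k / rho l = \<theta> * (2 * D * rho k / r)" using r D_ge_1 by (simp add: \<theta>_def)
    then have "(rho k / rho l) powr s = \<theta> powr s * (2 * D * rho k / r) powr s"
      using pos r D_ge_1 rho_pos[of k] by (simp only: powr_mult)
    moreover have "M powr (- \<bar>s\<bar>) * (2 * D * rho k / r) powr s \<le> \<theta> powr s * (2 * D * rho k / r) powr s"
      using \<theta> by (intro mult_right_mono) auto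
    ultimately have "exp (\<Sum>j=k..<l. log_sum s j) * (M powr (- \<bar>s\<bar>) * (2 * D * rho k / r) powr s)
        \<le> exp (\<Sum>j=k..<l. log_sum s j) * (rho k / rho l) powr s"
      by (intro mult_left_mono) auto
    also note le
    finally have "M powr (- \<bar>s\<bar>) / (real K + 1) * exp (\<Sum>j=k..<l. log_sum s j) * (2 * D * rho k / r) powr s \<le> real n"
      by (simp add: field_simps)
    then show ?thesis unfolding enat l_def by simp
  qed simp
  moreover have "0 < M powr (- \<bar>s\<bar>) / (real K + 1)" using M by (simp add: add_pos_nonneg)
  ultimately show ?thesis by blast
qed

lemma assouad_dimension_le:
  assumes "\<And>j. log_sum s j \<le> 0"
  shows "assouad_dimension F \<le> ereal s"
proof -
  obtain C where C: "C > 0" "\<And>r R. 0 < r \<Longrightarrow> r \<le> R \<Longrightarrow> R < 1 \<Longrightarrow>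
     ereal_of_enat (SUP x\<in>F. covering_number r (F \<inter> cball x R))
       \<le> ereal (C * exp (\<Sum>j=idx R..<idx (r / D). log_sum s j) * (R / r) powr s)"
    using covering_sup_le[of s] by blast
  have "ereal_of_enat (SUP x\<in>F. covering_number r (F \<inter> cball x R)) \<le> ereal (C * (R / r) powr s)"
    if r: "0 < r" "r \<le> R" "R < 1" for r R
  proof -
    note C(2)[OF r]
    also have "C * exp (\<Sum>j=idx R..<idx (r / D). log_sum s j) * (R / r) powr s \<le> C * 1 * (R / r) powr s"
      using C(1) assms by (intro mult_right_mono mult_left_mono) (auto intro: sum_nonpos)
    finally show ?thesis by simp
  qed
  then show ?thesis
    unfolding assouad_dimension_def using C(1) by (intro Inf_lower) blast
qed

lemma spectrum_le:
  assumes \<psi>: "\<And>x. 0 < x \<Longrightarrow> x < 1 \<Longrightarrow> 0 < \<psi> x"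
    and B: "\<And>R. 0 < R \<Longrightarrow> R < 1 \<Longrightarrow> (\<Sum>j=idx R..<idx (R powr (1 + \<psi> R) / D). log_sum s j) \<le> B"
  shows "generalised_assouad_spectrum \<psi> F \<le> ereal s"
proof -
  obtain C where C: "C > 0" "\<And>r R. 0 < r \<Longrightarrow> r \<le> R \<Longrightarrow> R < 1 \<Longrightarrow>
     ereal_of_enat (SUP x\<in>F. covering_number r (F \<inter> cball x R))
       \<le> ereal (C * exp (\<Sum>j=idx R..<idx (r / D). log_sum s j) * (R / r) powr s)"
    using covering_sup_le[of s] by blast
  have "ereal_of_enat (SUP x\<in>F. covering_number (R powr (1 + \<psi> R)) (F \<inter> cball x R))
      \<le> ereal (C * exp B * (R / R powr (1 + \<psi> R)) powr s)"
    if R: "0 < R" "R < 1" for R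
  proof -
    have r: "0 < R powr (1 + \<psi> R)" "R powr (1 + \<psi> R) \<le> R"
      using R \<psi>[OF R] powr_mono'[of 1 "1 + \<psi> R" R] by auto
    note C(2)[OF r R(2)]
    also have "C * exp (\<Sum>j=idx R..<idx (R powr (1 + \<psi> R) / D). log_sum s j) * (R / R powr (1 + \<psi> R)) powr s
        \<le> C * exp B * (R / R powr (1 + \<psi> R)) powr s"
      using C(1) B[OF R] by (intro mult_right_mono mult_left_mono) auto
    finally show ?thesis by simp
  qed
  then have "\<exists>C>0. \<forall>R\<in>{0<..<1}. let r = R powr (1 + \<psi> R) in
      ereal_of_enat (SUP x\<in>F. covering_number r (F \<inter> cball x R)) \<le> ereal (C * (R / r) powr s)"
    unfolding Let_def using C(1) by (intro exI[of _ "C * exp B"]) auto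
  then show ?thesis
    unfolding generalised_assouad_spectrum_def by (intro Inf_lower) blast
qed

lemma spectrum_ge:
  assumes \<psi>: "\<And>x. 0 < x \<Longrightarrow> x < 1 \<Longrightarrow> 0 < \<psi> x"
    and B: "\<And>B. \<exists>k. 2 * D * rho k < 1 \<and> k \<le> idx ((2 * D * rho k) powr (1 + \<psi> (2 * D * rho k))) \<and>
      B \<le> (\<Sum>j=k..<idx ((2 * D * rho k) powr (1 + \<psi> (2 * D * rho k))). log_sum s j)"
  shows "ereal s \<le> generalised_assouad_spectrum \<psi> F"
  unfolding generalised_assouad_spectrum_def
proof (rule Inf_greatest)
  fix x assume "x \<in> {ereal s |s. \<exists>C>0. \<forall>R\<in>{0<..<1}. let r = R powr (1 + \<psi> R) in
      ereal_of_enat (SUP x\<in>F. covering_number r (F \<inter> cball x R)) \<le> ereal (C * (R / r) powr s)}"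
  then obtain s' C where x: "x = ereal s'" and C: "C > 0" "\<And>R. 0 < R \<Longrightarrow> R < 1 \<Longrightarrow>
      ereal_of_enat (SUP x\<in>F. covering_number (R powr (1 + \<psi> R)) (F \<inter> cball x R))
        \<le> ereal (C * (R / R powr (1 + \<psi> R)) powr s')"
    unfolding Let_def by force
  obtain C' where C': "C' > 0" "\<And>k r. 0 < r \<Longrightarrow> r < 1 \<Longrightarrow> k \<le> idx r \<Longrightarrow>
     ereal (C' * exp (\<Sum>j=k..<idx r. log_sum s j) * (2 * D * rho k / r) powr s)
       \<le> ereal_of_enat (SUP x\<in>F. covering_number r (F \<inter> cball x (2 * D * rho k)))"
    using covering_sup_ge[of s] by blast
  show "ereal s \<le> x"
  proof (rule ccontr)
    assume "\<not> ?thesis"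
    then have s: "s' < s" by (simp add: x)
    obtain k where "2 * D * rho k < 1 \<and> k \<le> idx ((2 * D * rho k) powr (1 + \<psi> (2 * D * rho k))) \<and>
      ln (C / C') + 1 \<le> (\<Sum>j=k..<idx ((2 * D * rho k) powr (1 + \<psi> (2 * D * rho k))). log_sum s j)"
      using B by blast
    moreover define R r where "R = 2 * D * rho k" and "r = R powr (1 + \<psi> R)"
    ultimately have k: "R < 1" "k \<le> idx r" "ln (C / C') + 1 \<le> (\<Sum>j=k..<idx r. log_sum s j)"
      by simp_all
    have R: "0 < R" using rho_pos[of k] D_ge_1 by (simp add: R_def)
    have r: "0 < r" "r \<le> R" "r < 1"
    proof -
      show "0 < r" using R by (simp add: r_def)
      show "r \<le> R" using R k(1) \<psi>[OF R k(1)] powr_mono'[of 1 "1 + \<psi> R" R] by (auto simp: r_def)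
      then show "r < 1" using k(1) by simp
    qed
    have "ereal (C' * exp (\<Sum>j=k..<idx r. log_sum s j) * (R / r) powr s) \<le> ereal (C * (R / r) powr s')"
      using order_trans[OF C'(2)[OF r(1,3) k(2)] C(2)[OF R k(1), folded r_def, unfolded R_def]]
      by (simp add: R_def)
    then have "C' * exp (\<Sum>j=k..<idx r. log_sum s j) * (R / r) powr s \<le> C * (R / r) powr s'" by simp
    also have "\<dots> \<le> C * (R / r) powr s"
      using C(1) s r by (intro mult_left_mono powr_mono) auto
    finally have "C' * exp (\<Sum>j=k..<idx r. log_sum s j) \<le> C" using R r by simp
    then have "exp (\<Sum>j=k..<idx r. log_sum s j) \<le> C / C'" using C' by (simp add: field_simps)
    then have "(\<Sum>j=k..<idx r. log_sum s j) \<le> ln (C / C')"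
      using C(1) C'(1) by (simp add: ln_ge_iff)
    then show False using k(3) by simp
  qed
qed

section \<open>Box dimension from averages of the logarithmic sums\<close>

lemma F_nonempty: "F \<noteq> {}"
proof -
  have "(\<lambda>j\<in>{..<0::nat}. 1::nat) \<in> words 0" by (simp add: words_def restrict_def)
  then show ?thesis using F_meets_cylinder by blast
qed

lemma F_subset_cball:
  assumes "x \<in> F"
  shows "F \<subseteq> cball x (2 * D)"
proof
  fix y assume y: "y \<in> F"
  have "dist u z \<le> D" if "z \<in> F" for z
  proof -
    have "z \<in> \<Delta>"
      using F_in_cylinder[OF that, of 0] wm_image_subset(1)[of 0] by auto
    then show ?thesis by (rule dist_Delta)
  qed
  from this[OF assms] this[OF y] have "dist u x + dist u y \<le> 2 * D" by simp
  then show "y \<in> cball x (2 * D)" using dist_triangle2[of x y u] by (simp add: dist_commute)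
qed

lemma filterlim_idx:
  assumes "1 \<le> E"
  shows "filterlim (\<lambda>r. idx (r / E)) at_top (at_right 0)"
  unfolding filterlim_at_top
proof
  fix n
  have "\<forall>\<^sub>F r in at_right 0. r \<in> {0<..<rho n}"
    using rho_pos[of n] by (rule eventually_at_right_real)
  then show "\<forall>\<^sub>F r in at_right 0. n \<le> idx (r / E)"
  proof eventually_elim
    case (elim r)
    then have "0 < r / E" "r / E < rho n"
      using assms by (auto simp: divide_less_eq intro: order.strict_trans2[of _ "rho n * 1"])
    then show ?case using less_idx[of "r / E" n] by simp
  qed
qed

lemma idx_le_ln:
  assumes "0 < t" "t < 1"
  shows "real (idx t) \<le> - ln t / \<beta> + 1"
proof -
  obtain m where m: "idx t = Suc m" using idx_pos[OF assms] gr0_conv_Suc by blast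
  have "t < rho m" using rho_less_idx[of m t] m by simp
  then have "\<beta> * real m \<le> - ln t" using neg_ln_rho(1)[of m] assms(1) rho_pos[of m] by (smt (verit) ln_less_cancel_iff)
  then have "real m * \<beta> \<le> - ln t" by (simp add: mult.commute)
  then have "real m \<le> - ln t / \<beta>" by (rule pos_le_divide_eq[OF beta_pos, THEN iffD2])
  then show ?thesis by (simp add: m)
qed

lemma average_at_idx:
  assumes E: "1 \<le> E" and S: "(\<lambda>l. S l / real l) \<longlonglongrightarrow> (0::real)"
  shows "((\<lambda>r. S (idx (r / E)) / - ln r) \<longlongrightarrow> 0) (at_right 0)"
proof (rule tendsto_0_le)
  show "((\<lambda>r. S (idx (r / E)) / real (idx (r / E))) \<longlongrightarrow> 0) (at_right 0)"
    by (rule filterlim_compose[OF S filterlim_idx[OF E]])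
  have "\<forall>\<^sub>F r in at_right 0. r \<in> {0<..<min (1 / E) b}"
    using E b_pos by (intro eventually_at_right_real) auto
  then show "\<forall>\<^sub>F r in at_right 0. norm (S (idx (r / E)) / - ln r)
      \<le> norm (S (idx (r / E)) / real (idx (r / E))) * (3 / \<beta>)"
  proof eventually_elim
    case (elim r)
    then have r: "0 < r" "r < 1 / E" "r < b" by auto
    have rE: "0 < r / E" "r / E < 1"
    proof -
      show "0 < r / E" using r E by simp
      have "r / E \<le> r" using r E by (simp add: divide_le_eq)
      then show "r / E < 1" using r b_less_1 by linarith
    qed
    have lnr: "\<beta> < - ln r" "ln E < - ln r"
    proof -
      show "\<beta> < - ln r" using r b_pos by simp
      have "ln r < ln (1 / E)" using r E by (subst ln_less_cancel_iff) auto
      then show "ln E < - ln r" using E by (simp add: ln_div)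
    qed
    define l where "l = idx (r / E)"
    have l: "0 < l" unfolding l_def by (rule idx_pos[OF rE])
    \<comment> \<open>Two units of the constant 3 come from r < 1 / E, which bounds ln E by - ln r.
      The third comes from r < b, which lets - ln r / \<beta> absorb the summand 1 of the level
      bound.\<close>
    have "- ln (r / E) \<le> 2 * - ln r" using lnr r E by (simp add: ln_div)
    then have "- ln (r / E) / \<beta> \<le> 2 * - ln r / \<beta>" using beta_pos by (intro divide_right_mono) auto
    moreover have "1 \<le> - ln r / \<beta>" using lnr beta_pos by (simp add: pos_le_divide_eq)
    ultimately have "real l \<le> 3 * - ln r / \<beta>" using idx_le_ln[OF rE] unfolding l_def[symmetric]
      by (simp add: add_divide_distrib[symmetric])
    then have "real l * \<beta> \<le> 3 * - ln r" using beta_pos by (simp only: pos_le_divide_eq)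
    moreover have "0 < real l * \<beta>" using l beta_pos by (intro mult_pos_pos) auto
    ultimately have "3 / (3 * - ln r) \<le> 3 / (real l * \<beta>)"
      using lnr beta_pos l by (intro divide_left_mono mult_pos_pos) auto
    then have "1 / - ln r \<le> 3 / (real l * \<beta>)" by simp
    then have "\<bar>S l\<bar> * (1 / - ln r) \<le> \<bar>S l\<bar> * (3 / (real l * \<beta>))" by (rule mult_left_mono) simp
    moreover have "norm (S l / - ln r) = \<bar>S l\<bar> * (1 / - ln r)"
      using lnr beta_pos by (simp add: abs_div)
    moreover have "norm (S l / real l) * (3 / \<beta>) = \<bar>S l\<bar> * (3 / (real l * \<beta>))"
      using l by (simp add: abs_div)
    ultimately show ?case unfolding l_def by linarith
  qed
qed

text \<open>Since \<open>rho 0 = 1\<close> and F lies in the ball of radius 2 * D about each of its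
  points, the cylinder estimates at level 0 concern all of F. The upper one stops at the level of r
  / D and the lower one at that of r, so two partial sums enter the error.\<close>

lemma box_dimension_eq:
  assumes S: "(\<lambda>l. (\<Sum>j<l. log_sum d j) / real l) \<longlonglongrightarrow> 0"
  shows "has_box_dimension F (ereal d)"
proof -
  obtain x0 where x0: "x0 \<in> F" using F_nonempty by blast
  have F_eq: "F \<inter> cball x (2 * D) = F" if "x \<in> F" for x
    using F_subset_cball[OF that] by blast
  obtain K :: nat where K: "\<forall>k l r R x. k \<le> l \<longrightarrow> R \<le> 2 * D * rho k \<longrightarrow> D * rho l \<le> r \<longrightarrow>
     covering_number r (F \<inter> cball x R) \<le> enat (K * (\<Prod>j=k..<l. N (\<omega> j)))"
    using covering_number_upper[of "2 * D"] by blast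
  obtain K' :: nat where K': "\<forall>k l r R. k \<le> l \<longrightarrow> 2 * D * rho k \<le> R \<longrightarrow> r \<le> 1 / a * rho l \<longrightarrow>
     (\<exists>x\<in>F. enat (\<Prod>j=k..<l. N (\<omega> j)) \<le> enat K' * covering_number r (F \<inter> cball x R))"
    using covering_number_lower[of "1 / a"] by blast
  have up: "covering_number r F \<le> enat (K * (\<Prod>j=0..<l. N (\<omega> j)))" if "D * rho l \<le> r" for r l
    using K[rule_format, of 0 l "2 * D" r x0] that F_eq[OF x0] by simp
  have lo: "enat (\<Prod>j=0..<l. N (\<omega> j)) \<le> enat K' * covering_number r F" if "r \<le> 1 / a * rho l" for r l
    using K'[rule_format, of 0 l "2 * D" r] that F_eq by auto
  have fin: "covering_number r F \<noteq> \<infinity>" if r: "0 < r" for r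
  proof -
    have "rho (idx (r / D)) \<le> r / D" using r D_ge_1 by (intro rho_idx_le) simp
    then have "D * rho (idx (r / D)) \<le> r" using D_ge_1 by (simp add: field_simps)
    from up[OF this] show ?thesis by (cases "covering_number r F") auto
  qed
  define n where "n r = real (the_enat (covering_number r F))" for r
  have n: "covering_number r F = enat (the_enat (covering_number r F))" if "0 < r" for r
    using fin[OF that] by auto
  have prod: "real (\<Prod>j=0..<l. N (\<omega> j)) = exp ((\<Sum>j<l. log_sum d j) - d * ln (rho l))" for l
    using prod_N_eq[of 0 l d] rho_pos[of l]
    by (simp add: lessThan_atLeast0 powr_def ln_div exp_diff exp_minus field_simps)
  \<comment> \<open>Formulated with E because the upper estimate needs E = D and the lower one E =
    1.\<close>
  have ratio: "- \<bar>d\<bar> * ln (D / a) \<le> d * (ln (rho (idx (r / E))) - ln r) \<and>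
      d * (ln (rho (idx (r / E))) - ln r) \<le> \<bar>d\<bar> * ln (D / a)"
    if "0 < r" "r < 1" "1 \<le> E" "E \<le> D" for r E
  proof -
    have rE: "0 < r / E" "r / E < 1" using that by (auto simp: field_simps)
    have "a * (r / D) \<le> a * (r / E)" using that a_pos by (simp add: frac_le)
    also have "\<dots> < rho (idx (r / E))" using rho_idx_ge[OF rE] .
    finally have "ln (a * (r / D)) \<le> ln (rho (idx (r / E)))"
      using a_pos that D_ge_1 rho_pos by (subst ln_le_cancel_iff) auto
    moreover have "ln (a * (r / D)) = ln r - ln (D / a)"
      using a_pos that D_ge_1 by (simp add: ln_mult ln_div)
    moreover have "ln (rho (idx (r / E))) \<le> ln r"
    proof -
      have "rho (idx (r / E)) \<le> r / E" using rho_idx_le[OF rE(1)] .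
      also have "\<dots> \<le> r" using that by (simp add: field_simps)
      finally show ?thesis using rho_pos that by simp
    qed
    moreover have "0 \<le> ln (D / a)" using D_ge_1 a_pos q_bounds[of 0] b_less_1 by (simp add: field_simps)
    ultimately have "\<bar>ln (rho (idx (r / E))) - ln r\<bar> \<le> ln (D / a)" by linarith
    then have "\<bar>d * (ln (rho (idx (r / E))) - ln r)\<bar> \<le> \<bar>d\<bar> * ln (D / a)"
      by (simp add: abs_mult mult_left_mono)
    then show ?thesis by (simp add: abs_le_iff)
  qed
  define c where "c = ln (real K + 1) + ln (real K' + 1) + \<bar>d\<bar> * ln (D / a)"
  have cpos: "0 \<le> ln (real K + 1)" "0 \<le> ln (real K' + 1)" by simp_all
  have main: "\<bar>ln (n r) + d * ln r\<bar> \<le> c + \<bar>\<Sum>j<idx (r / D). log_sum d j\<bar> + \<bar>\<Sum>j<idx (r / 1). log_sum d j\<bar>"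
    if r: "0 < r" "r < 1" for r
  proof -
    have rD: "0 < r / D" using r D_ge_1 by simp
    have "rho (idx (r / D)) \<le> r / D" by (rule rho_idx_le[OF rD])
    then have "D * rho (idx (r / D)) \<le> r" using D_ge_1 by (simp add: field_simps)
    from up[OF this] have "the_enat (covering_number r F) \<le> K * (\<Prod>j=0..<idx (r / D). N (\<omega> j))"
      by (subst (asm) n[OF r(1)]) simp
    then have "n r \<le> real K * real (\<Prod>j=0..<idx (r / D). N (\<omega> j))"
      unfolding n_def by (metis of_nat_le_iff of_nat_mult)
    also have "\<dots> \<le> (real K + 1) * real (\<Prod>j=0..<idx (r / D). N (\<omega> j))"
      by (intro mult_right_mono of_nat_0_le_iff) simp
    finally have u: "n r \<le> (real K + 1) * exp ((\<Sum>j<idx (r / D). log_sum d j) - d * ln (rho (idx (r / D))))"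
      unfolding prod .
    have "a * r < rho (idx r)" by (rule rho_idx_ge[OF r])
    then have "r \<le> 1 / a * rho (idx r)" using a_pos by (simp add: field_simps)
    from lo[OF this] have "(\<Prod>j=0..<idx r. N (\<omega> j)) \<le> K' * the_enat (covering_number r F)"
      by (subst (asm) n[OF r(1)]) simp
    then have "real (\<Prod>j=0..<idx r. N (\<omega> j)) \<le> real K' * n r"
      unfolding n_def by (metis of_nat_le_iff of_nat_mult)
    also have "\<dots> \<le> (real K' + 1) * n r" by (intro mult_right_mono) (auto simp: n_def)
    finally have l: "exp ((\<Sum>j<idx r. log_sum d j) - d * ln (rho (idx r))) \<le> (real K' + 1) * n r"
      unfolding prod .
    then have "0 < (real K' + 1) * n r" using exp_gt_zero order.strict_trans2 by blast
    then have npos: "0 < n r" by (simp add: zero_less_mult_iff add_pos_nonneg)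
    have "ln (n r) \<le> ln ((real K + 1) * exp ((\<Sum>j<idx (r / D). log_sum d j) - d * ln (rho (idx (r / D)))))"
      using u npos by (subst ln_le_cancel_iff) (auto simp: add_nonneg_pos)
    also have "\<dots> = ln (real K + 1) + ((\<Sum>j<idx (r / D). log_sum d j) - d * ln (rho (idx (r / D))))"
      by (subst ln_mult) auto
    finally have "ln (n r) \<le> ln (real K + 1) + ((\<Sum>j<idx (r / D). log_sum d j) - d * ln (rho (idx (r / D))))" .
    moreover have "(\<Sum>j<idx r. log_sum d j) - d * ln (rho (idx r)) \<le> ln (real K' + 1) + ln (n r)"
    proof -
      have "ln (exp ((\<Sum>j<idx r. log_sum d j) - d * ln (rho (idx r)))) \<le> ln ((real K' + 1) * n r)"
        using l npos by (subst ln_le_cancel_iff) (auto simp: add_nonneg_pos)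
      also have "\<dots> = ln (real K' + 1) + ln (n r)" using npos by (subst ln_mult) auto
      finally show ?thesis by simp
    qed
    moreover have "- \<bar>d\<bar> * ln (D / a) \<le> d * ln (rho (idx (r / D))) - d * ln r"
      using conjunct1[OF ratio[OF r D_ge_1 order_refl]] unfolding right_diff_distrib .
    moreover have "d * ln (rho (idx r)) - d * ln r \<le> \<bar>d\<bar> * ln (D / a)"
      using conjunct2[OF ratio[OF r order_refl D_ge_1]] unfolding right_diff_distrib by simp
    ultimately show ?thesis
      using cpos abs_ge_zero[of "\<Sum>j<idx r. log_sum d j"] abs_ge_zero[of "\<Sum>j<idx (r / D). log_sum d j"]
        abs_ge_self[of "\<Sum>j<idx (r / D). log_sum d j"] abs_ge_minus_self[of "\<Sum>j<idx r. log_sum d j"]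
      unfolding c_def abs_le_iff div_by_1 by linarith
  qed
  have "((\<lambda>r. ln (n r) / - ln r - d) \<longlongrightarrow> 0) (at_right 0)"
  proof (rule Lim_null_comparison)
    have ev: "\<forall>\<^sub>F r in at_right (0::real). r \<in> {0<..<1}" by (rule eventually_at_right_real) simp
    show "\<forall>\<^sub>F r in at_right 0. norm (ln (n r) / - ln r - d) \<le>
        c / - ln r + \<bar>(\<Sum>j<idx (r / D). log_sum d j) / - ln r\<bar> + \<bar>(\<Sum>j<idx (r / 1). log_sum d j) / - ln r\<bar>"
      using ev
    proof eventually_elim
      case (elim r)
      then have r: "0 < r" "r < 1" by auto
      then have L: "0 < - ln r" by simp
      have "ln (n r) / - ln r - d = (ln (n r) + d * ln r) / - ln r" using L by (simp add: field_simps)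
      then have "norm (ln (n r) / - ln r - d) = \<bar>ln (n r) + d * ln r\<bar> / - ln r"
        using L by (simp add: abs_div)
      also have "\<dots> \<le> (c + \<bar>\<Sum>j<idx (r / D). log_sum d j\<bar> + \<bar>\<Sum>j<idx (r / 1). log_sum d j\<bar>) / - ln r"
        using main[OF r] L by (intro divide_right_mono) auto
      also have "\<dots> = c / - ln r + \<bar>(\<Sum>j<idx (r / D). log_sum d j) / - ln r\<bar> + \<bar>(\<Sum>j<idx (r / 1). log_sum d j) / - ln r\<bar>"
        using L by (simp add: add_divide_distrib abs_div)
      finally show ?case .
    qed
    have "filterlim (\<lambda>r::real. - ln r) at_top (at_right 0)"
      using ln_at_0 by (simp add: filterlim_uminus_at_top)
    then have lim1: "((\<lambda>r. c / - ln r) \<longlongrightarrow> 0) (at_right 0)"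
      by (intro tendsto_divide_0[OF tendsto_const] filterlim_at_top_imp_at_infinity)
    have lim2: "((\<lambda>r. \<bar>(\<Sum>j<idx (r / E). log_sum d j) / - ln r\<bar>) \<longlongrightarrow> 0) (at_right 0)" if "1 \<le> E" for E
      using average_at_idx[OF that S] by (rule tendsto_rabs_zero)
    show "((\<lambda>r. c / - ln r + \<bar>(\<Sum>j<idx (r / D). log_sum d j) / - ln r\<bar>
        + \<bar>(\<Sum>j<idx (r / 1). log_sum d j) / - ln r\<bar>) \<longlongrightarrow> 0) (at_right 0)"
      by (intro tendsto_add_zero lim1 lim2 D_ge_1 order_refl)
  qed
  then have "((\<lambda>r. ln (n r) / - ln r) \<longlongrightarrow> d) (at_right 0)" by (rule LIM_zero_cancel)
  then show ?thesis
    unfolding has_box_dimension_def n_def using fin by (auto intro: tendsto_ereal)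
qed

section \<open>Lengths of the blocks belonging to a spectrum\<close>

lemma filterlim_scale: "filterlim (\<lambda>k. - ln (2 * D * rho k)) at_top sequentially"
  unfolding filterlim_at_top eventually_sequentially
proof
  fix Z
  show "\<exists>n. \<forall>k\<ge>n. Z \<le> - ln (2 * D * rho k)"
  proof (intro exI allI impI)
    fix k assume "nat \<lceil>(Z + ln (2 * D)) / \<beta>\<rceil> \<le> k"
    then have "(Z + ln (2 * D)) / \<beta> \<le> real k" by linarith
    then have "Z + ln (2 * D) \<le> real k * \<beta>" by (rule pos_divide_le_eq[OF beta_pos, THEN iffD1])
    moreover have "ln (2 * D * rho k) = ln (2 * D) + ln (rho k)"
      using D_ge_1 rho_pos[of k] by (subst ln_mult) auto
    ultimately show "Z \<le> - ln (2 * D * rho k)" using neg_ln_rho(1)[of k] by (simp add: mult.commute)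
  qed
qed

text \<open>H is ln (R / r) for R = 2 * D * \<open>rho k\<close>. From \<open>rho k\<close> down to
  r the logarithm falls by H - ln (2 * D), and each level lowers it by at least \<beta> and at most
  \<alpha>. The hypothesis \<open>big\<close> says that r is below \<open>rho k\<close>.\<close>

lemma index_gap:
  fixes \<psi> :: "real \<Rightarrow> real"
  assumes R: "2 * D * rho k < 1" and H: "H = \<psi> (2 * D * rho k) * - ln (2 * D * rho k)"
    and big: "ln (2 * D) < H"
  defines "l \<equiv> idx ((2 * D * rho k) powr (1 + \<psi> (2 * D * rho k)))"
  shows "k \<le> l" "H - ln (2 * D) \<le> \<alpha> * (real l - real k)"
    and "\<beta> * (real l - real k - 1) \<le> H"
proof -
  define r where "r = (2 * D * rho k) powr (1 + \<psi> (2 * D * rho k))"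
  have R0: "0 < 2 * D * rho k" using D_ge_1 rho_pos[of k] by simp
  have r0: "0 < r" using D_ge_1 rho_pos[of k] by (simp add: r_def)
  have lnR: "ln (2 * D * rho k) = ln (2 * D) + ln (rho k)"
    using D_ge_1 rho_pos[of k] by (subst ln_mult) auto
  have "ln r = ln (2 * D * rho k) - H"
    using R0 by (simp add: r_def H ln_powr algebra_simps)
  then have lnr: "ln r = ln (2 * D) + ln (rho k) - H"
    using lnR by simp
  have D2: "0 \<le> ln (2 * D)" using D_ge_1 by simp
  have "ln r < ln (rho k)" using lnr big by simp
  then have "r < rho k" using r0 rho_pos[of k] by simp
  then have kl: "k < l" unfolding l_def r_def[symmetric] by (rule less_idx[OF r0])
  then show "k \<le> l" by simp
  have "rho l \<le> r" unfolding l_def r_def[symmetric] by (rule rho_idx_le[OF r0])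
  then have "ln (rho l) \<le> ln r" using r0 rho_pos[of l] by simp
  then show "H - ln (2 * D) \<le> \<alpha> * (real l - real k)"
    using ln_rho_diff_bounds(2)[of k l] kl lnr by simp
  have "r < rho (l - 1)" using kl unfolding l_def r_def[symmetric] by (intro rho_less_idx) simp
  then have "ln r < ln (rho (l - 1))" using r0 rho_pos[of "l - 1"] by simp
  moreover have "\<beta> * (real l - real k - 1) \<le> ln (rho k) - ln (rho (l - 1))"
    using ln_rho_diff_bounds(1)[of k "l - 1"] kl by (simp add: of_nat_diff algebra_simps)
  ultimately show "\<beta> * (real l - real k - 1) \<le> H"
    using lnr D2 by linarith
qed

lemma eventually_index_gap:
  fixes \<psi> :: "real \<Rightarrow> real"
  assumes lim: "filterlim (\<lambda>y. \<psi> (exp (- y)) * y) at_top at_top"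
  shows "\<forall>\<^sub>F k in sequentially. 2 * D * rho k < 1 \<and>
    ln (2 * D) < \<psi> (2 * D * rho k) * - ln (2 * D * rho k) \<and>
    k \<le> idx ((2 * D * rho k) powr (1 + \<psi> (2 * D * rho k))) \<and>
    G \<le> real (idx ((2 * D * rho k) powr (1 + \<psi> (2 * D * rho k)))) - real k"
proof -
  define h where "h = (\<lambda>y. \<psi> (exp (- y)) * y)"
  have "filterlim (\<lambda>k. h (- ln (2 * D * rho k))) at_top sequentially"
    unfolding h_def by (rule filterlim_compose[OF lim filterlim_scale])
  then have "\<forall>\<^sub>F k in sequentially. ln (2 * D) + \<alpha> * \<bar>G\<bar> + 1 \<le> h (- ln (2 * D * rho k))"
    unfolding filterlim_at_top by blast
  moreover have "\<forall>\<^sub>F k in sequentially. 1 \<le> - ln (2 * D * rho k)"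
    using filterlim_scale unfolding filterlim_at_top by blast
  ultimately show ?thesis
  proof eventually_elim
    case (elim k)
    have R0: "0 < 2 * D * rho k" using D_ge_1 rho_pos[of k] by simp
    have "ln (2 * D * rho k) < ln 1" using elim(2) by simp
    then have R1: "2 * D * rho k < 1" using R0 by (subst (asm) ln_less_cancel_iff) auto
    have aG: "0 \<le> \<alpha> * \<bar>G\<bar>" using alpha_pos by (intro mult_nonneg_nonneg) auto
    then have big: "ln (2 * D) < h (- ln (2 * D * rho k))" using elim(1) by linarith
    have hH: "h (- ln (2 * D * rho k)) = \<psi> (2 * D * rho k) * - ln (2 * D * rho k)"
      using R0 by (simp add: h_def)
    note gap = index_gap[where \<psi> = \<psi>, OF R1 hH big]
    have "\<alpha> * \<bar>G\<bar> \<le> \<alpha> * (real (idx ((2 * D * rho k) powr (1 + \<psi> (2 * D * rho k)))) - real k)"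
      using gap(2) elim(1) by linarith
    then have "\<bar>G\<bar> \<le> real (idx ((2 * D * rho k) powr (1 + \<psi> (2 * D * rho k)))) - real k"
      by (rule mult_left_le_imp_le[OF _ alpha_pos])
    then show ?case using R1 gap(1) big hH by auto
  qed
qed

text \<open>\<open>m k\<close> bounds from above the length of the block starting at level k,
  because - ln R is at most \<alpha> * (k + 1) and h is monotone. A run of that length therefore
  contains the whole block. Lowering the exponent from t to t - e gains at least e * \<beta> per
  level, which makes the sums unbounded as the blocks grow.\<close>

lemma spectrum_ge_of_runs:
  fixes \<psi> :: "real \<Rightarrow> real" and m :: "nat \<Rightarrow> nat"
  defines "h \<equiv> \<lambda>y. \<psi> (exp (- y)) * y"
  assumes \<psi>: "\<And>x. 0 < x \<Longrightarrow> x < 1 \<Longrightarrow> 0 < \<psi> x"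
    and mono: "mono_on {0<..} h" and lim: "filterlim h at_top at_top"
    and m: "\<And>k. h (\<alpha> * (real k + 1)) / \<beta> + 1 \<le> real (m k)"
    and runs: "\<exists>\<^sub>F k in sequentially. \<forall>j\<in>{k..<k + m k}. 0 \<le> log_sum t j"
  shows "ereal t \<le> generalised_assouad_spectrum \<psi> F"
proof -
  have "ereal (t - e) \<le> generalised_assouad_spectrum \<psi> F" if e: "0 < e" for e
  proof (rule spectrum_ge[OF \<psi>])
    fix B :: real
    \<comment> \<open>The number of levels after which a gain of e * \<beta> per level exceeds
      B.\<close>
    define G where "G = \<bar>B\<bar> / (e * \<beta>)"
    have e\<beta>: "0 < e * \<beta>" using e beta_pos by (rule mult_pos_pos)
    obtain k0 where k0: "\<And>k. k \<ge> k0 \<Longrightarrow> 2 * D * rho k < 1 \<and>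
      ln (2 * D) < \<psi> (2 * D * rho k) * - ln (2 * D * rho k) \<and>
      k \<le> idx ((2 * D * rho k) powr (1 + \<psi> (2 * D * rho k))) \<and>
      G \<le> real (idx ((2 * D * rho k) powr (1 + \<psi> (2 * D * rho k)))) - real k"
      using eventually_index_gap[OF lim[unfolded h_def], of G] unfolding eventually_sequentially by blast
    obtain k where k: "k \<ge> k0" "\<forall>j\<in>{k..<k + m k}. 0 \<le> log_sum t j"
      using runs unfolding frequently_sequentially by blast
    define l where "l = idx ((2 * D * rho k) powr (1 + \<psi> (2 * D * rho k)))"
    have R0: "0 < 2 * D * rho k" using D_ge_1 rho_pos[of k] by simp
    have R1: "2 * D * rho k < 1" and kl: "k \<le> l" and G: "G \<le> real l - real k"
      and big: "ln (2 * D) < h (- ln (2 * D * rho k))"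
      using k0[OF k(1)] R0 by (auto simp: l_def h_def)
    have hH: "h (- ln (2 * D * rho k)) = \<psi> (2 * D * rho k) * - ln (2 * D * rho k)"
      using R0 by (simp add: h_def)
    have "\<beta> * (real l - real k - 1) \<le> h (- ln (2 * D * rho k))"
      unfolding l_def by (rule index_gap(3)[where \<psi> = \<psi>, OF R1 hH big])
    also have "\<dots> \<le> h (\<alpha> * (real k + 1))"
    proof (rule mono_onD[OF mono])
      have "ln (2 * D * rho k) = ln (2 * D) + ln (rho k)"
        using D_ge_1 rho_pos[of k] by (subst ln_mult) auto
      moreover have "0 \<le> ln (2 * D)" using D_ge_1 by simp
      ultimately show "- ln (2 * D * rho k) \<le> \<alpha> * (real k + 1)"
        using neg_ln_rho(2)[of k] alpha_pos by (simp add: distrib_left)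
      show "- ln (2 * D * rho k) \<in> {0<..}" using R0 R1 by simp
      show "\<alpha> * (real k + 1) \<in> {0<..}" using mult_pos_pos[OF alpha_pos, of "real k + 1"] by simp
    qed
    finally have "(real l - real k - 1) * \<beta> \<le> h (\<alpha> * (real k + 1))" by (simp add: mult.commute)
    then have "real l - real k - 1 \<le> h (\<alpha> * (real k + 1)) / \<beta>"
      by (rule pos_le_divide_eq[OF beta_pos, THEN iffD2])
    then have lm: "l \<le> k + m k" using m[of k] by linarith
    have "G * (e * \<beta>) = \<bar>B\<bar>"
    proof -
      have "x / y * y = x" if "y \<noteq> 0" for x y :: real using that by simp
      then show ?thesis unfolding G_def using e\<beta> by (metis less_irrefl)
    qed
    then have "B \<le> G * (e * \<beta>)" by simp
    also have "\<dots> \<le> (real l - real k) * (e * \<beta>)" using G e\<beta> by (intro mult_right_mono) auto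
    also have "\<dots> = (\<Sum>j=k..<l. e * \<beta>)" using kl by (simp add: of_nat_diff)
    also have "\<dots> \<le> (\<Sum>j=k..<l. log_sum (t - e) j)"
    proof (rule sum_mono)
      fix j assume "j \<in> {k..<l}"
      then have "0 \<le> log_sum t j" using k(2) lm by auto
      moreover have "log_sum (t - e) j = log_sum t j + e * - ln (q j)"
        by (simp add: log_sum_def algebra_simps)
      moreover have "e * \<beta> \<le> e * - ln (q j)" using ln_q(2)[of j] e by (intro mult_left_mono) auto
      ultimately show "e * \<beta> \<le> log_sum (t - e) j" by linarith
    qed
    finally show "\<exists>k. 2 * D * rho k < 1 \<and> k \<le> idx ((2 * D * rho k) powr (1 + \<psi> (2 * D * rho k))) \<and>
        B \<le> (\<Sum>j=k..<idx ((2 * D * rho k) powr (1 + \<psi> (2 * D * rho k))). log_sum (t - e) j)"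
      using R1 kl unfolding l_def by blast
  qed
  then have "ereal t \<le> generalised_assouad_spectrum \<psi> F + ereal e" if "0 < e" for e
    using that by (cases "generalised_assouad_spectrum \<psi> F") force+
  then show ?thesis by (rule ereal_le_epsilon2)
qed

text \<open>\<nu> / - \<kappa> is the zero of s \<mapsto> \<nu> + s * \<kappa>, the mean of the
  logarithmic ratio sums. Above it the drift of late blocks is negative, below it positive.
  \<open>m k\<close> is a lower bound for block lengths valid in both estimates: the shift \<beta>
  accounts for R lying between two levels and ln (2 * D) for the radius 2 * D *
  \<open>rho k\<close>, while the subtracted 1 and ln (2 * D) / \<alpha> are the corresponding
  losses at the far end.\<close>

lemma spectrum_eq_of_averages:
  fixes \<psi> :: "real \<Rightarrow> real" and m :: "nat \<Rightarrow> nat"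
  defines "h \<equiv> \<lambda>y. \<psi> (exp (- y)) * y"
  assumes \<psi>: "\<And>x. 0 < x \<Longrightarrow> x < 1 \<Longrightarrow> 0 < \<psi> x"
    and mono: "mono_on {0<..} h" and lim: "filterlim h at_top at_top"
    and m: "\<And>k. real (m k) \<le> max 0 (h (\<beta> * real k - (\<beta> + ln (2 * D))) / \<alpha> - (1 + ln (2 * D) / \<alpha>))"
    and \<kappa>: "\<kappa> < 0"
    and av_N: "\<And>\<epsilon>. 0 < \<epsilon> \<Longrightarrow> \<forall>\<^sub>F k in sequentially. \<forall>l\<ge>k + m k.
      \<bar>\<Sum>j=k..<l. ln (real (N (\<omega> j))) - \<nu>\<bar> \<le> \<epsilon> * real (l - k)"
    and av_q: "\<And>\<epsilon>. 0 < \<epsilon> \<Longrightarrow> \<forall>\<^sub>F k in sequentially. \<forall>l\<ge>k + m k.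
      \<bar>\<Sum>j=k..<l. ln (q j) - \<kappa>\<bar> \<le> \<epsilon> * real (l - k)"
  shows "generalised_assouad_spectrum \<psi> F = ereal (\<nu> / - \<kappa>)"
    and "has_box_dimension F (ereal (\<nu> / - \<kappa>))"
proof -
  define d where "d = \<nu> / - \<kappa>"
  have d: "\<nu> + d * \<kappa> = 0" using \<kappa> by (simp add: d_def)
  have av: "\<forall>\<^sub>F k in sequentially. \<forall>l\<ge>k + m k.
      \<bar>(\<Sum>j=k..<l. log_sum s j) - real (l - k) * (\<nu> + s * \<kappa>)\<bar> \<le> \<epsilon> * real (l - k)"
    if \<epsilon>: "0 < \<epsilon>" for s \<epsilon>
  proof -
    define \<delta>' where "\<delta>' = \<epsilon> / (1 + \<bar>s\<bar>)"
    have \<delta>': "0 < \<delta>'" "\<delta>' * (1 + \<bar>s\<bar>) = \<epsilon>" using \<epsilon> by (auto simp: \<delta>'_def add_pos_nonneg)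
    show ?thesis using av_N[OF \<delta>'(1)] av_q[OF \<delta>'(1)]
    proof eventually_elim
      case (elim k)
      show ?case
      proof (intro allI impI)
        fix l assume l: "l \<ge> k + m k"
        have "(\<Sum>j=k..<l. log_sum s j) - real (l - k) * (\<nu> + s * \<kappa>)
            = (\<Sum>j=k..<l. ln (real (N (\<omega> j))) - \<nu>) + s * (\<Sum>j=k..<l. ln (q j) - \<kappa>)"
          by (simp add: log_sum_def sum.distrib sum_subtractf sum_distrib_left algebra_simps)
        also have "\<bar>\<dots>\<bar> \<le> \<bar>\<Sum>j=k..<l. ln (real (N (\<omega> j))) - \<nu>\<bar> + \<bar>s\<bar> * \<bar>\<Sum>j=k..<l. ln (q j) - \<kappa>\<bar>"
          by (metis abs_mult abs_triangle_ineq)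
        also have "\<dots> \<le> \<delta>' * real (l - k) + \<bar>s\<bar> * (\<delta>' * real (l - k))"
          using elim l by (intro add_mono mult_left_mono) auto
        also have "\<dots> = \<delta>' * (1 + \<bar>s\<bar>) * real (l - k)" by (simp add: algebra_simps)
        finally show "\<bar>(\<Sum>j=k..<l. log_sum s j) - real (l - k) * (\<nu> + s * \<kappa>)\<bar> \<le> \<epsilon> * real (l - k)"
          unfolding \<delta>'(2) .
      qed
    qed
  qed
  have D2: "0 \<le> ln (2 * D)" using D_ge_1 by simp
  have m_le: "m k \<le> l - k" if "k \<le> l" "h (\<beta> * real k - (\<beta> + ln (2 * D))) / \<alpha> - (1 + ln (2 * D) / \<alpha>) \<le> real l - real k" for k l
  proof -
    have "real (m k) \<le> real l - real k"
      by (rule order_trans[OF m max.boundedI]) (use that in auto)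
    then have "m k + k \<le> l" by linarith
    then show ?thesis by simp
  qed
  obtain k1 :: nat where k1: "(\<beta> + ln (2 * D)) / \<beta> < real k1" using reals_Archimedean2 by blast
  have k1: "\<beta> + ln (2 * D) < \<beta> * real k" if "k1 \<le> k" for k
  proof -
    have "\<beta> + ln (2 * D) < real k1 * \<beta>" using k1 by (rule pos_divide_less_eq[OF beta_pos, THEN iffD1])
    also have "\<dots> \<le> real k * \<beta>" using that beta_pos by (intro mult_right_mono) auto
    finally show ?thesis by (simp add: mult.commute)
  qed
  have up: "generalised_assouad_spectrum \<psi> F \<le> ereal (d + e)" if e: "0 < e" for e
  proof -
    have neg: "\<nu> + (d + e) * \<kappa> < 0" using d e \<kappa> mult_pos_neg[OF e \<kappa>] by (simp add: distrib_right)
    \<comment> \<open>The tolerance is the size of the drift itself, so late block sums are at most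
      0.\<close>
    obtain k0 where k0: "\<And>k l. k \<ge> k0 \<Longrightarrow> l \<ge> k + m k \<Longrightarrow>
        \<bar>(\<Sum>j=k..<l. log_sum (d + e) j) - real (l - k) * (\<nu> + (d + e) * \<kappa>)\<bar>
          \<le> - (\<nu> + (d + e) * \<kappa>) * real (l - k)"
      using av[of "- (\<nu> + (d + e) * \<kappa>)" "d + e"] neg unfolding eventually_sequentially by auto
    define k2 where "k2 = max k0 (max k1 2)"
    have k2: "k0 \<le> k2" "k1 \<le> k2" "2 \<le> k2" by (auto simp: k2_def)
    \<comment> \<open>The remaining radii satisfy R \<ge> \<open>rho k2\<close>. By monotonicity of
      h their r is bounded below, so all their blocks lie under the fixed level L.\<close>
    define L where "L = idx (rho k2 * exp (- h (- ln (rho k2))) / D)"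
    show ?thesis
    proof (rule spectrum_le[OF \<psi>])
      fix R :: real assume R: "0 < R" "R < 1"
      define r where "r = R powr (1 + \<psi> R)"
      define k l where "k = idx R" and "l = idx (r / D)"
      have r0: "0 < r" using R by (simp add: r_def)
      have lnr: "ln r = ln R - h (- ln R)" using R by (simp add: r_def h_def ln_powr algebra_simps)
      have hpos: "0 < h (- ln R)" using R \<psi>[OF R] by (simp add: h_def mult_pos_neg)
      have rD0: "0 < r / D" using r0 D_ge_1 by simp
      have "r / D \<le> r" using r0 D_ge_1 by (simp add: divide_le_eq)
      have "ln r \<le> ln R" using lnr hpos by simp
      then have "r \<le> R" using r0 R by simp
      have kl: "k \<le> l" unfolding k_def l_def
        using \<open>r / D \<le> r\<close> \<open>r \<le> R\<close> rD0 by (intro idx_antimono) auto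
      have k0': "0 < k" unfolding k_def by (rule idx_pos[OF R])
      have "(\<Sum>j=k..<l. log_sum (d + e) j) \<le> (\<Sum>j<L. \<bar>log_sum (d + e) j\<bar>)"
      proof (cases "k2 \<le> k")
        case True
        have "R < rho (k - 1)" using k0' unfolding k_def by (intro rho_less_idx) simp
        then have "ln R < ln (rho (k - 1))" using R rho_pos[of "k - 1"] by simp
        then have "\<beta> * real (k - 1) \<le> - ln R" using neg_ln_rho(1)[of "k - 1"] by linarith
        then have Y: "\<beta> * real k - (\<beta> + ln (2 * D)) \<le> - ln R"
          using k0' D2 by (simp add: of_nat_diff right_diff_distrib)
        have "h (\<beta> * real k - (\<beta> + ln (2 * D))) \<le> h (- ln R)"
          using Y k1[of k] True k2 R by (intro mono_onD[OF mono]) auto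
        moreover have "h (- ln R) - \<alpha> \<le> \<alpha> * (real l - real k)"
        proof -
          have "a * R < rho k" unfolding k_def by (rule rho_idx_ge[OF R])
          then have "ln (a * R) < ln (rho k)" using a_pos R rho_pos[of k] by (subst ln_less_cancel_iff) auto
          moreover have "ln (a * R) = ln a + ln R" using a_pos R by (simp add: ln_mult)
          moreover have "rho l \<le> r" using rho_idx_le[OF rD0] \<open>r / D \<le> r\<close> unfolding l_def by simp
          then have "ln (rho l) \<le> ln r" using r0 rho_pos[of l] by simp
          ultimately show ?thesis using lnr ln_rho_diff_bounds(2)[OF kl] by linarith
        qed
        ultimately have "h (\<beta> * real k - (\<beta> + ln (2 * D))) \<le> (real l - real k + 1) * \<alpha>"
          by (simp add: algebra_simps)
        then have "h (\<beta> * real k - (\<beta> + ln (2 * D))) / \<alpha> \<le> real l - real k + 1"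
          by (rule pos_divide_le_eq[OF alpha_pos, THEN iffD2])
        moreover have "0 \<le> ln (2 * D) / \<alpha>" using D2 alpha_pos by (intro divide_nonneg_pos)
        ultimately have "m k \<le> l - k" by (intro m_le kl) linarith
        then have "\<bar>(\<Sum>j=k..<l. log_sum (d + e) j) - real (l - k) * (\<nu> + (d + e) * \<kappa>)\<bar>
            \<le> - (\<nu> + (d + e) * \<kappa>) * real (l - k)"
          using kl True k2 by (intro k0) auto
        then have "(\<Sum>j=k..<l. log_sum (d + e) j) \<le> 0" by (simp add: abs_le_iff algebra_simps)
        also have "0 \<le> (\<Sum>j<L. \<bar>log_sum (d + e) j\<bar>)" by (simp add: sum_nonneg)
        finally show ?thesis .
      next
        case False
        have "rho k2 \<le> rho k" using False by (intro rho_antimono) simp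
        also have "\<dots> \<le> R" unfolding k_def by (rule rho_idx_le[OF R(1)])
        finally have R2: "rho k2 \<le> R" .
        then have lnR: "ln (rho k2) \<le> ln R" using rho_pos[of k2] R by simp
        have "h (- ln R) \<le> h (- ln (rho k2))"
          using lnR R by (intro mono_onD[OF mono]) (auto intro: order.strict_trans1[of _ "ln R"])
        then have "ln (rho k2) - h (- ln (rho k2)) \<le> ln r" using lnr lnR by linarith
        then have "exp (ln (rho k2) - h (- ln (rho k2))) \<le> r" using r0 by (simp add: ln_ge_iff)
        moreover have "exp (ln (rho k2) - h (- ln (rho k2))) = rho k2 * exp (- h (- ln (rho k2)))"
          using rho_pos[of k2] by (simp add: exp_diff exp_minus field_simps)
        ultimately have "rho k2 * exp (- h (- ln (rho k2))) / D \<le> r / D"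
          using D_ge_1 by (intro divide_right_mono) auto
        then have "l \<le> L" unfolding l_def L_def
          using rho_pos[of k2] D_ge_1 by (intro idx_antimono) auto
        have "(\<Sum>j=k..<l. log_sum (d + e) j) \<le> (\<Sum>j=k..<l. \<bar>log_sum (d + e) j\<bar>)" by (intro sum_mono) simp
        also have "\<dots> \<le> (\<Sum>j<L. \<bar>log_sum (d + e) j\<bar>)" using \<open>l \<le> L\<close> by (intro sum_mono2) auto
        finally show ?thesis .
      qed
      then show "(\<Sum>j=idx R..<idx (R powr (1 + \<psi> R) / D). log_sum (d + e) j) \<le> (\<Sum>j<L. \<bar>log_sum (d + e) j\<bar>)"
        unfolding k_def l_def r_def .
    qed
  qed
  have lo: "ereal (d - e) \<le> generalised_assouad_spectrum \<psi> F" if e: "0 < e" for e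
  proof (rule spectrum_ge[OF \<psi>])
    fix B :: real
    \<comment> \<open>The positive drift at d - e. Averages accurate to \<eta> / 2 still leave sums
      of at least \<eta> / 2 per level.\<close>
    define \<eta> where "\<eta> = \<nu> + (d - e) * \<kappa>"
    have \<eta>: "0 < \<eta>" using d e \<kappa> mult_pos_neg[OF e \<kappa>] by (simp add: \<eta>_def left_diff_distrib)
    have ev1: "\<forall>\<^sub>F k in sequentially. \<forall>l\<ge>k + m k.
      \<bar>(\<Sum>j=k..<l. log_sum (d - e) j) - real (l - k) * \<eta>\<bar> \<le> \<eta> / 2 * real (l - k)"
      unfolding \<eta>_def by (rule av) (use \<eta> in \<open>simp add: \<eta>_def\<close>)
    have "\<forall>\<^sub>F k in sequentially. 2 * D * rho k < 1 \<and> k \<le> idx ((2 * D * rho k) powr (1 + \<psi> (2 * D * rho k))) \<and>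
        B \<le> (\<Sum>j=k..<idx ((2 * D * rho k) powr (1 + \<psi> (2 * D * rho k))). log_sum (d - e) j)"
      using ev1 eventually_index_gap[OF lim[unfolded h_def], of "2 * \<bar>B\<bar> / \<eta>"] eventually_ge_at_top[of k1]
    proof eventually_elim
      case (elim k)
      define l where "l = idx ((2 * D * rho k) powr (1 + \<psi> (2 * D * rho k)))"
      have R0: "0 < 2 * D * rho k" using D_ge_1 rho_pos[of k] by simp
      have R1: "2 * D * rho k < 1" and kl: "k \<le> l" and G: "2 * \<bar>B\<bar> / \<eta> \<le> real l - real k"
        and big: "ln (2 * D) < h (- ln (2 * D * rho k))"
        using elim(2) R0 by (auto simp: l_def h_def)
      have hH: "h (- ln (2 * D * rho k)) = \<psi> (2 * D * rho k) * - ln (2 * D * rho k)"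
        using R0 by (simp add: h_def)
      have gap: "h (- ln (2 * D * rho k)) - ln (2 * D) \<le> \<alpha> * (real l - real k)"
        unfolding l_def by (rule index_gap(2)[where \<psi> = \<psi>, OF R1 hH big])
      have "ln (2 * D * rho k) = ln (2 * D) + ln (rho k)"
        using D_ge_1 rho_pos[of k] by (subst ln_mult) auto
      then have "\<beta> * real k - (\<beta> + ln (2 * D)) \<le> - ln (2 * D * rho k)"
        using neg_ln_rho(1)[of k] beta_pos by linarith
      then have hY: "h (\<beta> * real k - (\<beta> + ln (2 * D))) \<le> h (- ln (2 * D * rho k))"
        using k1[OF elim(3)] R0 R1 by (intro mono_onD[OF mono]) auto
      have "h (\<beta> * real k - (\<beta> + ln (2 * D))) \<le> (real l - real k + ln (2 * D) / \<alpha>) * \<alpha>"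
      proof -
        have "(x + y / z) * z = z * x + y" if "z \<noteq> 0" for x y z :: real
          using that by (simp add: distrib_right)
        from this[of \<alpha> "real l - real k" "ln (2 * D)"] show ?thesis using gap alpha_pos hY by linarith
      qed
      then have "h (\<beta> * real k - (\<beta> + ln (2 * D))) / \<alpha> \<le> real l - real k + ln (2 * D) / \<alpha>"
        by (rule pos_divide_le_eq[OF alpha_pos, THEN iffD2])
      then have "m k \<le> l - k" by (intro m_le kl) linarith
      then have "\<bar>(\<Sum>j=k..<l. log_sum (d - e) j) - real (l - k) * \<eta>\<bar> \<le> \<eta> / 2 * real (l - k)"
        using elim(1) kl by auto
      then have "\<eta> / 2 * real (l - k) \<le> (\<Sum>j=k..<l. log_sum (d - e) j)"
        by (simp only: abs_le_iff) (simp add: algebra_simps)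
      moreover have "\<bar>B\<bar> \<le> \<eta> / 2 * real (l - k)" using G \<eta> kl by (simp add: of_nat_diff field_simps)
      ultimately have "B \<le> (\<Sum>j=k..<l. log_sum (d - e) j)" by linarith
      then show ?case using R1 kl unfolding l_def by blast
    qed
    then show "\<exists>k. 2 * D * rho k < 1 \<and> k \<le> idx ((2 * D * rho k) powr (1 + \<psi> (2 * D * rho k))) \<and>
        B \<le> (\<Sum>j=k..<idx ((2 * D * rho k) powr (1 + \<psi> (2 * D * rho k))). log_sum (d - e) j)"
      unfolding eventually_sequentially by blast
  qed
  show "generalised_assouad_spectrum \<psi> F = ereal (\<nu> / - \<kappa>)"
    unfolding d_def[symmetric]
  proof (rule antisym)
    show "generalised_assouad_spectrum \<psi> F \<le> ereal d"
      by (rule ereal_le_epsilon2) (use up in auto)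
    have "ereal d \<le> generalised_assouad_spectrum \<psi> F + ereal e" if "0 < e" for e
      using lo[OF that] by (cases "generalised_assouad_spectrum \<psi> F") force+
    then show "ereal d \<le> generalised_assouad_spectrum \<psi> F" by (rule ereal_le_epsilon2)
  qed
  show "has_box_dimension F (ereal (\<nu> / - \<kappa>))"
    unfolding d_def[symmetric]
  proof (rule box_dimension_eq, rule LIMSEQ_I)
    fix \<epsilon> :: real assume \<epsilon>: "0 < \<epsilon>"
    \<comment> \<open>A single start k suffices, since the estimate holds for all long blocks from k
      at once; the first k terms vanish in the average.\<close>
    obtain k where k: "\<And>l. l \<ge> k + m k \<Longrightarrow> \<bar>\<Sum>j=k..<l. log_sum d j\<bar> \<le> \<epsilon> / 2 * real (l - k)"
      using av[of "\<epsilon> / 2" d] \<epsilon> d unfolding eventually_sequentially by auto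
    define S where "S = \<bar>\<Sum>j<k. log_sum d j\<bar>"
    obtain l0 :: nat where l0: "2 * S / \<epsilon> < real l0" using reals_Archimedean2 by blast
    show "\<exists>no. \<forall>l\<ge>no. norm ((\<Sum>j<l. log_sum d j) / real l - 0) < \<epsilon>"
    proof (intro exI allI impI)
      fix l assume l: "max (k + m k) (max l0 1) \<le> l"
      have "(\<Sum>j<l. log_sum d j) = (\<Sum>j<k. log_sum d j) + (\<Sum>j=k..<l. log_sum d j)"
        using sum.atLeastLessThan_concat[of 0 k l "log_sum d"] l by (simp add: lessThan_atLeast0)
      then have "\<bar>\<Sum>j<l. log_sum d j\<bar> \<le> S + \<epsilon> / 2 * real (l - k)"
        using k[of l] l unfolding S_def by simp
      also have "\<dots> \<le> S + \<epsilon> / 2 * real l" using \<epsilon> by simp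
      also have "S < \<epsilon> / 2 * real l"
      proof -
        have "2 * S / \<epsilon> < real l" using l0 l by simp
        then show ?thesis using \<epsilon> by (simp add: field_simps)
      qed
      finally have "\<bar>\<Sum>j<l. log_sum d j\<bar> < \<epsilon> * real l" by simp
      then show "norm ((\<Sum>j<l. log_sum d j) / real l - 0) < \<epsilon>"
        using l by (simp add: abs_div divide_less_eq)
    qed
  qed
qed

end

section \<open>Dimension functions on a logarithmic scale\<close>

text \<open>For a monotone function, summability along an arithmetic progression does not depend on
  the step: each sample of one progression dominates boundedly many of the other. This makes the
  distinction between \<alpha>, \<beta> and 1 in the argument harmless.\<close>

lemma summable_rescale_antimono:
  fixes g :: "real \<Rightarrow> real"
  assumes g: "antimono_on {0<..} g" "\<And>x. 0 < x \<Longrightarrow> 0 \<le> g x"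
    and pos: "0 < \<alpha>" "0 < \<gamma>" and sum: "summable (\<lambda>k. g (\<alpha> * (real k + 1)))"
  shows "summable (\<lambda>k. g (\<gamma> * (real k + 1)))"
proof -
  \<comment> \<open>q samples with step \<gamma> advance beyond one step \<alpha>, so each value
    \<open>w i\<close> has to serve q times.\<close>
  obtain q :: nat where "\<alpha> / \<gamma> < real q" using reals_Archimedean2 by blast
  then have q: "\<alpha> < real q * \<gamma>" using pos by (simp add: pos_divide_less_eq)
  have q0: "0 < q" using q pos by (cases q) auto
  define w where "w i = g (\<alpha> * (real i + 1))" for i
  have w0: "0 \<le> w i" for i using pos unfolding w_def by (intro g(2) mult_pos_pos) auto
  have sum_div: "summable (\<lambda>n. w (n div q))"
  proof (rule summableI_nonneg_bounded)
    fix n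
    have "n \<le> n * q" using q0 by simp
    then have "(\<Sum>k<n. w (k div q)) \<le> (\<Sum>k<n * q. w (k div q))"
      using w0 by (intro sum_mono2) auto
    also have "\<dots> = (\<Sum>i<n. \<Sum>k=i * q..<i * q + q. w (k div q))"
      by (rule sum.nat_group[symmetric])
    also have "\<dots> = (\<Sum>i<n. real q * w i)"
    proof (rule sum.cong[OF refl])
      fix i
      have "(\<Sum>k=i * q..<i * q + q. w (k div q)) = (\<Sum>k=i * q..<i * q + q. w i)"
      proof (rule sum.cong[OF refl])
        fix k assume "k \<in> {i * q..<i * q + q}"
        then have "k div q = i" using q0 by (intro div_nat_eqI) (auto simp: mult.commute)
        then show "w (k div q) = w i" by simp
      qed
      then show "(\<Sum>k=i * q..<i * q + q. w (k div q)) = real q * w i" by simp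
    qed
    also have "\<dots> = real q * (\<Sum>i<n. w i)" by (simp add: sum_distrib_left)
    also have "\<dots> \<le> real q * (\<Sum>i. w i)"
      using sum w0 by (intro mult_left_mono sum_le_suminf) (auto simp: w_def)
    finally show "(\<Sum>k<n. w (k div q)) \<le> real q * (\<Sum>i. w i)" .
  qed (rule w0)
  have "summable (\<lambda>n. g (\<gamma> * (real (n + q) + 1)))"
  proof (rule summable_comparison_test'[OF sum_div, of 0])
    fix n
    have "q * (n div q) \<le> n" by simp
    then have "real q * (real (n div q) + 1) \<le> real (n + q)"
      by (simp add: distrib_left flip: of_nat_mult of_nat_add)
    then have "\<gamma> * (real q * (real (n div q) + 1)) \<le> \<gamma> * (real (n + q) + 1)"
      using pos by (intro mult_left_mono) auto
    moreover have "\<alpha> * (real (n div q) + 1) \<le> (real q * \<gamma>) * (real (n div q) + 1)"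
      using q by (intro mult_right_mono) auto
    moreover have "(real q * \<gamma>) * (real (n div q) + 1) = \<gamma> * (real q * (real (n div q) + 1))"
      by (simp only: mult_ac)
    ultimately have le: "\<alpha> * (real (n div q) + 1) \<le> \<gamma> * (real (n + q) + 1)" by linarith
    have p: "0 < \<alpha> * (real (n div q) + 1)" using pos by (intro mult_pos_pos) auto
    have "g (\<gamma> * (real (n + q) + 1)) \<le> w (n div q)"
      unfolding w_def using p le by (intro monotone_onD[OF g(1)]) auto
    moreover have "0 \<le> g (\<gamma> * (real (n + q) + 1))" using p le by (intro g(2)) linarith
    ultimately show "norm (g (\<gamma> * (real (n + q) + 1))) \<le> w (n div q)" by simp
  qed
  then show ?thesis using summable_iff_shift[of "\<lambda>k. g (\<gamma> * (real k + 1))" q] by simp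
qed

lemma filterlim_exp_uminus: "filterlim (\<lambda>y::real. exp (- y)) (at_right 0) at_top"
proof (rule tendsto_imp_filterlim_at_right)
  show "((\<lambda>y::real. exp (- y)) \<longlongrightarrow> 0) at_top"
    by (rule filterlim_compose[OF exp_at_bot filterlim_uminus_at_bot_at_top])
qed simp

text \<open>With R = exp (- y) and r the scale assigned to R by \<psi>, the expression is ln (R /
  r). The series of the theorem is that of exp (- h(k)) for the same expression h formed with
  \<phi>.\<close>

lemma log_scale_pos:
  assumes "dimension_function \<psi>" "0 < y"
  shows "0 < \<psi> (exp (- y)) * y"
proof -
  have "exp (- y) \<in> {0<..<1}" using assms(2) by simp
  then have "0 < \<psi> (exp (- y))" using assms(1) unfolding dimension_function_def by blast
  then show ?thesis using assms(2) by simp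
qed

lemma log_scale_monotone:
  assumes "dimension_function \<psi>"
  shows "mono_on {0<..} (\<lambda>y. \<psi> (exp (- y)) * y) \<or> antimono_on {0<..} (\<lambda>y. \<psi> (exp (- y)) * y)"
proof -
  have eq: "\<psi> (exp (- y)) * y = \<psi> (exp (- y)) * \<bar>ln (exp (- y))\<bar>" if "0 < y" for y :: real
    using that by simp
  have "mono_on {0<..<1} (\<lambda>x. \<psi> x * \<bar>ln x\<bar>) \<or> antimono_on {0<..<1} (\<lambda>x. \<psi> x * \<bar>ln x\<bar>)"
    using assms unfolding dimension_function_def by blast
  then show ?thesis
  proof
    assume m: "mono_on {0<..<1} (\<lambda>x. \<psi> x * \<bar>ln x\<bar>)"
    have "antimono_on {0<..} (\<lambda>y. \<psi> (exp (- y)) * y)"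
    proof (rule monotone_onI)
      fix x y :: real assume xy: "x \<in> {0<..}" "y \<in> {0<..}" "x \<le> y"
      then have "exp (- y) \<in> {0<..<1}" "exp (- x) \<in> {0<..<1}" "exp (- y) \<le> exp (- x)" by auto
      from mono_onD[OF m this] show "\<psi> (exp (- y)) * y \<le> \<psi> (exp (- x)) * x"
        using eq xy by auto
    qed
    then show ?thesis by blast
  next
    assume m: "antimono_on {0<..<1} (\<lambda>x. \<psi> x * \<bar>ln x\<bar>)"
    have "mono_on {0<..} (\<lambda>y. \<psi> (exp (- y)) * y)"
    proof (rule mono_onI)
      fix x y :: real assume xy: "x \<in> {0<..}" "y \<in> {0<..}" "x \<le> y"
      then have "exp (- y) \<in> {0<..<1}" "exp (- x) \<in> {0<..<1}" "exp (- y) \<le> exp (- x)" by auto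
      from monotone_onD[OF m this] show "\<psi> (exp (- x)) * x \<le> \<psi> (exp (- y)) * y"
        using eq xy by auto
    qed
    then show ?thesis by blast
  qed
qed

lemma log_scale_at_top:
  fixes \<psi> :: "real \<Rightarrow> real"
  assumes "filterlim (\<lambda>x. \<psi> x * \<bar>ln x\<bar>) at_top (at_right 0)"
  shows "filterlim (\<lambda>y. \<psi> (exp (- y)) * y) at_top at_top"
proof -
  have lim: "filterlim (\<lambda>y. \<psi> (exp (- y)) * \<bar>ln (exp (- y))\<bar>) at_top at_top"
    by (rule filterlim_compose[OF assms filterlim_exp_uminus])
  have ev: "\<forall>\<^sub>F y in at_top. \<psi> (exp (- y)) * \<bar>ln (exp (- y))\<bar> = \<psi> (exp (- y)) * y"
    using eventually_gt_at_top[of 0] by eventually_elim simp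
  show ?thesis using filterlim_cong[OF refl refl ev] lim by blast
qed

lemma log_scale_ratio:
  assumes "dimension_function \<phi>" "dimension_function \<psi>"
    and lim: "((\<lambda>x. \<phi> x / \<psi> x) \<longlongrightarrow> 0) (at_right 0)" and \<epsilon>: "0 < \<epsilon>"
  shows "\<forall>\<^sub>F y in at_top. \<phi> (exp (- y)) * y \<le> \<epsilon> * (\<psi> (exp (- y)) * y)"
proof -
  have "((\<lambda>y. \<phi> (exp (- y)) / \<psi> (exp (- y))) \<longlongrightarrow> 0) at_top"
    by (rule filterlim_compose[OF lim filterlim_exp_uminus])
  then have "\<forall>\<^sub>F y in at_top. \<phi> (exp (- y)) / \<psi> (exp (- y)) < \<epsilon>" using \<epsilon> by (rule order_tendstoD(2))
  then show ?thesis using eventually_gt_at_top[of 0]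
  proof eventually_elim
    case (elim y)
    have "0 < \<psi> (exp (- y))" using log_scale_pos[OF assms(2) elim(2)] elim(2) by (simp add: zero_less_mult_iff)
    then have "\<phi> (exp (- y)) \<le> \<epsilon> * \<psi> (exp (- y))" using elim(1) by (simp add: divide_less_eq)
    then show ?case using elim(2) mult_right_mono[of "\<phi> (exp (- y))" "\<epsilon> * \<psi> (exp (- y))" y] by (simp add: mult.assoc)
  qed
qed

text \<open>A dimension function may be monotone in either direction. A decreasing h would stay
  below h 1 on [1, \<infinity>), so unboundedness settles the direction.\<close>

lemma unbounded_monotone_imp_mono:
  fixes h :: "real \<Rightarrow> real"
  assumes "mono_on {0<..} h \<or> antimono_on {0<..} h" and unb: "\<And>Z. \<exists>y\<ge>1. Z < h y"
  shows "mono_on {0<..} h"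
proof (rule ccontr)
  assume "\<not> ?thesis"
  then have "antimono_on {0<..} h" using assms(1) by blast
  moreover obtain y where "y \<ge> 1" "h 1 < h y" using unb by blast
  ultimately show False using monotone_onD[of "{0<..}" "(\<le>)" "(\<ge>)" h 1 y] by force
qed

lemma at_top_imp_unbounded:
  fixes h :: "real \<Rightarrow> real"
  assumes "filterlim h at_top at_top"
  shows "\<exists>y\<ge>1. Z < h y"
proof -
  have "\<forall>\<^sub>F y in at_top. Z < h y" using assms unfolding filterlim_at_top_dense by blast
  with eventually_ge_at_top[of 1] have "\<forall>\<^sub>F y in at_top. 1 \<le> y \<and> Z < h y" by (rule eventually_conj)
  then show ?thesis using eventually_happens by force
qed

text \<open>In the convergent case the unboundedness of h is a consequence, since the terms of the
  series tend to 0.\<close>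

lemma summable_exp_imp_unbounded:
  fixes h :: "real \<Rightarrow> real"
  assumes "summable (\<lambda>k. exp (- h (real (Suc k))))"
  shows "\<exists>y\<ge>1. Z < h y"
proof -
  have "(\<lambda>k. exp (- h (real (Suc k)))) \<longlonglongrightarrow> 0" using assms by (rule summable_LIMSEQ_zero)
  then have "\<forall>\<^sub>F k in sequentially. exp (- h (real (Suc k))) < exp (- Z)"
    by (rule order_tendstoD(2)) simp
  then obtain k where "exp (- h (real (Suc k))) < exp (- Z)"
    unfolding eventually_sequentially by blast
  then have "Z < h (real (Suc k))" by simp
  then show ?thesis by (intro exI[of _ "real (Suc k)"]) simp
qed

lemma mono_unbounded_imp_at_top:
  fixes h :: "real \<Rightarrow> real"
  assumes mono: "mono_on {0<..} h" and unb: "\<And>Z. \<exists>y\<ge>1. Z < h y"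
  shows "filterlim h at_top at_top"
  unfolding filterlim_at_top
proof
  fix Z
  obtain y where y: "y \<ge> 1" "Z < h y" using unb by blast
  show "\<forall>\<^sub>F x in at_top. Z \<le> h x" using eventually_ge_at_top[of y]
  proof eventually_elim
    case (elim x)
    then have "h y \<le> h x" using y by (intro mono_onD[OF mono]) auto
    then show ?case using y by simp
  qed
qed

lemma antimono_exp_uminus:
  fixes h :: "real \<Rightarrow> real"
  assumes "mono_on A h"
  shows "antimono_on A (\<lambda>y. exp (- h y))"
proof (rule monotone_onI)
  fix x y assume "x \<in> A" "y \<in> A" "x \<le> y"
  then show "exp (- h y) \<le> exp (- h x)" using mono_onD[OF assms, of x y] by simp
qed

lemma summable_block_lengths:
  fixes h\<^sub>1 h\<^sub>2 :: "real \<Rightarrow> real"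
  assumes mono: "mono_on {0<..} h\<^sub>1" and sum: "summable (\<lambda>k. exp (- h\<^sub>1 (real (Suc k))))"
    and ratio: "\<And>\<epsilon>. 0 < \<epsilon> \<Longrightarrow> \<forall>\<^sub>F y in at_top. h\<^sub>1 y \<le> \<epsilon> * h\<^sub>2 y"
    and pos: "0 < \<alpha>" "0 < \<beta>" "0 < t"
  shows "summable (\<lambda>k. exp (- t * real (nat \<lfloor>h\<^sub>2 (\<beta> * real k - c) / \<alpha> - c'\<rfloor>)))"
proof -
  have s1: "summable (\<lambda>k. exp (- h\<^sub>1 (1 * (real k + 1))))" using sum by (simp add: add.commute)
  have "summable (\<lambda>k. exp (- h\<^sub>1 (\<beta> / 2 * (real k + 1))))"
    using summable_rescale_antimono[OF antimono_exp_uminus[OF mono] _ zero_less_one _ s1, of "\<beta> / 2"] pos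
    by simp
  then have "summable (\<lambda>k. exp (t * (c' + 1)) * exp (- h\<^sub>1 (\<beta> / 2 * (real k + 1))))"
    by (rule summable_mult)
  then show ?thesis
  proof (rule summable_comparison_test_ev[rotated])
    have lim: "filterlim (\<lambda>k. \<beta> * real k - c) at_top sequentially"
      unfolding filterlim_at_top eventually_sequentially
    proof (intro allI exI impI)
      fix Z k assume "nat \<lceil>(Z + c) / \<beta>\<rceil> \<le> k"
      then have "(Z + c) / \<beta> \<le> real k" by linarith
      then show "Z \<le> \<beta> * real k - c" using pos by (simp add: pos_divide_le_eq mult.commute)
    qed
    \<comment> \<open>Giving up half of the slope absorbs the shift c.\<close>
    have ev2: "\<forall>\<^sub>F k in sequentially. \<beta> / 2 * (real k + 1) \<le> \<beta> * real k - c"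
      unfolding eventually_sequentially
    proof (intro exI allI impI)
      fix k assume "nat \<lceil>(2 * c + \<beta>) / \<beta>\<rceil> \<le> k"
      then have "(2 * c + \<beta>) / \<beta> \<le> real k" by linarith
      then have "2 * c + \<beta> \<le> real k * \<beta>" using pos by (simp add: pos_divide_le_eq)
      then show "\<beta> / 2 * (real k + 1) \<le> \<beta> * real k - c" by (simp add: field_simps)
    qed
    have "\<forall>\<^sub>F y in at_top. h\<^sub>1 y \<le> t / \<alpha> * h\<^sub>2 y" using pos by (intro ratio) simp
    then have "\<forall>\<^sub>F k in sequentially. h\<^sub>1 (\<beta> * real k - c) \<le> t / \<alpha> * h\<^sub>2 (\<beta> * real k - c)"
      by (rule eventually_compose_filterlim[OF _ lim])
    then show "\<forall>\<^sub>F k in sequentially. norm (exp (- t * real (nat \<lfloor>h\<^sub>2 (\<beta> * real k - c) / \<alpha> - c'\<rfloor>)))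
        \<le> exp (t * (c' + 1)) * exp (- h\<^sub>1 (\<beta> / 2 * (real k + 1)))"
      using ev2
    proof eventually_elim
      case (elim k)
      define x where "x = h\<^sub>2 (\<beta> * real k - c) / \<alpha> - c'"
      have "0 < \<beta> / 2 * (real k + 1)" using pos by simp
      then have "h\<^sub>1 (\<beta> / 2 * (real k + 1)) \<le> h\<^sub>1 (\<beta> * real k - c)"
        using elim(2) by (intro mono_onD[OF mono]) auto
      also have "\<dots> \<le> t * (x + c')" using elim(1) by (simp add: x_def)
      also have "\<dots> \<le> t * (real (nat \<lfloor>x\<rfloor>) + 1 + c')"
      proof (rule mult_left_mono)
        show "x + c' \<le> real (nat \<lfloor>x\<rfloor>) + 1 + c'" by linarith
      qed (use pos in simp)
      finally have "- t * real (nat \<lfloor>x\<rfloor>) \<le> t * (c' + 1) - h\<^sub>1 (\<beta> / 2 * (real k + 1))"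
        by (simp add: algebra_simps)
      then show ?case unfolding x_def[symmetric] by (simp flip: exp_add)
    qed
  qed
qed

text \<open>A run over x levels costs the factor q to the power x. The hypothesis
  \<open>ratio\<close> keeps this cost, in the exponent, below the function whose series diverges;
  rounding and rescaling cost no more than constants.\<close>

lemma not_summable_run_lengths:
  fixes h\<^sub>1 h\<^sub>2 :: "real \<Rightarrow> real"
  assumes mono: "mono_on {0<..} h\<^sub>1" and sum: "\<not> summable (\<lambda>k. exp (- h\<^sub>1 (real (Suc k))))"
    and ratio: "\<forall>\<^sub>F y in at_top. - ln q * h\<^sub>2 y / \<beta> \<le> h\<^sub>1 y"
    and pos: "0 < \<alpha>" "0 < \<beta>" "0 < q" "q < 1" and h2: "\<And>y. 0 < y \<Longrightarrow> 0 \<le> h\<^sub>2 y"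
  shows "\<not> summable (\<lambda>k. q ^ (nat \<lceil>h\<^sub>2 (\<alpha> * (real k + 1)) / \<beta>\<rceil> + 1))"
proof
  assume S: "summable (\<lambda>k. q ^ (nat \<lceil>h\<^sub>2 (\<alpha> * (real k + 1)) / \<beta>\<rceil> + 1))"
  have s1: "summable (\<lambda>k. exp (- h\<^sub>1 (\<alpha> * (real k + 1))))"
  proof (rule summable_comparison_test_ev)
    show "summable (\<lambda>k. 1 / q ^ 2 * q ^ (nat \<lceil>h\<^sub>2 (\<alpha> * (real k + 1)) / \<beta>\<rceil> + 1))"
      using S by (rule summable_mult)
    have "filterlim (\<lambda>k. \<alpha> * (real k + 1)) at_top sequentially"
      unfolding filterlim_at_top eventually_sequentially
    proof (intro allI exI impI)
      fix Z k assume "nat \<lceil>Z / \<alpha>\<rceil> \<le> k"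
      then have "Z / \<alpha> \<le> real k + 1" by linarith
      then show "Z \<le> \<alpha> * (real k + 1)" using pos by (simp add: pos_divide_le_eq mult.commute)
    qed
    from eventually_compose_filterlim[OF ratio this]
    show "\<forall>\<^sub>F k in sequentially. norm (exp (- h\<^sub>1 (\<alpha> * (real k + 1))))
        \<le> 1 / q ^ 2 * q ^ (nat \<lceil>h\<^sub>2 (\<alpha> * (real k + 1)) / \<beta>\<rceil> + 1)"
    proof eventually_elim
      case (elim k)
      define x where "x = h\<^sub>2 (\<alpha> * (real k + 1)) / \<beta>"
      define M where "M = nat \<lceil>x\<rceil>"
      have "0 \<le> x" using pos unfolding x_def by (intro divide_nonneg_pos h2 mult_pos_pos) auto
      then have M: "real M \<le> x + 1" unfolding M_def by linarith
      have lnq: "ln q < 0" using pos by simp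
      have "ln q * x \<le> ln q * (real M - 1)" using M lnq by (intro mult_left_mono_neg) auto
      moreover have "- ln q * x \<le> h\<^sub>1 (\<alpha> * (real k + 1))" using elim by (simp add: x_def)
      ultimately have "exp (- h\<^sub>1 (\<alpha> * (real k + 1))) \<le> exp (ln q * (real M - 1))" by simp
      also have "\<dots> = exp (real M * ln q) / exp (ln q)" by (simp add: exp_diff[symmetric] algebra_simps)
      also have "\<dots> = q ^ M / q" using pos by (simp add: exp_of_nat_mult)
      \<comment> \<open>One factor q is lost to the ceiling, the other to the summand 1 in the run
        length.\<close>
      also have "\<dots> = 1 / q ^ 2 * q ^ (M + 1)" using pos by (simp add: power2_eq_square field_simps)
      finally show ?case by (simp add: M_def x_def)
    qed
  qed
  have "summable (\<lambda>k. exp (- h\<^sub>1 (1 * (real k + 1))))"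
    using summable_rescale_antimono[OF antimono_exp_uminus[OF mono] _ pos(1) _ s1, of 1] by simp
  then show False using sum by (simp add: add.commute)
qed

section \<open>Block averages and runs of independent labels\<close>

lemma indep_vars_coordinates:
  assumes "prob_space \<mu>"
  shows "prob_space.indep_vars (label_sequences \<mu>) (\<lambda>_. \<mu>) (\<lambda>j \<omega>. \<omega> j) UNIV"
proof -
  interpret \<mu>: prob_space \<mu> by fact
  interpret P: product_prob_space "\<lambda>_. \<mu>" "UNIV :: nat set" ..
  have "distr (label_sequences \<mu>) (label_sequences \<mu>) (\<lambda>\<omega>. \<lambda>j\<in>UNIV. \<omega> j) = label_sequences \<mu>"
    by (simp add: restrict_def distr_id2)
  moreover have "distr (label_sequences \<mu>) \<mu> (\<lambda>\<omega>. \<omega> j) = \<mu>" for j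
    using P.PiM_component[of j] by simp
  ultimately show ?thesis
    by (subst P.indep_vars_iff_distr_eq_PiM') (auto intro: measurable_component_singleton)
qed

lemma Hoeffding_coordinates:
  fixes g :: "'a \<Rightarrow> real" and \<epsilon> :: real
  assumes \<mu>: "prob_space \<mu>" and g: "g \<in> borel_measurable \<mu>"
    and bound: "\<And>x. x \<in> space \<mu> \<Longrightarrow> \<bar>g x\<bar> \<le> B" and B: "0 < B" and \<epsilon>: "0 < \<epsilon>" and "finite I" "I \<noteq> {}"
  shows "measure (label_sequences \<mu>)
      {\<omega> \<in> space (label_sequences \<mu>). \<epsilon> * card I \<le> \<bar>(\<Sum>j\<in>I. g (\<omega> j) - integral\<^sup>L \<mu> g)\<bar>}
    \<le> 2 * exp (- (\<epsilon>\<^sup>2 / (2 * B\<^sup>2)) * card I)"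
proof -
  interpret \<mu>: prob_space \<mu> by fact
  interpret P: product_prob_space "\<lambda>_. \<mu>" "UNIV :: nat set" ..
  have distr: "distr (label_sequences \<mu>) \<mu> (\<lambda>\<omega>. \<omega> j) = \<mu>" for j
    using P.PiM_component[of j] by simp
  have meas: "(\<lambda>\<omega>. \<omega> j) \<in> measurable (label_sequences \<mu>) \<mu>" for j
    by (rule measurable_component_singleton) simp
  have g': "(\<lambda>\<omega>. g (\<omega> j)) \<in> borel_measurable (label_sequences \<mu>)" for j
    using measurable_compose[OF meas g] .
  have distr': "distr (label_sequences \<mu>) borel (\<lambda>\<omega>. g (\<omega> j)) = distr \<mu> borel g" for j
  proof -
    have "distr (distr (label_sequences \<mu>) \<mu> (\<lambda>\<omega>. \<omega> j)) borel g = distr (label_sequences \<mu>) borel (g \<circ> (\<lambda>\<omega>. \<omega> j))"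
      by (rule distr_distr[OF g meas])
    then show ?thesis by (simp add: distr comp_def)
  qed
  have space: "\<omega> j \<in> space \<mu>" if "\<omega> \<in> space (label_sequences \<mu>)" for \<omega> j
    using that by (auto simp: space_PiM)
  interpret H: Hoeffding_ineq_iid "label_sequences \<mu>" I "\<lambda>j \<omega>. g (\<omega> j)" "\<lambda>\<omega>. g (\<omega> 0)" "- B" B
    "P.expectation (\<lambda>\<omega>. g (\<omega> 0))"
  proof unfold_locales
    have "P.indep_vars (\<lambda>_. \<mu>) (\<lambda>j \<omega>. \<omega> j) I"
      using indep_vars_coordinates[OF \<mu>] by (rule P.indep_vars_subset) simp
    then show "P.indep_vars (\<lambda>_. borel) (\<lambda>j \<omega>. g (\<omega> j)) I"
      using g by (rule P.indep_vars_compose2)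
    show "AE \<omega> in label_sequences \<mu>. g (\<omega> 0) \<in> {- B..B}"
    proof (rule AE_I2)
      fix \<omega> assume "\<omega> \<in> space (label_sequences \<mu>)"
      then have "\<bar>g (\<omega> 0)\<bar> \<le> B" by (intro bound space)
      then show "g (\<omega> 0) \<in> {- B..B}" by auto
    qed
  qed (use g' distr' \<open>finite I\<close> in auto)
  have E: "P.expectation (\<lambda>\<omega>. g (\<omega> 0)) = integral\<^sup>L \<mu> g"
    using integral_distr[OF meas g, of 0] by (simp add: distr)
  have card: "0 < card I" using assms by (simp add: card_gt_0_iff)
  have eq: "\<bar>(\<Sum>j\<in>I. g (\<omega> j) - integral\<^sup>L \<mu> g)\<bar> = \<bar>(\<Sum>j\<in>I. g (\<omega> j)) - card I * integral\<^sup>L \<mu> g\<bar>" for \<omega>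
    by (simp add: sum_subtractf)
  have "- 2 * (\<epsilon> * card I)\<^sup>2 / (card I * (B - - B)\<^sup>2) = - (\<epsilon>\<^sup>2 / (2 * B\<^sup>2)) * card I"
    using card B by (simp add: field_simps power2_eq_square)
  then show ?thesis
    using H.Hoeffding_ineq_abs_ge[of "\<epsilon> * card I"] card B \<epsilon> \<open>I \<noteq> {}\<close>
    by (simp add: E eq)
qed

text \<open>A uniform strong law for blocks: with \<open>m = id\<close> it contains the ordinary one.\<close>

lemma AE_block_averages:
  fixes g :: "'a \<Rightarrow> real" and m :: "nat \<Rightarrow> nat"
  assumes \<mu>: "prob_space \<mu>" and g: "g \<in> borel_measurable \<mu>"
    and bound: "\<And>x. x \<in> space \<mu> \<Longrightarrow> \<bar>g x\<bar> \<le> B"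
    and m: "\<And>t::real. 0 < t \<Longrightarrow> summable (\<lambda>k. exp (- t * m k))"
  shows "AE \<omega> in label_sequences \<mu>. \<forall>\<epsilon>>0. \<forall>\<^sub>F k in sequentially. \<forall>l\<ge>k + m k.
    \<bar>\<Sum>j=k..<l. g (\<omega> j) - integral\<^sup>L \<mu> g\<bar> \<le> (\<epsilon>::real) * (l - k)"
proof -
  interpret \<mu>: prob_space \<mu> by fact
  interpret P: product_prob_space "\<lambda>_. \<mu>" "UNIV :: nat set" ..
  let ?S = "\<lambda>\<omega> k l. \<bar>\<Sum>j=k..<l. g (\<omega> j) - integral\<^sup>L \<mu> g\<bar>"
  \<comment> \<open>A strictly positive bound, as the Hoeffding estimate divides by it.\<close>
  define B' where "B' = \<bar>B\<bar> + 1"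
  have B': "0 < B'" "\<And>x. x \<in> space \<mu> \<Longrightarrow> \<bar>g x\<bar> \<le> B'" using bound by (force simp: B'_def)+
  have "(\<lambda>\<omega>. \<omega> j) \<in> measurable (label_sequences \<mu>) \<mu>" for j
    by (rule measurable_component_singleton) simp
  then have g' [measurable]: "(\<lambda>\<omega>. g (\<omega> j)) \<in> borel_measurable (label_sequences \<mu>)" for j
    using g by (rule measurable_compose)
  have *: "AE \<omega> in label_sequences \<mu>. \<forall>\<^sub>F k in sequentially. \<forall>l\<ge>k + m k. ?S \<omega> k l \<le> \<epsilon> * (l - k)"
    if \<epsilon>: "0 < \<epsilon>" for \<epsilon> :: real
  proof -
    define t where "t = \<epsilon>\<^sup>2 / (2 * B'\<^sup>2)"
    have t: "0 < t" using \<epsilon> B' by (simp add: t_def)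
    define A where "A k = {\<omega> \<in> space (label_sequences \<mu>). \<exists>l\<ge>k + m k. \<not> ?S \<omega> k l \<le> \<epsilon> * (l - k)}" for k
    \<comment> \<open>i is the excess of the block length over \<open>m k\<close>. The bad event for
      k is the countable union over i, and Hoeffding makes its probabilities decay geometrically in
      i with total of order exp (- t * m k).\<close>
    define A' where "A' k i = {\<omega> \<in> space (label_sequences \<mu>). \<not> ?S \<omega> k (k + m k + i) \<le> \<epsilon> * (m k + i)}" for k i
    have A' [measurable]: "A' k i \<in> sets (label_sequences \<mu>)" for k i
      unfolding A'_def by measurable
    have A_eq: "A k = (\<Union>i. A' k i)" for k
      by (auto simp: A_def A'_def le_iff_add)
    have A [measurable]: "A k \<in> sets (label_sequences \<mu>)" for k
      unfolding A_eq by measurable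
    have le: "P.prob (A' k i) \<le> 2 * exp (- t * m k) * exp (- t) ^ i" for k i
    \<comment> \<open>Hoeffding needs a nonempty block; for an empty one both sides of the deviation
      inequality are 0.\<close>
    proof (cases "m k + i = 0")
      case True
      then have "A' k i = {}" by (simp add: A'_def)
      then show ?thesis by simp
    next
      case False
      have "P.prob {\<omega> \<in> space (label_sequences \<mu>). \<epsilon> * card {k..<k + m k + i} \<le> \<bar>(\<Sum>j\<in>{k..<k + m k + i}. g (\<omega> j) - integral\<^sup>L \<mu> g)\<bar>}
        \<le> 2 * exp (- t * card {k..<k + m k + i})"
        unfolding t_def using False
        by (intro Hoeffding_coordinates[OF \<mu> g B'(2) B'(1) \<epsilon>, where I = "{k..<k + m k + i}"]) auto
      moreover have "P.prob (A' k i) \<le> P.prob {\<omega> \<in> space (label_sequences \<mu>). \<epsilon> * card {k..<k + m k + i} \<le> \<bar>(\<Sum>j\<in>{k..<k + m k + i}. g (\<omega> j) - integral\<^sup>L \<mu> g)\<bar>}"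
        by (rule P.finite_measure_mono) (auto simp: A'_def algebra_simps)
      moreover have "2 * exp (- t * card {k..<k + m k + i}) = 2 * exp (- t * m k) * exp (- t) ^ i"
        by (simp add: exp_of_nat_mult[symmetric] exp_add[symmetric] algebra_simps)
      ultimately show ?thesis by linarith
    qed
    have et: "norm (exp (- t)) < 1" using t by simp
    have sum: "summable (\<lambda>i. 2 * exp (- t * m k) * exp (- t) ^ i)" for k
      using summable_geometric[OF et] by (rule summable_mult)
    have bd: "P.prob (A k) \<le> 2 / (1 - exp (- t)) * exp (- t * m k)" for k
    proof -
      have sm: "summable (\<lambda>i. P.prob (A' k i))"
        by (rule summable_comparison_test'[OF sum, of 0]) (use le in auto)
      have "P.prob (A k) \<le> (\<Sum>i. P.prob (A' k i))"
        unfolding A_eq using sm by (intro P.finite_measure_subadditive_countably) auto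
      also have "\<dots> \<le> (\<Sum>i. 2 * exp (- t * m k) * exp (- t) ^ i)"
        using le sm sum by (intro suminf_le) auto
      also have "\<dots> = 2 * exp (- t * m k) * (1 / (1 - exp (- t)))"
        using suminf_geometric[OF et] summable_geometric[OF et] by (simp add: suminf_mult)
      finally show ?thesis by simp
    qed
    have "summable (\<lambda>k. 2 / (1 - exp (- t)) * exp (- t * m k))"
      using m[OF t] by (rule summable_mult)
    then have "summable (\<lambda>k. P.prob (A k))"
      by (rule summable_comparison_test'[where N = 0]) (use bd in simp)
    then have "AE \<omega> in label_sequences \<mu>. \<forall>\<^sub>F k in sequentially. \<omega> \<in> space (label_sequences \<mu>) - A k"
      by (intro borel_cantelli_AE1) (auto simp: P.emeasure_eq_measure)
    then show ?thesis
      by (rule AE_mp) (rule AE_I2, auto elim!: eventually_mono simp: A_def)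
  qed
  \<comment> \<open>Countably many tolerances give one null set outside of which every \<epsilon> is
    served.\<close>
  have "AE \<omega> in label_sequences \<mu>. \<forall>n. \<forall>\<^sub>F k in sequentially. \<forall>l\<ge>k + m k. ?S \<omega> k l \<le> 1 / Suc n * (l - k)"
    unfolding AE_all_countable by (intro allI *) simp
  then show ?thesis
  proof (rule AE_mp, intro AE_I2 impI allI)
    fix \<omega> and \<epsilon> :: real
    assume \<omega>: "\<forall>n. \<forall>\<^sub>F k in sequentially. \<forall>l\<ge>k + m k. ?S \<omega> k l \<le> 1 / Suc n * (l - k)" and "0 < \<epsilon>"
    then obtain n where n: "1 / Suc n < \<epsilon>" using reals_Archimedean by (auto simp: inverse_eq_divide)
    from \<omega> have "\<forall>\<^sub>F k in sequentially. \<forall>l\<ge>k + m k. ?S \<omega> k l \<le> 1 / Suc n * (l - k)" by blast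
    then show "\<forall>\<^sub>F k in sequentially. \<forall>l\<ge>k + m k. ?S \<omega> k l \<le> \<epsilon> * (l - k)"
    proof eventually_elim
      case (elim k)
      show ?case
      proof (intro allI impI)
        fix l assume "l \<ge> k + m k"
        then have "?S \<omega> k l \<le> 1 / Suc n * (l - k)" using elim by blast
        also have "1 / Suc n * real (l - k) \<le> \<epsilon> * real (l - k)" using n by (intro mult_right_mono) auto
        finally show "?S \<omega> k l \<le> \<epsilon> * (l - k)" .
      qed
    qed
  qed
qed

text \<open>Consecutive blocks of lengths \<open>m\<close>, started greedily, carry a divergent part of the series
  because \<open>m q^m \<le> p^m\<close> for \<open>q = p / 2\<close>; they are independent.\<close>

lemma AE_infinitely_many_runs:
  fixes m :: "nat \<Rightarrow> nat"
  assumes \<mu>: "prob_space \<mu>" and A: "A \<in> sets \<mu>"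
    and m: "mono m" "\<And>k. 1 \<le> m k"
    and div: "\<not> summable (\<lambda>k. (measure \<mu> A / 2) ^ m k)"
  shows "AE \<omega> in label_sequences \<mu>. \<exists>\<^sub>F k in sequentially. \<forall>j\<in>{k..<k + m k}. \<omega> j \<in> A"
proof -
  interpret \<mu>: prob_space \<mu> by fact
  interpret P: product_prob_space "\<lambda>_. \<mu>" "UNIV :: nat set" ..
  define p where "p = measure \<mu> A"
  have p: "0 \<le> p" "p \<le> 1" by (auto simp: p_def)
  define s where "s i = ((\<lambda>k. k + m k) ^^ i) 0" for i :: nat
  have s_Suc: "s (Suc i) = s i + m (s i)" and s0: "s 0 = 0" for i by (simp_all add: s_def)
  have s_mono: "strict_mono s"
    using m(2) by (intro strict_monoI_Suc) (simp add: s_Suc, metis less_eq_Suc_le One_nat_def)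
  have not_summable: "\<not> summable (\<lambda>i. p ^ m (s i))"
  proof
    assume sum: "summable (\<lambda>i. p ^ m (s i))"
    \<comment> \<open>As m is monotone, the first term of a block is its largest. The halving of p
      pays for the number of indices collected into the block, leaving the probability p ^ m (s i)
      of the run.\<close>
    have block: "(\<Sum>k<s i. (p / 2) ^ m k) \<le> (\<Sum>i'<i. p ^ m (s i'))" for i
    proof (induction i)
      case (Suc i)
      have "(\<Sum>k<s (Suc i). (p / 2) ^ m k) = (\<Sum>k<s i. (p / 2) ^ m k) + (\<Sum>k=s i..<s (Suc i). (p / 2) ^ m k)"
        by (simp add: s_Suc sum.atLeastLessThan_concat lessThan_atLeast0)
      also have "(\<Sum>k=s i..<s (Suc i). (p / 2) ^ m k) \<le> (\<Sum>k=s i..<s (Suc i). (p / 2) ^ m (s i))"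
        using p monoD[OF m(1)] by (intro sum_mono power_decreasing) auto
      also have "\<dots> = m (s i) * (p / 2) ^ m (s i)" by (simp add: s_Suc)
      also have "\<dots> \<le> 2 ^ m (s i) * (p / 2) ^ m (s i)"
        using p by (intro mult_right_mono) (auto simp: less_exp less_imp_le)
      also have "\<dots> = p ^ m (s i)" by (simp add: power_mult_distrib[symmetric])
      finally show ?case using Suc by simp
    qed (simp add: s0)
    have "summable (\<lambda>k. (p / 2) ^ m k)"
    proof (rule summableI_nonneg_bounded)
      fix n
      have "n \<le> s n" using s_mono by (rule strict_mono_imp_increasing)
      then have "(\<Sum>k<n. (p / 2) ^ m k) \<le> (\<Sum>k<s n. (p / 2) ^ m k)"
        using p by (intro sum_mono2) auto
      also have "\<dots> \<le> (\<Sum>i'<n. p ^ m (s i'))" by (rule block)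
      also have "\<dots> \<le> (\<Sum>i'. p ^ m (s i'))" using sum p by (intro sum_le_suminf) auto
      finally show "(\<Sum>k<n. (p / 2) ^ m k) \<le> (\<Sum>i'. p ^ m (s i'))" .
    qed (use p in simp)
    then show False using div by (simp add: p_def)
  qed
  define E where "E i = {\<omega> \<in> space (label_sequences \<mu>). \<forall>j\<in>{s i..<s (Suc i)}. \<omega> j \<in> A}" for i
  have [measurable]: "A \<in> sets \<mu>" by fact
  have [measurable]: "E i \<in> sets (label_sequences \<mu>)" for i
    unfolding E_def by measurable
  have disj: "disjoint_family (\<lambda>i. {s i..<s (Suc i)})"
  proof -
    have "{s i..<s (Suc i)} \<inter> {s j..<s (Suc j)} = {}" if "i < j" for i j
      using strict_mono_leD[OF s_mono, of "Suc i" j] that by auto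
    then show ?thesis unfolding disjoint_family_on_def by (metis inf_commute linorder_neqE_nat)
  qed
  have prob_E: "P.prob (E i) = p ^ m (s i)" for i
  proof -
    have "E i = prod_emb UNIV (\<lambda>_. \<mu>) {s i..<s (Suc i)} (\<Pi>\<^sub>E j\<in>{s i..<s (Suc i)}. A)"
      using sets.sets_into_space[OF A] by (auto simp: E_def prod_emb_def space_PiM PiE_iff)
    then have "P.prob (E i) = (\<Prod>j\<in>{s i..<s (Suc i)}. p)"
      using P.measure_PiM_emb[of "{s i..<s (Suc i)}" "\<lambda>_. A"] A by (simp add: p_def)
    then show ?thesis by (simp add: s_Suc)
  qed
  \<comment> \<open>Stated for complements, because the event to be excluded is that all runs from
    some block on fail.\<close>
  have indep: "P.indep_events (\<lambda>i. space (label_sequences \<mu>) - E i) UNIV"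
  proof -
    have "P.indep_vars (\<lambda>i. Pi\<^sub>M {s i..<s (Suc i)} (\<lambda>_. \<mu>)) (\<lambda>i \<omega>. restrict (\<lambda>j. \<omega> j) {s i..<s (Suc i)}) UNIV"
      by (rule P.indep_vars_restrict[OF indep_vars_coordinates[OF \<mu>] _ disj]) simp
    then have "P.indep_events (\<lambda>i. {\<omega> \<in> space (label_sequences \<mu>).
        \<not> (\<forall>j\<in>{s i..<s (Suc i)}. restrict (\<lambda>j. \<omega> j) {s i..<s (Suc i)} j \<in> A)}) UNIV"
      by (rule P.indep_eventsI_indep_vars) measurable
    also have "(\<lambda>i. {\<omega> \<in> space (label_sequences \<mu>).
        \<not> (\<forall>j\<in>{s i..<s (Suc i)}. restrict (\<lambda>j. \<omega> j) {s i..<s (Suc i)} j \<in> A)})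
      = (\<lambda>i. space (label_sequences \<mu>) - E i)"
      by (auto simp: E_def fun_eq_iff)
    finally show ?thesis .
  qed
  have none: "AE \<omega> in label_sequences \<mu>. \<exists>i\<ge>n. \<omega> \<in> E i" for n
  proof -
    define G where "G = (\<Inter>i\<in>{n..}. space (label_sequences \<mu>) - E i)"
    have G [measurable]: "G \<in> sets (label_sequences \<mu>)" unfolding G_def by measurable
    have bd: "P.prob G \<le> exp (- (\<Sum>i=n..<n + r. p ^ m (s i)))" if "0 < r" for r
    proof -
      have "P.prob G \<le> P.prob (\<Inter>i\<in>{n..<n + r}. space (label_sequences \<mu>) - E i)"
        using that by (intro P.finite_measure_mono sets.finite_INT) (auto simp: G_def)
      also have "\<dots> = (\<Prod>i\<in>{n..<n + r}. P.prob (space (label_sequences \<mu>) - E i))"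
        using indep that unfolding P.indep_events_def by auto
      also have "\<dots> = (\<Prod>i\<in>{n..<n + r}. 1 - p ^ m (s i))"
        by (simp add: P.prob_compl prob_E)
      also have "\<dots> \<le> (\<Prod>i\<in>{n..<n + r}. exp (- (p ^ m (s i))))"
      proof (rule prod_mono, intro conjI)
        fix i show "0 \<le> 1 - p ^ m (s i)" using p by (simp add: power_le_one)
        show "1 - p ^ m (s i) \<le> exp (- (p ^ m (s i)))"
          using exp_ge_add_one_self[of "- (p ^ m (s i))"] by simp
      qed
      also have "\<dots> = exp (- (\<Sum>i=n..<n + r. p ^ m (s i)))"
        by (simp add: exp_sum[symmetric] sum_negf)
      finally show ?thesis .
    qed
    \<comment> \<open>By 1 - x \<le> exp (- x), a positive probability would bound the partial sums
      of the run probabilities by - ln of it.\<close>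
    have "P.prob G = 0"
    proof (rule ccontr)
      assume "P.prob G \<noteq> 0"
      then have pos: "0 < P.prob G" by (simp add: zero_less_measure_iff)
      have "summable (\<lambda>i. p ^ m (s (i + n)))"
      proof (rule summableI_nonneg_bounded)
        fix r
        have "(\<Sum>i<r. p ^ m (s (i + n))) = (\<Sum>i=n..<n + r. p ^ m (s i))"
          using sum.shift_bounds_nat_ivl[of "\<lambda>i. p ^ m (s i)" 0 n r]
          by (simp add: lessThan_atLeast0 add.commute)
        also have "\<dots> \<le> max 0 (- ln (P.prob G))"
        proof (cases "r = 0")
          case False
          then have "ln (P.prob G) \<le> - (\<Sum>i=n..<n + r. p ^ m (s i))"
            using bd[of r] pos by (metis exp_gt_zero ln_exp ln_le_cancel_iff not_gr_zero)
          then show ?thesis by simp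
        qed simp
        finally show "(\<Sum>i<r. p ^ m (s (i + n))) \<le> max 0 (- ln (P.prob G))" .
      qed (use p in simp)
      then show False using not_summable summable_iff_shift[of "\<lambda>i. p ^ m (s i)" n] by simp
    qed
    then have "AE \<omega> in label_sequences \<mu>. \<omega> \<notin> G"
      by (intro AE_not_in) (simp add: null_sets_def P.emeasure_eq_measure)
    then show ?thesis by (rule AE_mp) (rule AE_I2, auto simp: G_def)
  qed
  have "AE \<omega> in label_sequences \<mu>. \<forall>n. \<exists>i\<ge>n. \<omega> \<in> E i"
    unfolding AE_all_countable using none by blast
  then show ?thesis
  proof (rule AE_mp, intro AE_I2 impI)
    fix \<omega> assume \<omega>: "\<forall>n. \<exists>i\<ge>n. \<omega> \<in> E i"
    show "\<exists>\<^sub>F k in sequentially. \<forall>j\<in>{k..<k + m k}. \<omega> j \<in> A"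
      unfolding frequently_sequentially
    proof
      fix n
      obtain i where "i \<ge> n" "\<omega> \<in> E i" using \<omega> by blast
      moreover have "n \<le> s i" using strict_mono_imp_increasing[OF s_mono, of i] \<open>i \<ge> n\<close> by simp
      ultimately show "\<exists>k\<ge>n. \<forall>j\<in>{k..<k + m k}. \<omega> j \<in> A" by (auto simp: E_def s_Suc)
    qed
  qed
qed

section \<open>Almost sure dimensions\<close>

context one_variable_RIFS
begin

text \<open>The constants are chosen before \<omega>, so that block lengths built from a, b and D
  are deterministic.\<close>

lemma homogeneous_iterations:
  assumes hom: "homogeneous \<Lambda> N c" and osc: "uniform_open_set_condition \<Lambda> V N f"
  obtains U a b D \<delta> u where
    "0 < a" "0 < b" "b < 1" "\<And>l. l \<in> \<Lambda> \<Longrightarrow> a \<le> c l 1 \<and> c l 1 \<le> b"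
    "\<And>\<omega>. (\<And>j. \<omega> j \<in> \<Lambda>) \<Longrightarrow> homogeneous_iteration V U \<Delta> N f \<omega> (\<lambda>j. c (\<omega> j) 1) a b D \<delta> u"
proof -
  interpret \<mu>: prob_space \<mu> by (rule prob_labels)
  obtain a b where ab: "0 < a" "b < 1" "\<And>l i. l \<in> \<Lambda> \<Longrightarrow> i \<in> {1..N l} \<Longrightarrow> a \<le> c l i \<and> c l i \<le> b"
    using ratios_bounded by blast
  have one: "1 \<in> {1..N l}" if "l \<in> \<Lambda>" for l using maps_nonempty[OF that] by simp
  have c1: "a \<le> c l 1 \<and> c l 1 \<le> b" if "l \<in> \<Lambda>" for l using ab(3)[OF that one[OF that]] .
  have "space \<mu> = \<Lambda>"
    using sets_eq_imp_space_eq[OF sets_labels] by (simp add: space_restrict_space)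
  then obtain l0 where "l0 \<in> \<Lambda>" using \<mu>.not_empty by blast
  then have "0 < b" using c1[of l0] ab(1) by linarith
  obtain U where U: "open U" "U \<noteq> {}" "U \<subseteq> V" and osc_U: "\<forall>l\<in>\<Lambda>.
      (\<forall>i\<in>{1..N l}. f l i ` U \<subseteq> U) \<and> disjoint_family_on (\<lambda>i. f l i ` U) {1..N l}"
    using osc unfolding uniform_open_set_condition_def by (elim exE conjE)
  obtain u where "u \<in> U" using U(2) by blast
  then obtain \<delta> where \<delta>: "0 < \<delta>" "ball u \<delta> \<subseteq> U" using U(1) open_contains_ball by blast
  obtain e where e: "\<And>x. x \<in> \<Delta> \<Longrightarrow> dist u x \<le> e"
    using compact_imp_bounded[OF Delta(1)] unfolding bounded_any_center[of _ u] by blast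
  have "homogeneous_iteration V U \<Delta> N f \<omega> (\<lambda>j. c (\<omega> j) 1) a b (max 1 e) \<delta> u"
    if \<omega>: "\<And>j. \<omega> j \<in> \<Lambda>" for \<omega>
  proof
    show "dist (f (\<omega> j) i x) (f (\<omega> j) i y) = c (\<omega> j) 1 * dist x y"
      if "i \<in> {1..N (\<omega> j)}" "x \<in> V" "y \<in> V" for i j x y
    proof -
      have "c (\<omega> j) i = c (\<omega> j) 1"
        using hom \<omega>[of j] that(1) one[OF \<omega>[of j]] unfolding homogeneous_def by blast
      then show ?thesis using similarity[OF \<omega> that] by simp
    qed
    show "dist u x \<le> max 1 e" if "x \<in> \<Delta>" for x using e[OF that] by simp
    show "f (\<omega> j) i ` U \<subseteq> U" if "i \<in> {1..N (\<omega> j)}" for i j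
      using osc_U \<omega> that by blast
    show "disjoint_family_on (\<lambda>i. f (\<omega> j) i ` U) {1..N (\<omega> j)}" for j
      using osc_U \<omega> by blast
    show "a \<le> c (\<omega> j) 1" "c (\<omega> j) 1 \<le> b" for j using c1[OF \<omega>] by blast+
  qed (fact ab U \<delta> Delta maps_nonempty[OF \<omega>] Delta_invariant[OF \<omega>] | simp)+
  then show thesis using that ab(1,2) \<open>0 < b\<close> c1 by blast
qed

end

locale homogeneous_RIFS = one_variable_RIFS \<Lambda> \<mu> V N f c \<Delta>
  for \<Lambda> :: "'a::euclidean_space set" and \<mu> :: "'a measure" and V \<Delta> :: "'b::euclidean_space set"
    and N :: "'a \<Rightarrow> nat" and f :: "'a \<Rightarrow> nat \<Rightarrow> 'b \<Rightarrow> 'b" and c :: "'a \<Rightarrow> nat \<Rightarrow> real" +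
  fixes U :: "'b set" and a b D \<delta> :: real and u :: 'b
  assumes hom: "homogeneous \<Lambda> N c"
    and ab: "0 < a" "0 < b" "b < 1"
    and ratio_bounds: "l \<in> \<Lambda> \<Longrightarrow> a \<le> c l 1 \<and> c l 1 \<le> b"
    and iteration: "(\<And>j. \<omega> j \<in> \<Lambda>) \<Longrightarrow> homogeneous_iteration V U \<Delta> N f \<omega> (\<lambda>j. c (\<omega> j) 1) a b D \<delta> u"
begin

section \<open>Measurability and means of the logarithmic data\<close>

sublocale \<mu>: prob_space \<mu> by (rule prob_labels)

lemma space_labels: "space \<mu> = \<Lambda>"
  using sets_eq_imp_space_eq[OF sets_labels] by (simp add: space_restrict_space)

lemma a_less_1: "a < 1"
proof -
  obtain l where "l \<in> \<Lambda>" using \<mu>.not_empty space_labels by blast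
  then show ?thesis using ratio_bounds[of l] ab by linarith
qed

lemma space_sequences: "\<omega> \<in> space (label_sequences \<mu>) \<Longrightarrow> \<omega> j \<in> \<Lambda>"
  using PiE_mem[of \<omega> UNIV "\<lambda>_. space \<mu>" j] by (simp add: space_PiM space_labels)

lemma ratio_sum_eq: "l \<in> \<Lambda> \<Longrightarrow> ratio_sum N c l t = real (N l) * c l 1 powr t"
proof -
  assume l: "l \<in> \<Lambda>"
  have "ratio_sum N c l t = (\<Sum>i=1..N l. c l 1 powr t)"
    unfolding ratio_sum_def
  proof (rule sum.cong[OF refl])
    fix i assume "i \<in> {1..N l}"
    moreover have "1 \<in> {1..N l}" using maps_nonempty[OF l] by simp
    ultimately have "c l i = c l 1"
      using hom l unfolding homogeneous_def by blast
    then show "c l i powr t = c l 1 powr t" by simp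
  qed
  then show ?thesis by simp
qed

definition log_number :: "'a \<Rightarrow> real" where "log_number l = ln (real (N l))"
definition log_ratio :: "'a \<Rightarrow> real" where "log_ratio l = ln (c l 1)"

lemma N_pos: "l \<in> \<Lambda> \<Longrightarrow> 0 < real (N l)"
  using maps_nonempty[of l] by simp

lemma c_pos: "l \<in> \<Lambda> \<Longrightarrow> 0 < c l 1"
  using ratio_bounds[of l] ab(1) by linarith

lemma ratio_sum_exp:
  assumes "l \<in> \<Lambda>"
  shows "ratio_sum N c l t = exp (log_number l + t * log_ratio l)"
  unfolding ratio_sum_eq[OF assms] log_number_def log_ratio_def
  using N_pos[OF assms] c_pos[OF assms] by (simp add: exp_add powr_def)

text \<open>Measurability is given for ratio sums only. The exponent 0 recovers the number of maps,
  and the quotient of the sums at 1 and 0 recovers the ratio.\<close>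

lemma measurable_log_number [measurable]: "log_number \<in> borel_measurable \<mu>"
proof -
  have "(\<lambda>l. ln (ratio_sum N c l 0)) \<in> borel_measurable \<mu>"
    by (intro borel_measurable_ln measurable_ratio_sum)
  moreover have "ln (ratio_sum N c l 0) = log_number l" if "l \<in> space \<mu>" for l
    using that by (simp add: space_labels ratio_sum_exp)
  ultimately show ?thesis using measurable_cong[of \<mu> log_number "\<lambda>l. ln (ratio_sum N c l 0)"] by simp
qed

lemma measurable_log_ratio [measurable]: "log_ratio \<in> borel_measurable \<mu>"
proof -
  have "(\<lambda>l. ln (ratio_sum N c l 1) - ln (ratio_sum N c l 0)) \<in> borel_measurable \<mu>"
    by (intro borel_measurable_diff borel_measurable_ln measurable_ratio_sum)
  moreover have "ln (ratio_sum N c l 1) - ln (ratio_sum N c l 0) = log_ratio l" if "l \<in> space \<mu>" for l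
    using that by (simp add: space_labels ratio_sum_exp)
  ultimately show ?thesis
    using measurable_cong[of \<mu> log_ratio "\<lambda>l. ln (ratio_sum N c l 1) - ln (ratio_sum N c l 0)"] by simp
qed

lemma log_number_bounded:
  obtains B where "\<And>l. l \<in> space \<mu> \<Longrightarrow> \<bar>log_number l\<bar> \<le> B" "0 \<le> B"
proof -
  obtain n where n: "\<And>l. l \<in> \<Lambda> \<Longrightarrow> N l \<le> n"
    using number_bounded unfolding bdd_above_def by blast
  have "\<bar>log_number l\<bar> \<le> ln (real (Suc n))" if "l \<in> space \<mu>" for l
  proof -
    have l: "l \<in> \<Lambda>" using that by (simp add: space_labels)
    have "0 \<le> log_number l" using maps_nonempty[OF l] by (simp add: log_number_def)
    moreover have "ln (real (N l)) \<le> ln (real (Suc n))"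
      using n[OF l] N_pos[OF l] by (subst ln_le_cancel_iff) auto
    ultimately show ?thesis by (simp add: log_number_def)
  qed
  then show thesis by (rule that) simp_all
qed

lemma log_ratio_bounds:
  assumes "l \<in> \<Lambda>"
  shows "ln a \<le> log_ratio l" "log_ratio l \<le> ln b"
  using ratio_bounds[OF assms] ab c_pos[OF assms] by (simp_all add: log_ratio_def)

lemma log_ratio_bounded: "l \<in> space \<mu> \<Longrightarrow> \<bar>log_ratio l\<bar> \<le> - ln a"
  using log_ratio_bounds[of l] ab a_less_1 ln_less_zero[of a] ln_less_zero[of b]
  unfolding space_labels abs_le_iff by linarith

lemma integral_log_ratio_neg: "integral\<^sup>L \<mu> log_ratio < 0"
proof -
  have "integrable \<mu> log_ratio"
    by (rule \<mu>.integrable_const_bound[where B = "- ln a"]) (auto intro!: AE_I2 log_ratio_bounded)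
  then have "integral\<^sup>L \<mu> log_ratio \<le> integral\<^sup>L \<mu> (\<lambda>_. ln b)"
    by (rule integral_mono) (auto simp: space_labels log_ratio_bounds)
  also have "\<dots> < 0" using ab by (simp add: \<mu>.prob_space)
  finally show ?thesis .
qed

text \<open>Outside a null set both dimensions equal the same quotient of the means of
  \<open>log_number\<close> and - \<open>log_ratio\<close>; the comparison with \<phi> makes the
  block lengths of \<psi> long enough for Borel-Cantelli.\<close>

lemma AE_box_dimension:
  assumes \<phi>: "dimension_function \<phi>"
    and sum: "summable (\<lambda>k. exp (- \<phi> (exp (- real (Suc k))) * real (Suc k)))"
    and \<psi>: "dimension_function \<psi>" and ratio: "((\<lambda>x. \<phi> x / \<psi> x) \<longlongrightarrow> 0) (at_right 0)"
  shows "AE \<omega> in label_sequences \<mu>. has_box_dimension (random_set N f \<Delta> \<omega>)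
    (generalised_assouad_spectrum \<psi> (random_set N f \<Delta> \<omega>))"
proof -
  define h\<^sub>1 where "h\<^sub>1 = (\<lambda>y. \<phi> (exp (- y)) * y)"
  define h\<^sub>2 where "h\<^sub>2 = (\<lambda>y. \<psi> (exp (- y)) * y)"
  have sum': "summable (\<lambda>k. exp (- h\<^sub>1 (real (Suc k))))"
    using sum by (simp add: h\<^sub>1_def)
  have unb1: "\<exists>y\<ge>1. Z < h\<^sub>1 y" for Z by (rule summable_exp_imp_unbounded[OF sum'])
  have mono1: "mono_on {0<..} h\<^sub>1"
    using log_scale_monotone[OF \<phi>, folded h\<^sub>1_def] unb1 by (rule unbounded_monotone_imp_mono)
  have lim1: "filterlim h\<^sub>1 at_top at_top"
    using mono1 unb1 by (rule mono_unbounded_imp_at_top)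
  have le: "\<forall>\<^sub>F y in at_top. h\<^sub>1 y \<le> \<epsilon> * h\<^sub>2 y" if "0 < \<epsilon>" for \<epsilon>
    unfolding h\<^sub>1_def h\<^sub>2_def by (rule log_scale_ratio[OF \<phi> \<psi> ratio that])
  have lim2: "filterlim h\<^sub>2 at_top at_top"
    using lim1 by (rule filterlim_at_top_mono) (use le[of 1] in simp)
  have mono2: "mono_on {0<..} h\<^sub>2"
    using log_scale_monotone[OF \<psi>, folded h\<^sub>2_def] at_top_imp_unbounded[OF lim2]
    by (rule unbounded_monotone_imp_mono)
  define \<alpha> \<beta> where "\<alpha> = - ln a" and "\<beta> = - ln b"
  have pos: "0 < \<alpha>" "0 < \<beta>" using ab a_less_1 by (auto simp: \<alpha>_def \<beta>_def)
  \<comment> \<open>Rounded down, since the averages must cover every block that can occur.\<close>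
  define m where "m k = nat \<lfloor>h\<^sub>2 (\<beta> * real k - (\<beta> + ln (2 * D))) / \<alpha> - (1 + ln (2 * D) / \<alpha>)\<rfloor>" for k
  have m: "summable (\<lambda>k. exp (- t * real (m k)))" if "0 < t" for t
    unfolding m_def by (rule summable_block_lengths[OF mono1 sum' le pos that])
  obtain B where B: "\<And>l. l \<in> space \<mu> \<Longrightarrow> \<bar>log_number l\<bar> \<le> B"
    using log_number_bounded by blast
  have "AE \<omega> in label_sequences \<mu>. \<forall>\<epsilon>>0. \<forall>\<^sub>F k in sequentially. \<forall>l\<ge>k + m k.
      \<bar>\<Sum>j=k..<l. log_number (\<omega> j) - integral\<^sup>L \<mu> log_number\<bar> \<le> \<epsilon> * real (l - k)"
    by (rule AE_block_averages[OF prob_labels measurable_log_number B m])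
  moreover have "AE \<omega> in label_sequences \<mu>. \<forall>\<epsilon>>0. \<forall>\<^sub>F k in sequentially. \<forall>l\<ge>k + m k.
      \<bar>\<Sum>j=k..<l. log_ratio (\<omega> j) - integral\<^sup>L \<mu> log_ratio\<bar> \<le> \<epsilon> * real (l - k)"
    by (rule AE_block_averages[OF prob_labels measurable_log_ratio log_ratio_bounded m])
  ultimately show ?thesis
    using AE_space
  proof eventually_elim
    case (elim \<omega>)
    interpret I: homogeneous_iteration V U \<Delta> N f \<omega> "\<lambda>j. c (\<omega> j) 1" a b D \<delta> u
      by (rule iteration) (rule space_sequences[OF elim(3)])
    have pos_\<psi>: "0 < \<psi> x" if "0 < x" "x < 1" for x
      using \<psi> that unfolding dimension_function_def by simp
    have mk: "real (m k) \<le> max 0 (h\<^sub>2 (- ln b * real k - (- ln b + ln (2 * D))) / - ln a - (1 + ln (2 * D) / - ln a))" for k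
      unfolding m_def \<alpha>_def \<beta>_def by linarith
    note * = mono2[unfolded h\<^sub>2_def] lim2[unfolded h\<^sub>2_def] mk[unfolded h\<^sub>2_def] integral_log_ratio_neg[unfolded log_ratio_def]
      elim(1)[unfolded log_number_def, rule_format] elim(2)[unfolded log_ratio_def, rule_format]
    show ?case
      using I.spectrum_eq_of_averages[OF pos_\<psi> *] by simp
  qed
qed

text \<open>The common core of the two divergent cases. In \<open>ratio\<close>, division by - ln b
  converts ln (R / r) into levels and - ln (measure \<mu> A / 2) is the cost of a level within a
  run, with the halving required by the greedy choice of blocks.\<close>

lemma AE_spectrum_ge:
  assumes \<phi>: "dimension_function \<phi>"
    and div: "\<not> summable (\<lambda>k. exp (- \<phi> (exp (- real (Suc k))) * real (Suc k)))"
    and \<psi>: "dimension_function \<psi>" and lim: "filterlim (\<lambda>x. \<psi> x * \<bar>ln x\<bar>) at_top (at_right 0)"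
    and A: "A \<in> sets \<mu>" "0 < measure \<mu> A" "\<And>l. l \<in> A \<Longrightarrow> 1 \<le> ratio_sum N c l t"
    and ratio: "\<forall>\<^sub>F y in at_top.
      - ln (measure \<mu> A / 2) * (\<psi> (exp (- y)) * y) / - ln b \<le> \<phi> (exp (- y)) * y"
  shows "AE \<omega> in label_sequences \<mu>.
    ereal t \<le> generalised_assouad_spectrum \<psi> (random_set N f \<Delta> \<omega>)"
proof -
  define h\<^sub>1 where "h\<^sub>1 = (\<lambda>y. \<phi> (exp (- y)) * y)"
  define h\<^sub>2 where "h\<^sub>2 = (\<lambda>y. \<psi> (exp (- y)) * y)"
  define \<alpha> \<beta> where "\<alpha> = - ln a" and "\<beta> = - ln b"
  define q where "q = measure \<mu> A / 2"
  have q: "0 < q" "q < 1" using A(2) \<mu>.prob_le_1[of A] unfolding q_def by linarith+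
  have pos: "0 < \<alpha>" "0 < \<beta>" using ab a_less_1 by (auto simp: \<alpha>_def \<beta>_def)
  have lim2: "filterlim h\<^sub>2 at_top at_top"
    unfolding h\<^sub>2_def using lim by (rule log_scale_at_top)
  have mono2: "mono_on {0<..} h\<^sub>2"
    using log_scale_monotone[OF \<psi>, folded h\<^sub>2_def] at_top_imp_unbounded[OF lim2]
    by (rule unbounded_monotone_imp_mono)
  have h2_pos: "0 < h\<^sub>2 y" if "0 < y" for y
    unfolding h\<^sub>2_def using log_scale_pos[OF \<psi> that] .
  have ratio': "\<forall>\<^sub>F y in at_top. - ln q * h\<^sub>2 y / \<beta> \<le> h\<^sub>1 y"
    using ratio by (simp add: h\<^sub>1_def h\<^sub>2_def \<beta>_def q_def)
  have lnq: "0 < - ln q / \<beta>" using q pos by (intro divide_pos_pos) auto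
  \<comment> \<open>Unboundedness passes from \<psi> to \<phi> through the comparison and shows that
    the function of \<phi> is increasing too.\<close>
  have "filterlim (\<lambda>y. - ln q / \<beta> * h\<^sub>2 y) at_top at_top"
    using lnq lim2 by (intro filterlim_tendsto_pos_mult_at_top[OF tendsto_const])
  then have lim1: "filterlim h\<^sub>1 at_top at_top"
    by (rule filterlim_at_top_mono) (use ratio' in simp)
  have mono1: "mono_on {0<..} h\<^sub>1"
    using log_scale_monotone[OF \<phi>, folded h\<^sub>1_def] at_top_imp_unbounded[OF lim1]
    by (rule unbounded_monotone_imp_mono)
  \<comment> \<open>Rounded up with one more level, so that a run contains the entire block and is
    never empty.\<close>
  define m where "m k = nat \<lceil>h\<^sub>2 (\<alpha> * (real k + 1)) / \<beta>\<rceil> + 1" for k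
  have div': "\<not> summable (\<lambda>k. exp (- h\<^sub>1 (real (Suc k))))" using div by (simp add: h\<^sub>1_def)
  have "\<not> summable (\<lambda>k. q ^ m k)"
    unfolding m_def
    by (rule not_summable_run_lengths[OF mono1 div' ratio' pos q]) (use h2_pos in \<open>simp add: less_imp_le\<close>)
  moreover have "mono m"
  proof (rule monoI)
    fix k k' :: nat assume "k \<le> k'"
    then have "\<alpha> * (real k + 1) \<le> \<alpha> * (real k' + 1)" using pos by (intro mult_left_mono) auto
    moreover have "0 < \<alpha> * (real k + 1)" using pos by (intro mult_pos_pos) auto
    ultimately have "h\<^sub>2 (\<alpha> * (real k + 1)) \<le> h\<^sub>2 (\<alpha> * (real k' + 1))"
      by (intro mono_onD[OF mono2]) auto
    then show "m k \<le> m k'"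
      unfolding m_def using pos by (intro add_right_mono nat_mono ceiling_mono divide_right_mono) auto
  qed
  ultimately have "AE \<omega> in label_sequences \<mu>. \<exists>\<^sub>F k in sequentially. \<forall>j\<in>{k..<k + m k}. \<omega> j \<in> A"
    using AE_infinitely_many_runs[OF prob_labels A(1), of m] by (simp add: q_def m_def)
  then show ?thesis
    using AE_space
  proof eventually_elim
    case (elim \<omega>)
    interpret I: homogeneous_iteration V U \<Delta> N f \<omega> "\<lambda>j. c (\<omega> j) 1" a b D \<delta> u
      by (rule iteration) (rule space_sequences[OF elim(2)])
    have pos_\<psi>: "0 < \<psi> x" if "0 < x" "x < 1" for x
      using \<psi> that unfolding dimension_function_def by simp
    have mk: "h\<^sub>2 (- ln a * (real k + 1)) / - ln b + 1 \<le> real (m k)" for k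
      unfolding m_def \<alpha>_def \<beta>_def by linarith
    have "0 \<le> I.log_sum t j" if "\<omega> j \<in> A" for j
    proof -
      have "1 \<le> exp (log_number (\<omega> j) + t * log_ratio (\<omega> j))"
        using A(3)[OF that] ratio_sum_exp[OF space_sequences[OF elim(2)]] by simp
      then have "0 \<le> log_number (\<omega> j) + t * log_ratio (\<omega> j)" by simp
      then show ?thesis by (simp only: I.log_sum_def log_number_def log_ratio_def)
    qed
    then have runs: "\<exists>\<^sub>F k in sequentially. \<forall>j\<in>{k..<k + m k}. 0 \<le> I.log_sum t j"
      using elim(1) by (elim frequently_elim1) blast
    show ?case
      by (rule I.spectrum_ge_of_runs[OF pos_\<psi> mono2[unfolded h\<^sub>2_def] lim2[unfolded h\<^sub>2_def] mk[unfolded h\<^sub>2_def] runs])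
  qed
qed

section \<open>The critical exponent and the almost sure Assouad dimension\<close>

abbreviation s\<^sub>A :: real where "s\<^sub>A \<equiv> assouad_exponent \<mu> N c"

lemma ratio_sum_ge_1_sets: "{l \<in> space \<mu>. 1 \<le> ratio_sum N c l t} \<in> sets \<mu>"
  using measurable_ratio_sum[of t] by measurable

text \<open>A real supremum is informative only for a nonempty set that is bounded above. The
  exponent 0 belongs to the set since every system has a map, and bounded numbers of maps with
  ratios at most b < 1 limit the exponents.\<close>

lemma assouad_exponent_set:
  "{t. 0 < measure \<mu> {l \<in> space \<mu>. 1 \<le> ratio_sum N c l t}} \<noteq> {}" (is "?S \<noteq> {}")
  "bdd_above {t. 0 < measure \<mu> {l \<in> space \<mu>. 1 \<le> ratio_sum N c l t}}"
proof -
  have "{l \<in> space \<mu>. 1 \<le> ratio_sum N c l 0} = space \<mu>"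
  proof -
    have "1 \<le> ratio_sum N c l 0" if "l \<in> \<Lambda>" for l
      using that maps_nonempty[OF that] c_pos[OF that] by (simp add: ratio_sum_eq)
    then show ?thesis by (auto simp: space_labels)
  qed
  then have "0 \<in> ?S" by (simp add: \<mu>.prob_space)
  then show "?S \<noteq> {}" by blast
  obtain B where B: "\<And>l. l \<in> space \<mu> \<Longrightarrow> \<bar>log_number l\<bar> \<le> B" "0 \<le> B"
    using log_number_bounded by blast
  have lnb: "0 < - ln b" using ab by simp
  show "bdd_above ?S"
  proof (rule bdd_aboveI)
    fix t assume "t \<in> ?S"
    then have "{l \<in> space \<mu>. 1 \<le> ratio_sum N c l t} \<noteq> {}" by force
    then obtain l where l: "l \<in> space \<mu>" "1 \<le> ratio_sum N c l t" by blast
    then have l': "l \<in> \<Lambda>" by (simp add: space_labels)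
    then have "0 \<le> log_number l + t * log_ratio l" using l(2) by (simp add: ratio_sum_exp)
    then have le: "t * - log_ratio l \<le> B" using B(1)[OF l(1)] by (simp add: abs_le_iff)
    show "t \<le> B / - ln b"
    proof (cases "0 \<le> t")
      case True
      then have "t * - ln b \<le> t * - log_ratio l" using log_ratio_bounds(2)[OF l'] by (intro mult_left_mono) auto
      then have "t * - ln b \<le> B" using le by linarith
      then show ?thesis by (rule pos_le_divide_eq[OF lnb, THEN iffD2])
    next
      case False
      then have "t \<le> 0" by simp
      also have "0 \<le> B / - ln b" using B(2) lnb by (intro divide_nonneg_pos)
      finally show ?thesis .
    qed
  qed
qed

text \<open>Above the supremum almost every label has ratio sum below 1, so almost surely all block
  sums are nonpositive.\<close>

lemma AE_assouad_dimension_le: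
  "AE \<omega> in label_sequences \<mu>. assouad_dimension (random_set N f \<Delta> \<omega>) \<le> ereal s\<^sub>A"
proof -
  have "AE \<omega> in label_sequences \<mu>. assouad_dimension (random_set N f \<Delta> \<omega>) \<le> ereal (s\<^sub>A + 1 / Suc n)" for n
  proof -
    define s where "s = s\<^sub>A + 1 / Suc n"
    have "s \<notin> {t. 0 < measure \<mu> {l \<in> space \<mu>. 1 \<le> ratio_sum N c l t}}"
    proof
      assume "s \<in> {t. 0 < measure \<mu> {l \<in> space \<mu>. 1 \<le> ratio_sum N c l t}}"
      then have "s \<le> s\<^sub>A" unfolding assouad_exponent_def by (rule cSup_upper[OF _ assouad_exponent_set(2)])
      then show False by (simp add: s_def divide_le_0_iff)
    qed
    then have "measure \<mu> {l \<in> space \<mu>. 1 \<le> ratio_sum N c l s} = 0"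
      using measure_nonneg[of \<mu> "{l \<in> space \<mu>. 1 \<le> ratio_sum N c l s}"]
      unfolding mem_Collect_eq by linarith
    then have "{l \<in> space \<mu>. 1 \<le> ratio_sum N c l s} \<in> null_sets \<mu>"
      using ratio_sum_ge_1_sets[of s] by (simp add: null_sets_def \<mu>.emeasure_eq_measure)
    then have "AE l in \<mu>. l \<notin> {l \<in> space \<mu>. 1 \<le> ratio_sum N c l s}" by (rule AE_not_in)
    then have "AE \<omega> in label_sequences \<mu>. \<omega> j \<notin> {l \<in> space \<mu>. 1 \<le> ratio_sum N c l s}" for j
      by (intro AE_PiM_component prob_labels) auto
    then have "AE \<omega> in label_sequences \<mu>. \<forall>j. \<omega> j \<notin> {l \<in> space \<mu>. 1 \<le> ratio_sum N c l s}"
      unfolding AE_all_countable by blast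
    then show ?thesis
      using AE_space
    proof eventually_elim
      case (elim \<omega>)
      interpret I: homogeneous_iteration V U \<Delta> N f \<omega> "\<lambda>j. c (\<omega> j) 1" a b D \<delta> u
        by (rule iteration) (rule space_sequences[OF elim(2)])
      have "I.log_sum s j \<le> 0" for j
      proof -
        have "\<omega> j \<in> space \<mu>" using space_sequences[OF elim(2)] space_labels by simp
        then have "ratio_sum N c (\<omega> j) s < 1" using elim(1) by force
        then have "exp (log_number (\<omega> j) + s * log_ratio (\<omega> j)) < 1"
          using ratio_sum_exp[OF space_sequences[OF elim(2)]] by simp
        then have "log_number (\<omega> j) + s * log_ratio (\<omega> j) \<le> 0" by simp
        then show ?thesis by (simp only: I.log_sum_def log_number_def log_ratio_def)
      qed
      then show ?case unfolding s_def[symmetric] by (rule I.assouad_dimension_le)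
    qed
  qed
  then have "AE \<omega> in label_sequences \<mu>. \<forall>n. assouad_dimension (random_set N f \<Delta> \<omega>) \<le> ereal (s\<^sub>A + 1 / Suc n)"
    unfolding AE_all_countable by blast
  then show ?thesis
  proof eventually_elim
    case (elim \<omega>)
    have "assouad_dimension (random_set N f \<Delta> \<omega>) \<le> ereal s\<^sub>A + ereal e" if e: "0 < e" for e
    proof -
      obtain n where "inverse (real (Suc n)) < e" using reals_Archimedean[OF e] by blast
      then have "ereal (s\<^sub>A + 1 / Suc n) \<le> ereal s\<^sub>A + ereal e" by (simp add: inverse_eq_divide)
      from order_trans[OF elim[rule_format, of n] this] show ?thesis .
    qed
    then show ?case by (rule ereal_le_epsilon2)
  qed
qed

text \<open>The chain from the critical exponent through the spectrum and the Assouad dimension back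
  to the critical exponent closes.\<close>

lemma AE_spectrum_eq:
  assumes \<psi>: "dimension_function \<psi>"
    and ge: "AE \<omega> in label_sequences \<mu>. ereal s\<^sub>A \<le> generalised_assouad_spectrum \<psi> (random_set N f \<Delta> \<omega>)"
  shows "AE \<omega> in label_sequences \<mu>. generalised_assouad_spectrum \<psi> (random_set N f \<Delta> \<omega>)
    = assouad_dimension (random_set N f \<Delta> \<omega>)"
  using AE_assouad_dimension_le ge
proof eventually_elim
  case (elim \<omega>)
  have "0 < \<psi> x" if "0 < x" "x < 1" for x
    using \<psi> that unfolding dimension_function_def by simp
  then have "generalised_assouad_spectrum \<psi> (random_set N f \<Delta> \<omega>) \<le> assouad_dimension (random_set N f \<Delta> \<omega>)"
    by (rule spectrum_le_assouad_dimension)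
  then show ?case using elim by (metis antisym order_trans)
qed

text \<open>The supremum need not be attained by a set of positive measure. Each t below it has its
  own label set and its own cost per level, and \<psi> = o(\<phi>) beats all of these costs.\<close>

lemma AE_spectrum_eq_small:
  assumes \<phi>: "dimension_function \<phi>"
    and div: "\<not> summable (\<lambda>k. exp (- \<phi> (exp (- real (Suc k))) * real (Suc k)))"
    and \<psi>: "dimension_function \<psi>" and lim: "filterlim (\<lambda>x. \<psi> x * \<bar>ln x\<bar>) at_top (at_right 0)"
    and ratio: "((\<lambda>x. \<psi> x / \<phi> x) \<longlongrightarrow> 0) (at_right 0)"
  shows "AE \<omega> in label_sequences \<mu>. generalised_assouad_spectrum \<psi> (random_set N f \<Delta> \<omega>)
    = assouad_dimension (random_set N f \<Delta> \<omega>)"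
proof (rule AE_spectrum_eq[OF \<psi>])
  have "AE \<omega> in label_sequences \<mu>. ereal (s\<^sub>A - 1 / Suc n) \<le> generalised_assouad_spectrum \<psi> (random_set N f \<Delta> \<omega>)" for n
  proof -
    have "s\<^sub>A - 1 / Suc n < s\<^sub>A" by simp
    then obtain t where t: "s\<^sub>A - 1 / Suc n < t" "0 < measure \<mu> {l \<in> space \<mu>. 1 \<le> ratio_sum N c l t}"
      unfolding assouad_exponent_def less_cSup_iff[OF assouad_exponent_set] by blast
    define A where "A = {l \<in> space \<mu>. 1 \<le> ratio_sum N c l t}"
    have q: "0 < measure \<mu> A / 2" "measure \<mu> A / 2 < 1"
      using t(2)[folded A_def] \<mu>.prob_le_1[of A] by linarith+
    have lnb: "0 < - ln b" using ab by simp
    \<comment> \<open>Chosen so that the factor for the run cost, converted into levels, becomes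
      exactly 1.\<close>
    define \<epsilon> where "\<epsilon> = - ln b / - ln (measure \<mu> A / 2)"
    have lnq: "0 < - ln (measure \<mu> A / 2)" using q by simp
    have \<epsilon>: "0 < \<epsilon>" unfolding \<epsilon>_def using lnb lnq by (rule divide_pos_pos)
    have "\<forall>\<^sub>F y in at_top. \<psi> (exp (- y)) * y \<le> \<epsilon> * (\<phi> (exp (- y)) * y)"
      by (rule log_scale_ratio[OF \<psi> \<phi> ratio \<epsilon>])
    then have ev: "\<forall>\<^sub>F y in at_top. - ln (measure \<mu> A / 2) * (\<psi> (exp (- y)) * y) / - ln b \<le> \<phi> (exp (- y)) * y"
    proof eventually_elim
      case (elim y)
      have "- ln (measure \<mu> A / 2) * (\<psi> (exp (- y)) * y)
          \<le> - ln (measure \<mu> A / 2) * (\<epsilon> * (\<phi> (exp (- y)) * y))"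
        using elim lnq by (intro mult_left_mono) auto
      also have "\<dots> = \<phi> (exp (- y)) * y * - ln b"
      proof -
        have "z * (x / z * w) = w * x" if "z \<noteq> 0" for x z w :: real using that by simp
        then show ?thesis unfolding \<epsilon>_def using lnq by (metis less_irrefl)
      qed
      finally show ?case by (rule pos_divide_le_eq[OF lnb, THEN iffD2])
    qed
    have "AE \<omega> in label_sequences \<mu>. ereal t \<le> generalised_assouad_spectrum \<psi> (random_set N f \<Delta> \<omega>)"
      by (rule AE_spectrum_ge[OF \<phi> div \<psi> lim _ _ _ ev])
        (use ratio_sum_ge_1_sets t(2) in \<open>auto simp: A_def\<close>)
    then show ?thesis
    proof eventually_elim
      case (elim \<omega>)
      have "ereal (s\<^sub>A - 1 / Suc n) \<le> ereal t" using t(1) by simp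
      then show ?case using elim by (rule order_trans)
    qed
  qed
  then have "AE \<omega> in label_sequences \<mu>. \<forall>n. ereal (s\<^sub>A - 1 / Suc n) \<le> generalised_assouad_spectrum \<psi> (random_set N f \<Delta> \<omega>)"
    unfolding AE_all_countable by blast
  then show "AE \<omega> in label_sequences \<mu>. ereal s\<^sub>A \<le> generalised_assouad_spectrum \<psi> (random_set N f \<Delta> \<omega>)"
  proof eventually_elim
    case (elim \<omega>)
    have "ereal s\<^sub>A \<le> generalised_assouad_spectrum \<psi> (random_set N f \<Delta> \<omega>) + ereal e" if e: "0 < e" for e
    proof -
      obtain n where "inverse (real (Suc n)) < e" using reals_Archimedean[OF e] by blast
      then have "ereal s\<^sub>A \<le> ereal (s\<^sub>A - 1 / Suc n) + ereal e" by (simp add: inverse_eq_divide)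
      also have "\<dots> \<le> generalised_assouad_spectrum \<psi> (random_set N f \<Delta> \<omega>) + ereal e"
        using elim by (intro add_right_mono) blast
      finally show ?thesis .
    qed
    then show ?case by (rule ereal_le_epsilon2)
  qed
qed

text \<open>The critical exponent is attained on A, so one label set suffices. C depends on b and on
  the measure of A, hence not on \<psi>.\<close>

lemma AE_spectrum_eq_comparable:
  assumes \<phi>: "dimension_function \<phi>"
    and div: "\<not> summable (\<lambda>k. exp (- \<phi> (exp (- real (Suc k))) * real (Suc k)))"
    and A: "A \<in> sets \<mu>" "0 < measure \<mu> A" "\<And>l. l \<in> A \<Longrightarrow> ratio_sum N c l s\<^sub>A = 1"
  shows "\<exists>C>0. \<forall>\<psi>. dimension_function \<psi> \<and> filterlim (\<lambda>x. \<psi> x * \<bar>ln x\<bar>) at_top (at_right 0) \<and>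
      (\<forall>x\<in>{0<..<1}. \<psi> x \<le> C * \<phi> x) \<longrightarrow>
    (AE \<omega> in label_sequences \<mu>. generalised_assouad_spectrum \<psi> (random_set N f \<Delta> \<omega>)
      = assouad_dimension (random_set N f \<Delta> \<omega>))"
proof -
  have q: "0 < measure \<mu> A / 2" "measure \<mu> A / 2 < 1"
    using A(2) \<mu>.prob_le_1[of A] by linarith+
  have lnb: "0 < - ln b" using ab by simp
  define C where "C = - ln b / - ln (measure \<mu> A / 2)"
  have lnq: "0 < - ln (measure \<mu> A / 2)" using q by simp
  have C: "0 < C" unfolding C_def using lnb lnq by (rule divide_pos_pos)
  have "AE \<omega> in label_sequences \<mu>. generalised_assouad_spectrum \<psi> (random_set N f \<Delta> \<omega>)
      = assouad_dimension (random_set N f \<Delta> \<omega>)"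
    if \<psi>: "dimension_function \<psi>" and lim: "filterlim (\<lambda>x. \<psi> x * \<bar>ln x\<bar>) at_top (at_right 0)"
      and le: "\<forall>x\<in>{0<..<1}. \<psi> x \<le> C * \<phi> x" for \<psi>
  proof (rule AE_spectrum_eq[OF \<psi>], rule AE_spectrum_ge[OF \<phi> div \<psi> lim A(1,2)])
    show "\<forall>\<^sub>F y in at_top. - ln (measure \<mu> A / 2) * (\<psi> (exp (- y)) * y) / - ln b \<le> \<phi> (exp (- y)) * y"
      using eventually_gt_at_top[of 0]
    proof eventually_elim
      case (elim y)
      then have "exp (- y) \<in> {0<..<1}" by simp
      then have "\<psi> (exp (- y)) \<le> C * \<phi> (exp (- y))" using le by blast
      then have "\<psi> (exp (- y)) * y \<le> C * \<phi> (exp (- y)) * y" using elim by (intro mult_right_mono) auto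
      then have "- ln (measure \<mu> A / 2) * (\<psi> (exp (- y)) * y)
          \<le> - ln (measure \<mu> A / 2) * (C * \<phi> (exp (- y)) * y)"
        using lnq by (intro mult_left_mono) auto
      also have "\<dots> = \<phi> (exp (- y)) * y * - ln b"
      proof -
        have "z * (x / z * v * w) = v * w * x" if "z \<noteq> 0" for x z v w :: real using that by simp
        then show ?thesis unfolding C_def using lnq by (metis less_irrefl)
      qed
      finally show ?case by (rule pos_divide_le_eq[OF lnb, THEN iffD2])
    qed
  qed (use A(3) in simp)
  with C show ?thesis by blast
qed

end

theorem theorem2p6:
  fixes \<Lambda> :: "'a::euclidean_space set"
    and \<mu> :: "'a measure"
    and V \<Delta> :: "'b::euclidean_space set"
    and N :: "'a \<Rightarrow> nat"
    and f :: "'a \<Rightarrow> nat \<Rightarrow> 'b \<Rightarrow> 'b"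
    and c :: "'a \<Rightarrow> nat \<Rightarrow> real"
  assumes "one_variable_RIFS \<Lambda> \<mu> V N f c \<Delta>"
    and "homogeneous \<Lambda> N c"
    and "uniform_open_set_condition \<Lambda> V N f"
    and "\<not> almost_deterministic \<mu> N c"
  shows
    "(\<forall>\<phi>. dimension_function \<phi> \<and>
           summable (\<lambda>k. exp (- \<phi> (exp (- real (Suc k))) * real (Suc k))) \<longrightarrow>
        (\<forall>\<psi>. dimension_function \<psi> \<and> ((\<lambda>x. \<phi> x / \<psi> x) \<longlongrightarrow> 0) (at_right 0) \<longrightarrow>
           (AE \<omega> in label_sequences \<mu>.
              has_box_dimension (random_set N f \<Delta> \<omega>)
                (generalised_assouad_spectrum \<psi> (random_set N f \<Delta> \<omega>)))))
     \<and>
     (\<forall>\<phi>. dimension_function \<phi> \<and>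
           \<not> summable (\<lambda>k. exp (- \<phi> (exp (- real (Suc k))) * real (Suc k))) \<longrightarrow>
        (\<forall>\<psi>. dimension_function \<psi> \<and> filterlim (\<lambda>x. \<psi> x * \<bar>ln x\<bar>) at_top (at_right 0) \<and>
             ((\<lambda>x. \<psi> x / \<phi> x) \<longlongrightarrow> 0) (at_right 0) \<longrightarrow>
           (AE \<omega> in label_sequences \<mu>.
              generalised_assouad_spectrum \<psi> (random_set N f \<Delta> \<omega>)
                = assouad_dimension (random_set N f \<Delta> \<omega>))))
     \<and>
     (\<forall>\<phi>. dimension_function \<phi> \<and>
           \<not> summable (\<lambda>k. exp (- \<phi> (exp (- real (Suc k))) * real (Suc k))) \<and>
           (\<exists>\<Lambda>'\<in>sets \<mu>. \<Lambda>' \<subseteq> \<Lambda> \<and> measure \<mu> \<Lambda>' > 0 \<and>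
              (\<forall>l\<in>\<Lambda>'. ratio_sum N c l (assouad_exponent \<mu> N c) = 1)) \<longrightarrow>
        (\<exists>C>0. \<forall>\<psi>. dimension_function \<psi> \<and> filterlim (\<lambda>x. \<psi> x * \<bar>ln x\<bar>) at_top (at_right 0) \<and>
             (\<forall>x\<in>{0<..<1}. \<psi> x \<le> C * \<phi> x) \<longrightarrow>
           (AE \<omega> in label_sequences \<mu>.
              generalised_assouad_spectrum \<psi> (random_set N f \<Delta> \<omega>)
                = assouad_dimension (random_set N f \<Delta> \<omega>))))"
proof -
  interpret one_variable_RIFS \<Lambda> \<mu> V N f c \<Delta> by fact
  obtain U a b D \<delta> u where "homogeneous_RIFS \<Lambda> \<mu> V \<Delta> N f c U a b D \<delta> u"
  proof (rule homogeneous_iterations[OF assms(2,3)])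
    fix U a b D \<delta> u
    assume "0 < a" "0 < b" "b < 1" "\<And>l. l \<in> \<Lambda> \<Longrightarrow> a \<le> c l 1 \<and> c l 1 \<le> b"
      "\<And>\<omega>. (\<And>j. \<omega> j \<in> \<Lambda>) \<Longrightarrow> homogeneous_iteration V U \<Delta> N f \<omega> (\<lambda>j. c (\<omega> j) 1) a b D \<delta> u"
    have "homogeneous_RIFS \<Lambda> \<mu> V \<Delta> N f c U a b D \<delta> u"
      by (intro homogeneous_RIFS.intro homogeneous_RIFS_axioms.intro assms(1,2)) fact+
    then show thesis by (rule that)
  qed
  then interpret homogeneous_RIFS \<Lambda> \<mu> V \<Delta> N f c U a b D \<delta> u .
  show ?thesis
  proof (intro conjI allI impI; elim conjE bexE)
    fix \<phi> \<psi>
    assume "dimension_function \<phi>" "summable (\<lambda>k. exp (- \<phi> (exp (- real (Suc k))) * real (Suc k)))"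
      "dimension_function \<psi>" "((\<lambda>x. \<phi> x / \<psi> x) \<longlongrightarrow> 0) (at_right 0)"
    then show "AE \<omega> in label_sequences \<mu>. has_box_dimension (random_set N f \<Delta> \<omega>)
        (generalised_assouad_spectrum \<psi> (random_set N f \<Delta> \<omega>))"
      by (rule AE_box_dimension)
  next
    fix \<phi> \<psi>
    assume "dimension_function \<phi>" "\<not> summable (\<lambda>k. exp (- \<phi> (exp (- real (Suc k))) * real (Suc k)))"
      "dimension_function \<psi>" "filterlim (\<lambda>x. \<psi> x * \<bar>ln x\<bar>) at_top (at_right 0)"
      "((\<lambda>x. \<psi> x / \<phi> x) \<longlongrightarrow> 0) (at_right 0)"
    then show "AE \<omega> in label_sequences \<mu>. generalised_assouad_spectrum \<psi> (random_set N f \<Delta> \<omega>)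
        = assouad_dimension (random_set N f \<Delta> \<omega>)"
      by (rule AE_spectrum_eq_small)
  next
    fix \<phi> A
    assume "dimension_function \<phi>" "\<not> summable (\<lambda>k. exp (- \<phi> (exp (- real (Suc k))) * real (Suc k)))"
      "A \<in> sets \<mu>" "0 < measure \<mu> A" "\<forall>l\<in>A. ratio_sum N c l (assouad_exponent \<mu> N c) = 1"
    then show "\<exists>C>0. \<forall>\<psi>. dimension_function \<psi> \<and> filterlim (\<lambda>x. \<psi> x * \<bar>ln x\<bar>) at_top (at_right 0) \<and>
        (\<forall>x\<in>{0<..<1}. \<psi> x \<le> C * \<phi> x) \<longrightarrow>
      (AE \<omega> in label_sequences \<mu>. generalised_assouad_spectrum \<psi> (random_set N f \<Delta> \<omega>)
        = assouad_dimension (random_set N f \<Delta> \<omega>))"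
      by (intro AE_spectrum_eq_comparable) auto
  qed
qed

end
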